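(* Let $X$ be a smooth irreducible quasi-projective variety of dimension $n$ over an algebraically closed field $K$ of characteristic $0$, let $P\in X$, let $U$ be an étale chart of $X$ containing $P$, $A=\mathcal{O}(U)$, $V=\mathrm{Der}(A)$. Let $W$ be a rational finite-dimensional $\widehat L_+$-module and let $N\geq1$ be an integer such that $\mathfrak m^N\widehat L_+$ annihilates $W$. Then the Rudakov module $R_P^W$ is differentiable: it is annihilated by $\Delta^{N+1}\otimes_AV$.
   Context: **Étale charts.** An affine open $U\subset X$ is an étale chart with uniformizing parameters $x_1,\dots,x_n\in A=\mathcal{O}(U)$ if (1) $x_1,\dots,x_n$ are algebraically independent over $K$; (2) every $f\in A$ is algebraic over $K[x_1,\dots,x_n]$; (3) the derivations $\frac{\partial}{\partial x_i}$ of $K[x_1,\dots,x_n]$ extend to derivations of $A$. Then $V=\bigoplus_iA\frac{\partial}{\partial x_i}$. For $s\in\mathbb{Z}_+^n$, $|s|=\sum s_i$, $s!=\prod s_i!$, $X^s=\prod X_i^{s_i}$. **$\widehat L_+$.** Let $\mathfrak m=\langle X_1,\dots,X_n\rangle\subset K[[X_1,\dots,X_n]]$ and $\widehat L_+=\bigoplus_i\mathfrak m\frac{\partial}{\partial X_i}$, with subalgebra $L_0=\mathrm{Span}\{X_j\frac{\partial}{\partial X_i}\}\cong\mathfrak{gl}_n$. A finite-dimensional $\widehat L_+$-module $(W,\rho)$ is rational if the $L_0$-action integrates to a rational $GL_n$-module. It is a fact that each finite-dimensional $\widehat L_+$-module is annihilated by some $\mathfrak m^N\widehat L_+$. **Algebras.**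 $A\#U(V)$ is $A\otimes_KU(V)$ with algebra structure determined by $\eta\cdot f=\eta(f)+f\cdot\eta$ for $\eta\in V$, $f\in A$. Its subspace $A\#V=A\otimes_KV$ is identified with $(A\otimes_KA)\otimes_AV$ by $g\#f\eta=(g\otimes f)\otimes\eta$. $\Delta$ is the kernel of the multiplication map $A\otimes_KA\to A$, so $\Delta^m\otimes_AV\subset A\#V$. An $AV$-module (i.e. an $A\#U(V)$-module) $M$ is differentiable if there is $N'\ge1$ such that all elements $\sum_{k=0}^{N'}(-1)^k\binom{N'}{k}f^k\#f^{N'-k}\eta$ ($f\in A$, $\eta\in V$) annihilate $M$; equivalently, $\Delta^{N'}\otimes_AV$ annihilates $M$. **Rudakov modules.** Let $\mathfrak m_P\subset A$ be the maximal ideal of $P$. The Lie algebra $\mathfrak m_PV$ acts on $W$ by $$f\frac{\partial}{\partial x_i}\mapsto\sum_{0<|s|\le N}\frac1{s!}\frac{\partial^sf}{\partial x^s}(P)\,\rho\left(X^s\frac{\partial}{\partial X_i}\right),\quad f\in\mathfrak m_P,$$ so that $\mathfrak m_P^{N+1}V$ acts trivially, and $A$ acts on $W$ by $fw=f(P)w$. Thus $W$ is a module over the subalgebra $A\#U(\mathfrak m_PV)\subset A\#U(V)$, and $R_P^W=A\#U(V)\otimes_{A\#U(\mathfrak m_PV)}W$. *)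

theory Defs
  imports
    "HOL-Library.Poly_Mapping"
    "HOL-Library.Function_Algebras"
    "HOL-Library.Indicator_Function"
    "HOL-Computational_Algebra.Polynomial"
    "HOL-Computational_Algebra.Group_Closure"
    "HOL-Algebra.Free_Abelian_Groups"
    "HOL-Algebra.QuotRing"
    "HOL-Algebra.Ideal_Product"
    "HOL-Algebra.Module"
    "HOL-Analysis.Abstract_Topology"
    "Jordan_Normal_Form.Determinant"
begin

section \<open>Multivariate polynomials\<close>

text \<open>
  Polynomials in variables of type \<open>'x\<close> are finitely supported maps from monomials
  (finitely supported exponents) to coefficients.  Variables and coordinates are numbered from
  \<open>0\<close>; those with index \<open>< n\<close> play the role of $1,\dots,n$.
\<close>

type_synonym ('x, 'k) mpoly = "('x \<Rightarrow>\<^sub>0 nat) \<Rightarrow>\<^sub>0 'k"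

definition peval :: "('x \<Rightarrow> 'k::comm_ring_1) \<Rightarrow> ('x, 'k) mpoly \<Rightarrow> 'k" where
  "peval v p = (\<Sum>s\<in>Poly_Mapping.keys p.
     Poly_Mapping.lookup p s * (\<Prod>i\<in>Poly_Mapping.keys s. v i ^ Poly_Mapping.lookup s i))"

definition mpderiv :: "'x \<Rightarrow> ('x, 'k::comm_ring_1) mpoly \<Rightarrow> ('x, 'k) mpoly" where
  "mpderiv i p = (\<Sum>s\<in>Poly_Mapping.keys p.
     Poly_Mapping.single (s - Poly_Mapping.single i 1)
       (of_nat (Poly_Mapping.lookup s i) * Poly_Mapping.lookup p s))"

definition mdeg :: "('x \<Rightarrow>\<^sub>0 nat) \<Rightarrow> nat" where
  "mdeg s = (\<Sum>i\<in>Poly_Mapping.keys s. Poly_Mapping.lookup s i)"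

definition mfact :: "('x \<Rightarrow>\<^sub>0 nat) \<Rightarrow> 'k::field_char_0" where
  "mfact s = (\<Prod>i\<in>Poly_Mapping.keys s. fact (Poly_Mapping.lookup s i))"

definition homogeneous :: "nat \<Rightarrow> ('x, 'k::zero) mpoly \<Rightarrow> bool" where
  "homogeneous d p \<longleftrightarrow> (\<forall>s\<in>Poly_Mapping.keys p. mdeg s = d)"

definition polys :: "nat \<Rightarrow> (nat, 'k::zero) mpoly set" where
  "polys n = {p. \<forall>s\<in>Poly_Mapping.keys p. Poly_Mapping.keys s \<subseteq> {..<n}}"

definition cscale :: "'k::times \<Rightarrow> ('i \<Rightarrow> 'k) \<Rightarrow> ('i \<Rightarrow> 'k)" where
  "cscale c f = (\<lambda>i. c * f i)"


section \<open>Quasi-projective varieties\<close>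

text \<open>
  A point of $\mathbb{P}^m$ is the set of its homogeneous coordinate vectors.
\<close>

type_synonym 'k pt = "(nat \<Rightarrow> 'k) set"

definition proj_space :: "nat \<Rightarrow> 'k::field pt set" where
  "proj_space m = {{cscale c v | c. c \<noteq> 0} | v. v \<noteq> 0 \<and> (\<forall>i>m. v i = 0)}"

definition basic_open :: "nat \<Rightarrow> (nat, 'k::field) mpoly \<Rightarrow> 'k pt set" where
  "basic_open m F = {p \<in> proj_space m. \<forall>v\<in>p. peval v F \<noteq> 0}"

definition zariski :: "nat \<Rightarrow> 'k::field pt topology" where
  "zariski m = topology_generated_by {basic_open m F | F. \<exists>d. homogeneous d F}"

definition quasi_projective :: "nat \<Rightarrow> 'k::field pt set \<Rightarrow> bool" where
  "quasi_projective m X \<longleftrightarrow>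
     (\<exists>O' C. openin (zariski m) O' \<and> closedin (zariski m) C \<and> X = O' \<inter> C)"

definition irreducible_in :: "'a topology \<Rightarrow> 'a set \<Rightarrow> bool" where
  "irreducible_in T S \<longleftrightarrow> S \<noteq> {} \<and> S \<subseteq> topspace T \<and>
     (\<forall>C D. closedin T C \<and> closedin T D \<and> S \<subseteq> C \<union> D \<longrightarrow> S \<subseteq> C \<or> S \<subseteq> D)"

definition closed_chain :: "'a topology \<Rightarrow> nat \<Rightarrow> bool" where
  "closed_chain T n \<longleftrightarrow> (\<exists>C. (\<forall>i\<le>n. closedin T (C i) \<and> irreducible_in T (C i)) \<and>
     (\<forall>i<n. C i \<subset> C (Suc i)))"

definition krull_dim :: "'a topology \<Rightarrow> nat \<Rightarrow> bool" where
  "krull_dim T n \<longleftrightarrow> closed_chain T n \<and> \<not> closed_chain T (Suc n)"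

text \<open>
  The tangent space at the point with coordinate vector \<open>v\<close> is the affine cone over the embedded
  projective tangent space; smoothness is the Jacobian criterion (rank $m - n$ at every point).
\<close>

definition tangent_cone :: "nat \<Rightarrow> 'k::field pt set \<Rightarrow> (nat \<Rightarrow> 'k) \<Rightarrow> (nat \<Rightarrow> 'k) set" where
  "tangent_cone m X v = {t. (\<forall>i>m. t i = 0) \<and>
     (\<forall>F d. homogeneous d F \<and> (\<forall>q\<in>X. \<forall>u\<in>q. peval u F = 0) \<longrightarrow>
        (\<Sum>i\<le>m. peval v (mpderiv i F) * t i) = 0)}"

definition smooth_of_dim :: "nat \<Rightarrow> nat \<Rightarrow> 'k::field pt set \<Rightarrow> bool" where
  "smooth_of_dim m n X \<longleftrightarrow> krull_dim (subtopology (zariski m) X) n \<and>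
     (\<forall>p\<in>X. \<forall>v\<in>p. vector_space.dim cscale (tangent_cone m X v) = n + 1)"

text \<open>
  Regular functions on \<open>U\<close> are extended by \<open>0\<close> outside \<open>U\<close>.  Thus $\mathcal{O}(U)$ is a set
  of functions closed under the pointwise operations, and its unit element is
  \<open>indicator U\<close>.
\<close>

type_synonym 'k fn = "'k pt \<Rightarrow> 'k"

definition regular :: "nat \<Rightarrow> 'k::field pt set \<Rightarrow> 'k fn set" where
  "regular m U = {f. (\<forall>q. q \<notin> U \<longrightarrow> f q = 0) \<and>
     (\<forall>p\<in>U. \<exists>O' d F G. openin (subtopology (zariski m) U) O' \<and> p \<in> O' \<and>
        homogeneous d F \<and> homogeneous d G \<and>
        (\<forall>q\<in>O'. \<forall>v\<in>q. peval v G \<noteq> 0 \<and> f q = peval v F / peval v G))}"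

definition morphism ::
  "nat \<Rightarrow> 'k::field pt set \<Rightarrow> nat \<Rightarrow> 'k pt set \<Rightarrow> ('k pt \<Rightarrow> 'k pt) \<Rightarrow> bool" where
  "morphism m U m' U' \<phi> \<longleftrightarrow>
     continuous_map (subtopology (zariski m) U) (subtopology (zariski m') U') \<phi> \<and>
     (\<forall>O' f. openin (subtopology (zariski m') U') O' \<and> f \<in> regular m' O' \<longrightarrow>
        (\<lambda>q. if q \<in> U then f (\<phi> q) else 0) \<in> regular m {q \<in> U. \<phi> q \<in> O'})"

definition standard_chart :: "nat \<Rightarrow> 'k::field pt set" where
  "standard_chart k = {p \<in> proj_space k. \<forall>v\<in>p. v 0 \<noteq> 0}"

text \<open>Affine means isomorphic to a closed subset of some affine space $\mathbb{A}^k$, the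
  latter viewed as the standard chart of $\mathbb{P}^k$.\<close>

definition affine_variety :: "nat \<Rightarrow> 'k::field pt set \<Rightarrow> bool" where
  "affine_variety m U \<longleftrightarrow>
     (\<exists>k Z \<phi> \<psi>. closedin (subtopology (zariski k) (standard_chart k)) Z \<and>
        morphism m U k Z \<phi> \<and> morphism k Z m U \<psi> \<and>
        (\<forall>q\<in>U. \<psi> (\<phi> q) = q) \<and> (\<forall>z\<in>Z. \<phi> (\<psi> z) = z))"


section \<open>Derivations and etale charts\<close>

text \<open>Derivations of \<open>A\<close> are extended by \<open>0\<close> outside \<open>A\<close>, so that the Lie algebra and
  \<open>A\<close>-module operations on them are computed pointwise.\<close>

definition Der :: "'k::field fn set \<Rightarrow> ('k fn \<Rightarrow> 'k fn) set" where
  "Der A = {D. (\<forall>f\<in>A. D f \<in> A) \<and> (\<forall>f. f \<notin> A \<longrightarrow> D f = 0) \<and>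
     (\<forall>f\<in>A. \<forall>g\<in>A. D (f + g) = D f + D g) \<and>
     (\<forall>c. \<forall>f\<in>A. D (cscale c f) = cscale c (D f)) \<and>
     (\<forall>f\<in>A. \<forall>g\<in>A. D (f * g) = D f * g + f * D g)}"

definition fmul :: "'k::field fn \<Rightarrow> ('k fn \<Rightarrow> 'k fn) \<Rightarrow> ('k fn \<Rightarrow> 'k fn)" where
  "fmul f D = (\<lambda>h. f * D h)"

definition lie :: "('k::field fn \<Rightarrow> 'k fn) \<Rightarrow> ('k fn \<Rightarrow> 'k fn) \<Rightarrow> ('k fn \<Rightarrow> 'k fn)" where
  "lie D E = (\<lambda>h. D (E h) - E (D h))"

definition peval_on ::
  "'k::field pt set \<Rightarrow> (nat \<Rightarrow> 'k fn) \<Rightarrow> (nat, 'k) mpoly \<Rightarrow> 'k fn" where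
  "peval_on U x p = (\<lambda>q. if q \<in> U then peval (\<lambda>i. x i q) p else 0)"

text \<open>\<open>pd i\<close> is the extension of $\partial/\partial x_i$ from $K[x_1,\dots,x_n]$ to
  $\mathcal{O}(U)$; it is made part of the data of the chart.\<close>

definition etale_chart ::
  "nat \<Rightarrow> 'k::field pt set \<Rightarrow> nat \<Rightarrow> 'k pt set \<Rightarrow> (nat \<Rightarrow> 'k fn) \<Rightarrow>
   (nat \<Rightarrow> 'k fn \<Rightarrow> 'k fn) \<Rightarrow> bool" where
  "etale_chart m X n U x pd \<longleftrightarrow>
     openin (subtopology (zariski m) X) U \<and> affine_variety m U \<and>
     (\<forall>i<n. x i \<in> regular m U) \<and>
     (\<forall>p\<in>polys n. peval_on U x p = 0 \<longrightarrow> p = 0) \<and>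
     (\<forall>f\<in>regular m U. \<exists>d c. (\<forall>k\<le>d. c k \<in> peval_on U x ` polys n) \<and>
        (\<exists>k\<le>d. c k \<noteq> 0) \<and> (\<Sum>k\<le>d. c k * f ^ k) = 0) \<and>
     (\<forall>i<n. pd i \<in> Der (regular m U) \<and>
        (\<forall>p\<in>polys n. pd i (peval_on U x p) = peval_on U x (mpderiv i p)))"

definition pd_pow ::
  "nat \<Rightarrow> (nat \<Rightarrow> 'k::field fn \<Rightarrow> 'k fn) \<Rightarrow> (nat \<Rightarrow>\<^sub>0 nat) \<Rightarrow> 'k fn \<Rightarrow> 'k fn" where
  "pd_pow n pd s = foldr (\<lambda>i. pd i ^^ Poly_Mapping.lookup s i) [0..<n]"


section \<open>The Lie algebra of formal vector fields vanishing at the origin\<close>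

type_synonym 'k ps = "(nat \<Rightarrow>\<^sub>0 nat) \<Rightarrow> 'k"
type_synonym 'k vf = "nat \<Rightarrow> 'k ps"

definition ps_carrier :: "nat \<Rightarrow> 'k::field ps set" where
  "ps_carrier n = {f. \<forall>s. f s \<noteq> 0 \<longrightarrow> Poly_Mapping.keys s \<subseteq> {..<n}}"

definition ps_mult :: "'k::field ps \<Rightarrow> 'k ps \<Rightarrow> 'k ps" where
  "ps_mult f g = (\<lambda>s. \<Sum>(a, b)\<in>{(a, b). a + b = s}. f a * g b)"

definition ps_deriv :: "nat \<Rightarrow> 'k::field ps \<Rightarrow> 'k ps" where
  "ps_deriv i f =
     (\<lambda>s. of_nat (Poly_Mapping.lookup s i + 1) * f (s + Poly_Mapping.single i 1))"

definition ps_max :: "nat \<Rightarrow> 'k::field ps set" where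
  "ps_max n = {f \<in> ps_carrier n. f 0 = 0}"

fun ps_max_pow :: "nat \<Rightarrow> nat \<Rightarrow> 'k::field ps set" where
  "ps_max_pow n 0 = ps_carrier n"
| "ps_max_pow n (Suc k) = group_closure {ps_mult f g | f g. f \<in> ps_max n \<and> g \<in> ps_max_pow n k}"

text \<open>A formal vector field $\sum_i v_i\,\partial/\partial X_i$ is the family of its
  components.\<close>

definition Lplus :: "nat \<Rightarrow> 'k::field vf set" where
  "Lplus n = {v. (\<forall>i<n. v i \<in> ps_max n) \<and> (\<forall>i\<ge>n. v i = 0)}"

definition vf_bracket :: "nat \<Rightarrow> 'k::field vf \<Rightarrow> 'k vf \<Rightarrow> 'k vf" where
  "vf_bracket n v w = (\<lambda>j. \<Sum>i<n. ps_mult (v i) (ps_deriv i (w j)) - ps_mult (w i) (ps_deriv i (v j)))"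

definition max_pow_Lplus :: "nat \<Rightarrow> nat \<Rightarrow> 'k::field vf set" where
  "max_pow_Lplus n N =
     group_closure {(\<lambda>i. ps_mult f (v i)) | f v. f \<in> ps_max_pow n N \<and> v \<in> Lplus n}"

definition monom_vf :: "(nat \<Rightarrow>\<^sub>0 nat) \<Rightarrow> nat \<Rightarrow> 'k::field vf" where
  "monom_vf s i = (\<lambda>j a. if j = i \<and> a = s then 1 else 0)"

definition fd_Lplus_module ::
  "nat \<Rightarrow> ('k::field \<Rightarrow> 'w::ab_group_add \<Rightarrow> 'w) \<Rightarrow> ('k vf \<Rightarrow> 'w \<Rightarrow> 'w) \<Rightarrow> bool" where
  "fd_Lplus_module n scale \<rho> \<longleftrightarrow>
     (\<exists>Basis. finite_dimensional_vector_space scale Basis) \<and>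
     (\<forall>v\<in>Lplus n. Vector_Spaces.linear scale scale (\<rho> v)) \<and>
     (\<forall>u\<in>Lplus n. \<forall>v\<in>Lplus n. \<forall>w. \<rho> (u + v) w = \<rho> u w + \<rho> v w) \<and>
     (\<forall>c. \<forall>v\<in>Lplus n. \<forall>w. \<rho> (\<lambda>i. cscale c (v i)) w = scale c (\<rho> v w)) \<and>
     (\<forall>u\<in>Lplus n. \<forall>v\<in>Lplus n. \<forall>w.
        \<rho> (vf_bracket n u v) w = \<rho> u (\<rho> v w) - \<rho> v (\<rho> u w))"

text \<open>Rational representations of $GL_n$: the matrix coefficients are polynomials in the entries
  divided by powers of the determinant.\<close>

definition GL :: "nat \<Rightarrow> 'k::field mat set" where
  "GL n = {g \<in> carrier_mat n n. det g \<noteq> 0}"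

definition regular_GL :: "nat \<Rightarrow> ('k::field mat \<Rightarrow> 'k) \<Rightarrow> bool" where
  "regular_GL n F \<longleftrightarrow> (\<exists>(p :: (nat \<times> nat, 'k) mpoly) r. \<forall>g\<in>GL n.
     F g = peval (\<lambda>(i, j). if i < n \<and> j < n then g $$ (i, j) else 0) p / det g ^ r)"

definition rational_GL_module ::
  "nat \<Rightarrow> ('k::field \<Rightarrow> 'w::ab_group_add \<Rightarrow> 'w) \<Rightarrow> ('k mat \<Rightarrow> 'w \<Rightarrow> 'w) \<Rightarrow> bool" where
  "rational_GL_module n scale \<Phi> \<longleftrightarrow>
     (\<forall>g\<in>GL n. Vector_Spaces.linear scale scale (\<Phi> g)) \<and>
     (\<forall>w. \<Phi> (1\<^sub>m n) w = w) \<and>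
     (\<forall>g\<in>GL n. \<forall>h\<in>GL n. \<forall>w. \<Phi> (g * h) w = \<Phi> g (\<Phi> h w)) \<and>
     (\<forall>w l. Vector_Spaces.linear scale (*) l \<longrightarrow> regular_GL n (\<lambda>g. l (\<Phi> g w)))"

text \<open>\<open>deriv_at_one n F M d\<close>: the rational function $t \mapsto F(1 + tM)$ has derivative \<open>d\<close>
  at $t = 0$.\<close>

definition deriv_at_one :: "nat \<Rightarrow> ('k::field mat \<Rightarrow> 'k) \<Rightarrow> 'k mat \<Rightarrow> 'k \<Rightarrow> bool" where
  "deriv_at_one n F M d \<longleftrightarrow> (\<exists>a b :: 'k poly. poly b 0 \<noteq> 0 \<and>
     (\<forall>t. 1\<^sub>m n + t \<cdot>\<^sub>m M \<in> GL n \<and> poly b t \<noteq> 0 \<longrightarrow> F (1\<^sub>m n + t \<cdot>\<^sub>m M) = poly a t / poly b t) \<and>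
     d = (poly (pderiv a) 0 * poly b 0 - poly a 0 * poly (pderiv b) 0) / (poly b 0)\<^sup>2)"

text \<open>The isomorphism $\mathfrak{gl}_n \cong L_0$ sends the matrix unit $E_{ji}$ to
  $X_j\,\partial/\partial X_i$.\<close>

definition linear_vf :: "nat \<Rightarrow> 'k::field mat \<Rightarrow> 'k vf" where
  "linear_vf n M = (\<lambda>i. if i < n
     then \<Sum>j<n. cscale (M $$ (j, i)) (monom_vf (Poly_Mapping.single j 1) i i) else 0)"

definition rational_Lplus_module ::
  "nat \<Rightarrow> ('k::field \<Rightarrow> 'w::ab_group_add \<Rightarrow> 'w) \<Rightarrow> ('k vf \<Rightarrow> 'w \<Rightarrow> 'w) \<Rightarrow> bool" where
  "rational_Lplus_module n scale \<rho> \<longleftrightarrow> fd_Lplus_module n scale \<rho> \<and>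
     (\<exists>\<Phi>. rational_GL_module n scale \<Phi> \<and>
        (\<forall>M\<in>carrier_mat n n. \<forall>w l. Vector_Spaces.linear scale (*) l \<longrightarrow>
           deriv_at_one n (\<lambda>g. l (\<Phi> g w)) M (l (\<rho> (linear_vf n M) w))))"


section \<open>Tensor products\<close>

text \<open>
  \<open>M \<otimes> N\<close> over a ring is the free abelian group on \<open>M \<times> N\<close> modulo the subgroup generated by the
  biadditivity and balancing relations.  Scalars \<open>c \<in> C\<close> act on \<open>M\<close> by \<open>r\<close> from the right and on
  \<open>N\<close> by \<open>l\<close> from the left; additions on \<open>M\<close> and \<open>N\<close> are passed explicitly.
\<close>

definition tensor_rels ::
  "'m set \<Rightarrow> ('m \<Rightarrow> 'm \<Rightarrow> 'm) \<Rightarrow> 'n set \<Rightarrow> ('n \<Rightarrow> 'n \<Rightarrow> 'n) \<Rightarrow> 'c set \<Rightarrow>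
   ('m \<Rightarrow> 'c \<Rightarrow> 'm) \<Rightarrow> ('c \<Rightarrow> 'n \<Rightarrow> 'n) \<Rightarrow> (('m \<times> 'n) \<Rightarrow>\<^sub>0 int) set" where
  "tensor_rels M addM N addN C r l = group_closure
     ({frag_of (addM a a', b) - frag_of (a, b) - frag_of (a', b) | a a' b.
         a \<in> M \<and> a' \<in> M \<and> b \<in> N}
      \<union> {frag_of (a, addN b b') - frag_of (a, b) - frag_of (a, b') | a b b'.
         a \<in> M \<and> b \<in> N \<and> b' \<in> N}
      \<union> {frag_of (r a c, b) - frag_of (a, l c b) | a c b. a \<in> M \<and> c \<in> C \<and> b \<in> N})"

text \<open>The commutative ring $A \otimes_K A$, the kernel \<open>\<Delta>\<close> of multiplication, and its powers.\<close>

definition tensor_square_free :: "'k::field pt set \<Rightarrow> 'k fn set \<Rightarrow> (('k fn \<times> 'k fn) \<Rightarrow>\<^sub>0 int) ring" where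
  "tensor_square_free U A =
     \<lparr>carrier = {t. Poly_Mapping.keys t \<subseteq> A \<times> A},
      monoid.mult = (\<lambda>s t. frag_extend (\<lambda>(a, b). frag_extend (\<lambda>(c, d). frag_of (a * c, b * d)) t) s),
      one = frag_of (indicator U, indicator U), zero = 0, add = (+)\<rparr>"

definition tensor_square :: "'k::field pt set \<Rightarrow> 'k fn set \<Rightarrow> (('k fn \<times> 'k fn) \<Rightarrow>\<^sub>0 int) set ring" where
  "tensor_square U A =
     tensor_square_free U A Quot tensor_rels A (+) A (+) UNIV (\<lambda>f c. cscale c f) cscale"

definition mult_map :: "(('k::field fn \<times> 'k fn) \<Rightarrow>\<^sub>0 int) \<Rightarrow> 'k fn" where
  "mult_map t = (\<Sum>(g, f)\<in>Poly_Mapping.keys t. of_int (Poly_Mapping.lookup t (g, f)) * (g * f))"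

definition Delta :: "'k::field pt set \<Rightarrow> 'k fn set \<Rightarrow> (('k fn \<times> 'k fn) \<Rightarrow>\<^sub>0 int) set set" where
  "Delta U A = {T \<in> carrier (tensor_square U A). the_elem (mult_map ` T) = 0}"

definition Delta_pow ::
  "'k::field pt set \<Rightarrow> 'k fn set \<Rightarrow> nat \<Rightarrow> (('k fn \<times> 'k fn) \<Rightarrow>\<^sub>0 int) set set" where
  "Delta_pow U A k = Delta U A [^]\<^bsub>ideals_set (tensor_square U A)\<^esub> k"


section \<open>The smash product $A\#U(\mathfrak{g})$\<close>

text \<open>
  For a Lie subalgebra $\mathfrak{g}$ of $\mathrm{Der}(A)$ we have
  $U(\mathfrak{g}) = K\langle\mathfrak{g}\rangle / I$, where $K\langle\mathfrak{g}\rangle$ is the free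
  algebra on the set $\mathfrak{g}$ and $I$ is generated by linearity and commutator relations, so
  $A \otimes_K U(\mathfrak{g}) = (A \otimes_K K\langle\mathfrak{g}\rangle) / (A \otimes_K I)$.
  An element of $A \otimes_K K\langle\mathfrak{g}\rangle$ is a finitely supported map from words to
  coefficients in \<open>A\<close>; \<open>Poly_Mapping.single [\<eta>\<^sub>1, \<dots>, \<eta>\<^sub>r] f\<close> is $f\#\eta_1\cdots\eta_r$.
\<close>

type_synonym 'k der = "'k fn \<Rightarrow> 'k fn"

text \<open>\<open>straighten f (rev u) g v\<close> is the product $(f\#u)\cdot(g\#v)$, obtained by repeatedly using
  $\eta\cdot g = \eta(g) + g\cdot\eta$ for the last letter \<open>\<eta>\<close> of the word \<open>u\<close>.\<close>

fun straighten ::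
  "'k::field fn \<Rightarrow> 'k der list \<Rightarrow> 'k fn \<Rightarrow> 'k der list \<Rightarrow> ('k der list \<Rightarrow>\<^sub>0 'k fn)" where
  "straighten f [] g v = Poly_Mapping.single v (f * g)"
| "straighten f (\<eta> # u) g v = straighten f u (\<eta> g) v + straighten f u g (\<eta> # v)"

definition smash_free ::
  "'k::field pt set \<Rightarrow> 'k fn set \<Rightarrow> 'k der set \<Rightarrow> ('k der list \<Rightarrow>\<^sub>0 'k fn) ring" where
  "smash_free U A L =
     \<lparr>carrier = {p. Poly_Mapping.keys p \<subseteq> lists L \<and> range (Poly_Mapping.lookup p) \<subseteq> A},
      monoid.mult = (\<lambda>p q. \<Sum>u\<in>Poly_Mapping.keys p. \<Sum>v\<in>Poly_Mapping.keys q.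
                straighten (Poly_Mapping.lookup p u) (rev u) (Poly_Mapping.lookup q v) v),
      one = Poly_Mapping.single [] (indicator U), zero = 0, add = (+)\<rparr>"

definition smash_rels ::
  "'k::field fn set \<Rightarrow> 'k der set \<Rightarrow> ('k der list \<Rightarrow>\<^sub>0 'k fn) set" where
  "smash_rels A L = group_closure
     ({Poly_Mapping.single (u @ [\<eta> + \<mu>] @ v) f - Poly_Mapping.single (u @ [\<eta>] @ v) f
         - Poly_Mapping.single (u @ [\<mu>] @ v) f | u v \<eta> \<mu> f.
         u \<in> lists L \<and> v \<in> lists L \<and> \<eta> \<in> L \<and> \<mu> \<in> L \<and> f \<in> A}
      \<union> {Poly_Mapping.single (u @ [\<lambda>h. cscale c (\<eta> h)] @ v) f
         - Poly_Mapping.single (u @ [\<eta>] @ v) (cscale c f) | u v \<eta> c f.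
         u \<in> lists L \<and> v \<in> lists L \<and> \<eta> \<in> L \<and> f \<in> A}
      \<union> {Poly_Mapping.single (u @ [\<eta>, \<mu>] @ v) f - Poly_Mapping.single (u @ [\<mu>, \<eta>] @ v) f
         - Poly_Mapping.single (u @ [lie \<eta> \<mu>] @ v) f | u v \<eta> \<mu> f.
         u \<in> lists L \<and> v \<in> lists L \<and> \<eta> \<in> L \<and> \<mu> \<in> L \<and> f \<in> A})"

definition smash ::
  "'k::field pt set \<Rightarrow> 'k fn set \<Rightarrow> 'k der set \<Rightarrow> ('k der list \<Rightarrow>\<^sub>0 'k fn) set ring" where
  "smash U A L = smash_free U A L Quot smash_rels A L"

definition smash_class ::
  "'k::field pt set \<Rightarrow> 'k fn set \<Rightarrow> 'k der set \<Rightarrow> ('k der list \<Rightarrow>\<^sub>0 'k fn) \<Rightarrow>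
   ('k der list \<Rightarrow>\<^sub>0 'k fn) set" where
  "smash_class U A L p = smash_rels A L +>\<^bsub>smash_free U A L\<^esub> p"

text \<open>$(\sum_k g_k \otimes f_k) \otimes \eta \mapsto \sum_k g_k \# f_k\eta$, and the image of
  $\Delta^k \otimes_A V$ in $A\#V$.\<close>

definition to_sharp ::
  "(('k::field fn \<times> 'k fn) \<Rightarrow>\<^sub>0 int) \<Rightarrow> 'k der \<Rightarrow> ('k der list \<Rightarrow>\<^sub>0 'k fn)" where
  "to_sharp t \<eta> = (\<Sum>(g, f)\<in>Poly_Mapping.keys t.
     Poly_Mapping.single [fmul f \<eta>] (of_int (Poly_Mapping.lookup t (g, f)) * g))"

definition Delta_pow_V ::
  "'k::field pt set \<Rightarrow> 'k fn set \<Rightarrow> nat \<Rightarrow> ('k der list \<Rightarrow>\<^sub>0 'k fn) set set" where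
  "Delta_pow_V U A k = generate (add_monoid (smash U A (Der A)))
     {smash_class U A (Der A) (to_sharp t \<eta>) | T t \<eta>.
        T \<in> Delta_pow U A k \<and> t \<in> T \<and> \<eta> \<in> Der A}"

definition annihilates :: "'b set \<Rightarrow> ('b, 'r, 'z) module_scheme \<Rightarrow> bool" where
  "annihilates S M \<longleftrightarrow> (\<forall>b\<in>S. \<forall>r\<in>carrier M. b \<odot>\<^bsub>M\<^esub> r = \<zero>\<^bsub>M\<^esub>)"

text \<open>The factor \<open>indicator U\<close> makes $f^0$ the unit of \<open>A\<close>.\<close>

definition diff_element ::
  "'k::field pt set \<Rightarrow> nat \<Rightarrow> 'k fn \<Rightarrow> 'k der \<Rightarrow> ('k der list \<Rightarrow>\<^sub>0 'k fn)" where
  "diff_element U k f \<eta> = (\<Sum>j\<le>k. Poly_Mapping.single [fmul (f ^ (k - j)) \<eta>]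
     (indicator U * cscale ((-1) ^ j * of_nat (k choose j)) (f ^ j)))"

definition differentiable_module ::
  "'k::field pt set \<Rightarrow> 'k fn set \<Rightarrow>
   (('k der list \<Rightarrow>\<^sub>0 'k fn) set, 'r, 'z) module_scheme \<Rightarrow> bool" where
  "differentiable_module U A M \<longleftrightarrow> (\<exists>k\<ge>1.
     annihilates {smash_class U A (Der A) (diff_element U k f \<eta>) | f \<eta>. f \<in> A \<and> \<eta> \<in> Der A} M)"


section \<open>Rudakov modules\<close>

definition max_ideal_V :: "'k::field fn set \<Rightarrow> 'k pt \<Rightarrow> 'k der set" where
  "max_ideal_V A P = group_closure {fmul f \<eta> | f \<eta>. f \<in> A \<and> f P = 0 \<and> \<eta> \<in> Der A}"

text \<open>The action of $\mathfrak{m}_P V$ on \<open>W\<close>: as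
  $\eta = \sum_i \eta(x_i)\,\partial/\partial x_i$, the coefficients of \<open>\<eta>\<close> are \<open>\<eta> (x i)\<close>.\<close>

definition vf_action ::
  "nat \<Rightarrow> nat \<Rightarrow> ('k::field_char_0 \<Rightarrow> 'w::ab_group_add \<Rightarrow> 'w) \<Rightarrow> ('k vf \<Rightarrow> 'w \<Rightarrow> 'w) \<Rightarrow>
   (nat \<Rightarrow> 'k fn) \<Rightarrow> (nat \<Rightarrow> 'k fn \<Rightarrow> 'k fn) \<Rightarrow> 'k pt \<Rightarrow> 'k der \<Rightarrow> 'w \<Rightarrow> 'w" where
  "vf_action n N scale \<rho> x pd P \<eta> w =
     (\<Sum>i<n. \<Sum>s\<in>{s. Poly_Mapping.keys s \<subseteq> {..<n} \<and> 0 < mdeg s \<and> mdeg s \<le> N}.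
        scale (inverse (mfact s) * pd_pow n pd s (\<eta> (x i)) P) (\<rho> (monom_vf s i) w))"

text \<open>The resulting action of \<open>smash_free U A (max_ideal_V A P)\<close>, in which $A$ acts by
  evaluation at \<open>P\<close>; it factors through $A\#U(\mathfrak{m}_P V)$.\<close>

definition smash_action ::
  "nat \<Rightarrow> nat \<Rightarrow> ('k::field_char_0 \<Rightarrow> 'w::ab_group_add \<Rightarrow> 'w) \<Rightarrow> ('k vf \<Rightarrow> 'w \<Rightarrow> 'w) \<Rightarrow>
   (nat \<Rightarrow> 'k fn) \<Rightarrow> (nat \<Rightarrow> 'k fn \<Rightarrow> 'k fn) \<Rightarrow> 'k pt \<Rightarrow>
   ('k der list \<Rightarrow>\<^sub>0 'k fn) \<Rightarrow> 'w \<Rightarrow> 'w" where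
  "smash_action n N scale \<rho> x pd P p w =
     (\<Sum>u\<in>Poly_Mapping.keys p.
        scale (Poly_Mapping.lookup p u P) (foldr (vf_action n N scale \<rho> x pd P) u w))"

text \<open>
  $A\#U(V) \otimes_{A\#U(\mathfrak{m}_P V)} W$.  The subalgebra $A\#U(\mathfrak{m}_P V)$ acts on both
  sides through representatives in \<open>smash_free U A (max_ideal_V A P)\<close>, of which it is a quotient;
  tensoring over a ring or over a ring surjecting onto it gives the same result.
\<close>

definition rudakov_rels ::
  "'k::field_char_0 pt set \<Rightarrow> 'k fn set \<Rightarrow> nat \<Rightarrow> nat \<Rightarrow> ('k \<Rightarrow> 'w::ab_group_add \<Rightarrow> 'w) \<Rightarrow>
   ('k vf \<Rightarrow> 'w \<Rightarrow> 'w) \<Rightarrow> (nat \<Rightarrow> 'k fn) \<Rightarrow> (nat \<Rightarrow> 'k fn \<Rightarrow> 'k fn) \<Rightarrow> 'k pt \<Rightarrow>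
   ((('k der list \<Rightarrow>\<^sub>0 'k fn) set \<times> 'w) \<Rightarrow>\<^sub>0 int) set" where
  "rudakov_rels U A n N scale \<rho> x pd P =
     tensor_rels (carrier (smash U A (Der A))) (add (smash U A (Der A))) UNIV (+)
       (carrier (smash_free U A (max_ideal_V A P)))
       (\<lambda>b c. b \<otimes>\<^bsub>smash U A (Der A)\<^esub> smash_class U A (Der A) c)
       (smash_action n N scale \<rho> x pd P)"

text \<open>Only the additive structure and the action \<open>smult\<close> of the record are meaningful.\<close>

definition rudakov_module ::
  "'k::field_char_0 pt set \<Rightarrow> 'k fn set \<Rightarrow> nat \<Rightarrow> nat \<Rightarrow> ('k \<Rightarrow> 'w::ab_group_add \<Rightarrow> 'w) \<Rightarrow>
   ('k vf \<Rightarrow> 'w \<Rightarrow> 'w) \<Rightarrow> (nat \<Rightarrow> 'k fn) \<Rightarrow> (nat \<Rightarrow> 'k fn \<Rightarrow> 'k fn) \<Rightarrow> 'k pt \<Rightarrow>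
   (('k der list \<Rightarrow>\<^sub>0 'k fn) set, ((('k der list \<Rightarrow>\<^sub>0 'k fn) set \<times> 'w) \<Rightarrow>\<^sub>0 int) set) module" where
  "rudakov_module U A n N scale \<rho> x pd P =
     (let B = smash U A (Der A);
          F = free_Abelian_group (carrier B \<times> UNIV);
          T = rudakov_rels U A n N scale \<rho> x pd P
      in \<lparr>carrier = carrier (F Mod T), monoid.mult = undefined, one = undefined,
          zero = one (F Mod T), add = monoid.mult (F Mod T),
          module.smult = (\<lambda>b r. \<Union>t\<in>r. T #>\<^bsub>F\<^esub> frag_extend (\<lambda>(b', w). frag_of (b \<otimes>\<^bsub>B\<^esub> b', w)) t)\<rparr>)"

end

theory Submission
  imports Defs
begin

text \<open>
  Write \<open>S\<close> for $\Delta^{N+1} \otimes_A V$, viewed inside $A\#U(V)$.  The module $R_P^W$ is generated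
  over $A\#U(V)$ by the vectors $1 \otimes w$.  It therefore suffices that \<open>S\<close> kills these vectors and
  that \<open>S\<close> can be moved past every element of $A\#U(V)$.

  For the second point, an element $\sum_j g_j\#f_j\eta$ with $\sum_j g_j f_j = 0$ commutes with
  functions, and its commutator with a derivation \<open>\<mu>\<close> is obtained by letting \<open>\<mu>\<close> act on
  $A \otimes A$ by the Leibniz rule and on \<open>\<eta>\<close> by the bracket; both operations preserve
  $\Delta^k \otimes V$ (\<open>Delta_span_commutator\<close>).  So a left ideal containing \<open>S\<close> also contains
  \<open>S\<close> times anything (\<open>Delta_span_mult_mem\<close>), and only left ideals have to be considered.

  For the first point, $\Delta^{N+1}$ is spanned by the elements
  $(g \otimes h) \prod_{i=0}^{N} (f_i \otimes 1 - 1 \otimes f_i)$, where constants may be subtracted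
  from the $f_i$ so that they lie in $\mathfrak{m}_P$.  Expanding the product gives terms
  $g f_I \# h f_J \eta$ with \<open>I\<close>, \<open>J\<close> a partition of the indices.  If neither part is empty, then
  $h f_J \eta \in \mathfrak{m}_P V$ acts on \<open>W\<close>, and the result is killed by $f_I(P) = 0$.
  If \<open>I\<close> is empty, then $h f_J \eta \in \mathfrak{m}_P^{N+1} V$ acts on \<open>W\<close> by zero.  If \<open>J\<close> is
  empty, then $g f_I \# h\eta = h\eta \cdot g f_I - h\eta(g f_I)$, where both $g f_I$ and
  $h\eta(g f_I)$ vanish at \<open>P\<close> because there are $N + 1 \geq 2$ factors
  (\<open>Delta_span_subset_left_ideal\<close>).

  The spanning set of $\Delta^k$ comes from the identity
  $g \otimes f = gf \otimes 1 - (g \otimes 1)(f \otimes 1 - 1 \otimes f)$, which shows that \<open>\<Delta>\<close> is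
  generated by differences (\<open>Delta_pow_elementD\<close>).  Taking all $f_i$ equal to one \<open>f\<close> and
  $g = h = 1$ gives, up to sign, the elements in the definition of a differentiable module
  (\<open>diff_element_mem_Delta_span\<close>), so both claims follow from the same computation.

  All computations take place with representatives in the free smash product, modulo the ideal of
  relations, and the annihilated elements are described as a left ideal there (\<open>annihilator\<close>).
\<close>


section \<open>Sums over the support of a finitely supported map\<close>

definition linear_extension :: "('a \<Rightarrow> 'b::zero \<Rightarrow> 'c::comm_monoid_add) \<Rightarrow> ('a \<Rightarrow>\<^sub>0 'b) \<Rightarrow> 'c" where
  "linear_extension \<phi> p = (\<Sum>k\<in>Poly_Mapping.keys p. \<phi> k (Poly_Mapping.lookup p k))"

lemma linear_extension_superset:
  assumes "finite S" "Poly_Mapping.keys p \<subseteq> S" "\<And>k. \<phi> k 0 = 0"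
  shows "linear_extension \<phi> p = (\<Sum>k\<in>S. \<phi> k (Poly_Mapping.lookup p k))"
  unfolding linear_extension_def
  by (rule sum.mono_neutral_left) (use assms in \<open>auto simp: in_keys_iff\<close>)

lemma linear_extension_add:
  assumes zero: "\<And>k. \<phi> k 0 = 0"
    and add: "\<And>k a b. a \<in> A \<Longrightarrow> b \<in> A \<Longrightarrow> \<phi> k (a + b) = \<phi> k a + \<phi> k b"
    and "range (Poly_Mapping.lookup p) \<subseteq> A" "range (Poly_Mapping.lookup q) \<subseteq> A"
  shows "linear_extension \<phi> (p + q) = linear_extension \<phi> p + linear_extension \<phi> q"
proof -
  let ?S = "Poly_Mapping.keys p \<union> Poly_Mapping.keys q"
  have "linear_extension \<phi> (p + q)
      = (\<Sum>k\<in>?S. \<phi> k (Poly_Mapping.lookup p k) + \<phi> k (Poly_Mapping.lookup q k))"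
    using assms(3,4) by (subst linear_extension_superset[of ?S])
      (auto simp: zero lookup_add add image_subset_iff keys_add intro!: sum.cong)
  also have "\<dots> = linear_extension \<phi> p + linear_extension \<phi> q"
    by (simp add: sum.distrib linear_extension_superset[of ?S _ \<phi>] zero)
  finally show ?thesis .
qed

lemma linear_extension_zero [simp]: "linear_extension \<phi> 0 = 0"
  by (simp add: linear_extension_def)

lemma linear_extension_single [simp]:
  "\<phi> k 0 = 0 \<Longrightarrow> linear_extension \<phi> (Poly_Mapping.single k c) = \<phi> k c"
  by (simp add: linear_extension_def)

lemma poly_mapping_sum_singles:
  "(\<Sum>k\<in>Poly_Mapping.keys p. Poly_Mapping.single k (Poly_Mapping.lookup p k))
    = (p :: 'a \<Rightarrow>\<^sub>0 'b::comm_monoid_add)"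
  by (rule poly_mapping_eqI) (auto simp: lookup_sum lookup_single when_def in_keys_iff)

text \<open>Restricting supports and coefficients lets the induction run inside the carrier of a
  ring of formal sums.\<close>

lemma poly_mapping_carrier_induct [consumes 2, case_names zero single add]:
  fixes p :: "'a \<Rightarrow>\<^sub>0 'b::comm_monoid_add"
  assumes "Poly_Mapping.keys p \<subseteq> L" "range (Poly_Mapping.lookup p) \<subseteq> A"
    and zero: "P 0"
    and single: "\<And>k c. k \<in> L \<Longrightarrow> c \<in> A \<Longrightarrow> P (Poly_Mapping.single k c)"
    and add: "\<And>k c q. k \<in> L \<Longrightarrow> c \<in> A \<Longrightarrow> Poly_Mapping.keys q \<subseteq> L \<Longrightarrow>
        range (Poly_Mapping.lookup q) \<subseteq> insert 0 A \<Longrightarrow> P q \<Longrightarrow> P (Poly_Mapping.single k c + q)"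
  shows "P p"
proof -
  let ?s = "\<lambda>S. \<Sum>k\<in>S. Poly_Mapping.single k (Poly_Mapping.lookup p k)"
  have "S \<subseteq> L \<Longrightarrow> P (?s S)" if "finite S" for S
    using that
  proof induction
    case (insert k S)
    have "range (Poly_Mapping.lookup (?s S)) \<subseteq> insert 0 A"
      using assms(2) insert.hyps(1) by (auto simp: lookup_sum lookup_single when_def sum.If_cases)
    moreover have "Poly_Mapping.keys (?s S) \<subseteq> L"
      using insert.prems by (intro order.trans[OF keys_sum]) auto
    ultimately show ?case
      using insert assms(2) by (auto intro!: add)
  qed (simp add: zero)
  then show ?thesis
    using assms(1) by (metis finite_keys poly_mapping_sum_singles)
qed

lemma group_closure_image_mem:
  fixes h :: "'a::ab_group_add \<Rightarrow> 'b::ab_group_add"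
  assumes "s \<in> group_closure S" "S \<subseteq> C"
    and C: "0 \<in> C" "\<And>a b. a \<in> C \<Longrightarrow> b \<in> C \<Longrightarrow> a - b \<in> C"
    and h: "\<And>a b. a \<in> C \<Longrightarrow> b \<in> C \<Longrightarrow> h (a - b) = h a - h b"
    and K: "\<And>a. a \<in> S \<Longrightarrow> h a \<in> K" "0 \<in> K" "\<And>a b. a \<in> K \<Longrightarrow> b \<in> K \<Longrightarrow> a - b \<in> K"
  shows "h s \<in> K"
proof -
  have h0: "h 0 = 0"
    using h[OF C(1) C(1)] by simp
  have "s \<in> C \<and> h s \<in> K"
    using assms(1) by induction (use assms(2) C h K in \<open>auto simp: h0\<close>)
  then show ?thesis ..
qed


section \<open>Algebras of functions and their derivations\<close>

locale function_algebra =
  fixes U :: "'k::field pt set" and A :: "'k fn set"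
  assumes support: "f \<in> A \<Longrightarrow> q \<notin> U \<Longrightarrow> f q = 0"
    and add_closed: "f \<in> A \<Longrightarrow> g \<in> A \<Longrightarrow> f + g \<in> A"
    and mult_closed: "f \<in> A \<Longrightarrow> g \<in> A \<Longrightarrow> f * g \<in> A"
    and cscale_closed: "f \<in> A \<Longrightarrow> cscale c f \<in> A"
    and unit_closed: "indicator U \<in> A"
begin

lemma zero_closed: "0 \<in> A"
  using cscale_closed[OF unit_closed, of 0] by (simp add: cscale_def zero_fun_def)

lemma uminus_closed: "f \<in> A \<Longrightarrow> - f \<in> A"
  using cscale_closed[of f "-1"] by (simp add: cscale_def fun_Compl_def)

lemma diff_closed: "f \<in> A \<Longrightarrow> g \<in> A \<Longrightarrow> f - g \<in> A"
  using add_closed[OF _ uminus_closed] by (simp add: diff_conv_add_uminus del: add_uminus_conv_diff)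

lemma unit_mult [simp]: "f \<in> A \<Longrightarrow> indicator U * f = f"
  by (auto simp: fun_eq_iff indicator_def support)

lemma mult_unit [simp]: "f \<in> A \<Longrightarrow> f * indicator U = f"
  by (auto simp: fun_eq_iff indicator_def support)

lemma cscale_unit_mult: "f \<in> A \<Longrightarrow> cscale c (indicator U) * f = cscale c f"
  by (auto simp: fun_eq_iff cscale_def indicator_def support)

lemmas closed = add_closed mult_closed cscale_closed unit_closed zero_closed uminus_closed diff_closed

subsection \<open>Derivations\<close>

lemma Der_closed: "D \<in> Der A \<Longrightarrow> f \<in> A \<Longrightarrow> D f \<in> A"
  and Der_outside: "D \<in> Der A \<Longrightarrow> f \<notin> A \<Longrightarrow> D f = 0"
  and Der_add: "D \<in> Der A \<Longrightarrow> f \<in> A \<Longrightarrow> g \<in> A \<Longrightarrow> D (f + g) = D f + D g"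
  and Der_cscale: "D \<in> Der A \<Longrightarrow> f \<in> A \<Longrightarrow> D (cscale c f) = cscale c (D f)"
  and Der_mult: "D \<in> Der A \<Longrightarrow> f \<in> A \<Longrightarrow> g \<in> A \<Longrightarrow> D (f * g) = D f * g + f * D g"
  by (auto simp: Der_def)

lemma Der_zero: "D \<in> Der A \<Longrightarrow> D 0 = 0"
  by (metis Der_add add.right_neutral add_left_cancel zero_closed)

lemma Der_unit: "D \<in> Der A \<Longrightarrow> D (indicator U) = 0"
  using Der_mult[OF _ unit_closed unit_closed, of D] unit_closed
  by (simp add: Der_closed)

lemma Der_add_closed: "D \<in> Der A \<Longrightarrow> E \<in> Der A \<Longrightarrow> D + E \<in> Der A"
  unfolding Der_def
  by (auto simp: add_closed algebra_simps cscale_def fun_eq_iff)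

lemma Der_cscale_closed:
  assumes "D \<in> Der A"
  shows "(\<lambda>h. cscale c (D h)) \<in> Der A"
  unfolding Der_def
proof (intro CollectI conjI ballI allI impI)
  fix f g
  assume "f \<in> A" "g \<in> A"
  then show "cscale c (D (f + g)) = cscale c (D f) + cscale c (D g)"
    and "cscale c (D (f * g)) = cscale c (D f) * g + f * cscale c (D g)"
    using assms by (simp_all add: Der_add Der_mult) (simp_all add: cscale_def fun_eq_iff algebra_simps)
next
  fix c' f
  assume "f \<in> A"
  then show "cscale c (D (cscale c' f)) = cscale c' (cscale c (D f))"
    using assms by (simp add: Der_cscale) (simp add: cscale_def fun_eq_iff)
next
  fix f
  assume "f \<notin> A"
  then show "cscale c (D f) = 0"
    using assms by (simp add: Der_outside) (simp add: cscale_def fun_eq_iff)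
qed (use assms in \<open>auto simp: Der_closed cscale_closed\<close>)

lemma Der_fmul_closed: "f \<in> A \<Longrightarrow> D \<in> Der A \<Longrightarrow> fmul f D \<in> Der A"
  unfolding Der_def fmul_def
  by (auto simp: mult_closed algebra_simps cscale_def fun_eq_iff)

lemma Der_lie_closed:
  assumes "D \<in> Der A" "E \<in> Der A"
  shows "lie D E \<in> Der A"
proof -
  note rules = Der_closed[OF assms(1)] Der_closed[OF assms(2)] Der_add[OF assms(1)] Der_add[OF assms(2)]
    Der_cscale[OF assms(1)] Der_cscale[OF assms(2)] Der_mult[OF assms(1)] Der_mult[OF assms(2)]
    Der_outside[OF assms(1)] Der_outside[OF assms(2)] Der_zero[OF assms(1)] Der_zero[OF assms(2)]
  show ?thesis
    unfolding Der_def lie_def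
  proof (intro CollectI conjI ballI allI impI)
    fix c f
    assume "f \<in> A"
    then show "D (E (cscale c f)) - E (D (cscale c f)) = cscale c (D (E f) - E (D f))"
      by (simp add: rules) (simp add: cscale_def fun_eq_iff algebra_simps)
  qed (auto simp: rules closed algebra_simps)
qed

lemma fmul_add: "fmul (f + g) D = fmul f D + fmul g D"
  by (simp add: fmul_def fun_eq_iff algebra_simps)

lemma fmul_cscale: "fmul (cscale c f) D = (\<lambda>h. cscale c (fmul f D h))"
  by (simp add: fmul_def fun_eq_iff cscale_def mult.assoc)

lemma lie_fmul:
  assumes "D \<in> Der A" "E \<in> Der A" "f \<in> A"
  shows "lie D (fmul f E) = fmul (D f) E + fmul f (lie D E)"
proof (intro ext)
  fix h q
  show "lie D (fmul f E) h q = (fmul (D f) E + fmul f (lie D E)) h q"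
  proof (cases "h \<in> A")
    case True
    then have "D (f * E h) q = D f q * E h q + f q * D (E h) q"
      using Der_mult[OF assms(1,3) Der_closed[OF assms(2)]] by simp
    then show ?thesis
      unfolding lie_def fmul_def fun_diff_def plus_fun_apply times_fun_apply
      by (simp add: right_diff_distrib)
  next
    case False
    then have "D h = 0" "E h = 0" "D 0 = 0" "E 0 = 0" "f * 0 = 0" "D f * 0 = 0"
      using assms(1,2)[THEN Der_outside] assms(1,2)[THEN Der_zero] by auto
    then show ?thesis
      by (simp add: lie_def fmul_def)
  qed
qed

end


section \<open>The smash product as a ring\<close>

text \<open>The rule for moving letters past functions says that a derivation \<open>\<eta>\<close> acts on the free smash
  product, from the left, by $g v \mapsto \eta(g) v + g\,\eta v$.  Expressing the product through
  these operators reduces associativity to the Leibniz rule.\<close>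

definition coeff_mult :: "'k::field fn \<Rightarrow> ('k der list \<Rightarrow>\<^sub>0 'k fn) \<Rightarrow> ('k der list \<Rightarrow>\<^sub>0 'k fn)" where
  "coeff_mult f q = Poly_Mapping.map ((*) f) q"

definition letter_mult :: "'k::field der \<Rightarrow> ('k der list \<Rightarrow>\<^sub>0 'k fn) \<Rightarrow> ('k der list \<Rightarrow>\<^sub>0 'k fn)" where
  "letter_mult \<eta> q =
     linear_extension (\<lambda>v g. Poly_Mapping.single v (\<eta> g) + Poly_Mapping.single (\<eta> # v) g) q"

definition smash_mult ::
  "('k::field der list \<Rightarrow>\<^sub>0 'k fn) \<Rightarrow> ('k der list \<Rightarrow>\<^sub>0 'k fn) \<Rightarrow> ('k der list \<Rightarrow>\<^sub>0 'k fn)" where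
  "smash_mult p q = linear_extension (\<lambda>u f. coeff_mult f (foldr letter_mult u q)) p"

lemma lookup_coeff_mult: "Poly_Mapping.lookup (coeff_mult f q) v = f * Poly_Mapping.lookup q v"
  by (simp add: coeff_mult_def Poly_Mapping.map.rep_eq when_def)

lemma coeff_mult_simps:
  "coeff_mult f 0 = 0" "coeff_mult 0 q = 0"
  "coeff_mult f (p + q) = coeff_mult f p + coeff_mult f q"
  "coeff_mult f (p - q) = coeff_mult f p - coeff_mult f q"
  "coeff_mult (f + g) q = coeff_mult f q + coeff_mult g q"
  "coeff_mult f (coeff_mult g q) = coeff_mult (f * g) q"
  "coeff_mult f (Poly_Mapping.single v g) = Poly_Mapping.single v (f * g)"
  by (rule poly_mapping_eqI,
      simp add: lookup_coeff_mult lookup_add lookup_minus lookup_single when_def algebra_simps)+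

lemma smash_mult_add_left: "smash_mult (p + p') q = smash_mult p q + smash_mult p' q"
  unfolding smash_mult_def
  by (rule linear_extension_add[where A = UNIV]) (simp_all add: coeff_mult_simps)

lemma smash_mult_zero_left: "smash_mult 0 q = 0"
  by (simp add: smash_mult_def)

lemma smash_mult_diff_left: "smash_mult (p - p') q = smash_mult p q - smash_mult p' q"
  using smash_mult_add_left[of "p - p'" p' q] by simp

lemma smash_mult_single:
  "smash_mult (Poly_Mapping.single u f) q = coeff_mult f (foldr letter_mult u q)"
  unfolding smash_mult_def by (rule linear_extension_single) (simp add: coeff_mult_simps)

lemma smash_mult_coeff_mult: "smash_mult (coeff_mult f p) q = coeff_mult f (smash_mult p q)"
proof -
  have "Poly_Mapping.keys p \<subseteq> UNIV" "range (Poly_Mapping.lookup p) \<subseteq> UNIV"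
    by simp_all
  then show ?thesis
  proof (induction p rule: poly_mapping_carrier_induct)
    case (single k c)
    then show ?case by (simp add: smash_mult_single coeff_mult_simps)
  qed (simp_all add: smash_mult_add_left smash_mult_zero_left smash_mult_single coeff_mult_simps)
qed

context function_algebra
begin

abbreviation C :: "('k der list \<Rightarrow>\<^sub>0 'k fn) set" where
  "C \<equiv> carrier (smash_free U A (Der A))"

lemma mem_C_iff:
  "p \<in> C \<longleftrightarrow> Poly_Mapping.keys p \<subseteq> lists (Der A) \<and> range (Poly_Mapping.lookup p) \<subseteq> A"
  by (simp add: smash_free_def)

lemma C_zero: "0 \<in> C"
  by (auto simp: mem_C_iff zero_closed)

lemma C_add: "p \<in> C \<Longrightarrow> q \<in> C \<Longrightarrow> p + q \<in> C"
  unfolding mem_C_iff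
  by (intro conjI order.trans[OF keys_add]) (auto simp: lookup_add image_subset_iff intro!: add_closed)

lemma C_uminus: "p \<in> C \<Longrightarrow> - p \<in> C"
  unfolding mem_C_iff by (auto intro!: uminus_closed)

lemma C_diff: "p \<in> C \<Longrightarrow> q \<in> C \<Longrightarrow> p - q \<in> C"
  using C_add[OF _ C_uminus] by (simp add: diff_conv_add_uminus del: add_uminus_conv_diff)

lemma C_single: "u \<in> lists (Der A) \<Longrightarrow> f \<in> A \<Longrightarrow> Poly_Mapping.single u f \<in> C"
  unfolding mem_C_iff by (auto simp: lookup_single when_def zero_closed)

lemmas C_closed = C_zero C_add C_uminus C_diff

lemma C_induct [consumes 1, case_names zero single add]:
  assumes "p \<in> C" and zero: "P 0"
    and single: "\<And>u f. u \<in> lists (Der A) \<Longrightarrow> f \<in> A \<Longrightarrow> P (Poly_Mapping.single u f)"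
    and add: "\<And>u f q. u \<in> lists (Der A) \<Longrightarrow> f \<in> A \<Longrightarrow> P (Poly_Mapping.single u f) \<Longrightarrow> q \<in> C
      \<Longrightarrow> P q \<Longrightarrow> P (Poly_Mapping.single u f + q)"
  shows "P p"
proof -
  have [simp]: "insert 0 A = A"
    using zero_closed by auto
  have "Poly_Mapping.keys p \<subseteq> lists (Der A)" "range (Poly_Mapping.lookup p) \<subseteq> A"
    using assms(1) by (simp_all add: mem_C_iff)
  then show ?thesis
  proof (induction p rule: poly_mapping_carrier_induct)
    case (add u f q)
    then show ?case
      by (intro assms(4) single) (simp_all add: mem_C_iff)
  qed (use zero single in auto)
qed

lemma C_coeff_mult:
  assumes "f \<in> A" "q \<in> C"
  shows "coeff_mult f q \<in> C"
proof -
  have "Poly_Mapping.keys (coeff_mult f q) \<subseteq> Poly_Mapping.keys q"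
    by (auto simp: in_keys_iff lookup_coeff_mult)
  then show ?thesis
    using assms unfolding mem_C_iff by (auto simp: lookup_coeff_mult image_subset_iff intro: mult_closed)
qed

lemma coeff_mult_unit: "q \<in> C \<Longrightarrow> coeff_mult (indicator U) q = q"
  by (rule poly_mapping_eqI) (auto simp: lookup_coeff_mult mem_C_iff image_subset_iff)

lemma letter_mult_single:
  assumes "\<eta> \<in> Der A"
  shows "letter_mult \<eta> (Poly_Mapping.single v g) =
    Poly_Mapping.single v (\<eta> g) + Poly_Mapping.single (\<eta> # v) g"
  unfolding letter_mult_def
  by (rule linear_extension_single) (simp add: Der_zero[OF assms])

lemma letter_mult_add:
  assumes "\<eta> \<in> Der A" "p \<in> C" "q \<in> C"
  shows "letter_mult \<eta> (p + q) = letter_mult \<eta> p + letter_mult \<eta> q"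
  unfolding letter_mult_def
  by (rule linear_extension_add[where A = A])
    (use assms in \<open>auto simp: Der_zero[OF assms(1)] Der_add[OF assms(1)] mem_C_iff single_add\<close>)

lemma letter_mult_zero: "letter_mult \<eta> 0 = 0"
  by (simp add: letter_mult_def)

lemma letter_mult_diff:
  assumes "\<eta> \<in> Der A" "p \<in> C" "q \<in> C"
  shows "letter_mult \<eta> (p - q) = letter_mult \<eta> p - letter_mult \<eta> q"
  using letter_mult_add[OF assms(1) C_diff[OF assms(2,3)] assms(3)] by simp

lemma C_letter_mult:
  assumes "\<eta> \<in> Der A" "q \<in> C"
  shows "letter_mult \<eta> q \<in> C"
  using assms(2)
proof (induction rule: C_induct)
  case (single u f)
  then show ?case
    using assms(1) by (auto simp: letter_mult_single intro!: C_add C_single Der_closed[OF assms(1)])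
next
  case (add u f q)
  then show ?case
    using assms(1) by (auto simp: letter_mult_add C_single intro: C_add)
qed (simp add: letter_mult_zero C_zero)

lemma C_word_mult: "u \<in> lists (Der A) \<Longrightarrow> q \<in> C \<Longrightarrow> foldr letter_mult u q \<in> C"
  by (induction rule: lists.induct) (auto intro: C_letter_mult)

lemma word_mult_zero: "foldr letter_mult u 0 = 0"
  by (induction u) (auto simp: letter_mult_zero)

lemma word_mult_add:
  assumes "u \<in> lists (Der A)" "p \<in> C" "q \<in> C"
  shows "foldr letter_mult u (p + q) = foldr letter_mult u p + foldr letter_mult u q"
  using assms(1) by induction (use assms(2,3) in \<open>auto simp: letter_mult_add C_word_mult in_listsI\<close>)

lemma word_mult_unit:
  assumes "u \<in> lists (Der A)"
  shows "foldr letter_mult u (Poly_Mapping.single v (indicator U)) = Poly_Mapping.single (u @ v) (indicator U)"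
  using assms
proof induction
  case (Cons \<eta> u)
  then show ?case
    by (simp add: letter_mult_single Der_unit[OF Cons(1)] del: func_zero)
qed simp

text \<open>This is where the letters being derivations enters the associativity of the product.\<close>

lemma letter_mult_coeff_mult:
  assumes "\<eta> \<in> Der A" "g \<in> A" "q \<in> C"
  shows "letter_mult \<eta> (coeff_mult g q) = coeff_mult (\<eta> g) q + coeff_mult g (letter_mult \<eta> q)"
  using assms(3)
proof (induction rule: C_induct)
  case (single u f)
  then show ?case
    using assms(1,2)
    by (simp add: letter_mult_single coeff_mult_simps Der_mult[OF assms(1)] single_add)
next
  case (add u f q)
  have "letter_mult \<eta> (coeff_mult g (Poly_Mapping.single u f + q))
      = letter_mult \<eta> (coeff_mult g (Poly_Mapping.single u f)) + letter_mult \<eta> (coeff_mult g q)"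
    unfolding coeff_mult_simps(3)
    by (intro letter_mult_add assms C_coeff_mult C_single add.hyps)
  then show ?case
    unfolding add.IH letter_mult_add[OF assms(1) C_single[OF add.hyps(1,2)] add.hyps(3)] coeff_mult_simps(3)
    by (simp only: ac_simps)
qed (simp add: letter_mult_zero coeff_mult_simps)

lemma word_mult_diff:
  assumes "u \<in> lists (Der A)" "p \<in> C" "q \<in> C"
  shows "foldr letter_mult u (p - q) = foldr letter_mult u p - foldr letter_mult u q"
  using word_mult_add[OF assms(1) C_diff[OF assms(2,3)] assms(3)] by simp

lemma word_mult_cscale:
  assumes "u \<in> lists (Der A)" "q \<in> C"
  shows "foldr letter_mult u (coeff_mult (cscale c (indicator U)) q)
    = coeff_mult (cscale c (indicator U)) (foldr letter_mult u q)"
  using assms(1)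
proof induction
  case (Cons \<eta> u)
  have "\<eta> (cscale c (indicator U)) = 0"
    unfolding Der_cscale[OF Cons(1) unit_closed] Der_unit[OF Cons(1)]
    by (simp add: cscale_def fun_eq_iff)
  then have "coeff_mult (\<eta> (cscale c (indicator U))) (foldr letter_mult u q) = 0"
    by (simp only: coeff_mult_simps)
  then show ?case
    using Cons assms(2)
    by (simp add: letter_mult_coeff_mult cscale_closed unit_closed C_word_mult in_listsI)
qed simp

lemma C_smash_mult:
  assumes "p \<in> C" "q \<in> C"
  shows "smash_mult p q \<in> C"
  using assms(1)
proof (induction rule: C_induct)
  case (single u f)
  then show ?case
    using assms(2) by (simp add: smash_mult_single C_coeff_mult C_word_mult)
qed (simp_all add: smash_mult_zero_left smash_mult_add_left C_closed)

lemma smash_mult_add_right: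
  assumes "p \<in> C" "q \<in> C" "q' \<in> C"
  shows "smash_mult p (q + q') = smash_mult p q + smash_mult p q'"
  using assms(1)
proof (induction rule: C_induct)
  case (single u f)
  then show ?case
    using assms(2-) by (simp add: smash_mult_single word_mult_add coeff_mult_simps)
qed (simp_all add: smash_mult_zero_left smash_mult_add_left algebra_simps)

lemma smash_mult_diff_right:
  assumes "p \<in> C" "q \<in> C" "q' \<in> C"
  shows "smash_mult p (q - q') = smash_mult p q - smash_mult p q'"
  using smash_mult_add_right[OF assms(1) C_diff[OF assms(2,3)] assms(3)] by simp

lemma smash_mult_letter_mult:
  assumes "\<eta> \<in> Der A" "p \<in> C" "q \<in> C"
  shows "smash_mult (letter_mult \<eta> p) q = letter_mult \<eta> (smash_mult p q)"
  using assms(2)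
proof (induction rule: C_induct)
  case (single u f)
  then show ?case
    using assms(1,3)
    by (simp add: letter_mult_single smash_mult_add_left smash_mult_single
        letter_mult_coeff_mult C_word_mult)
next
  case (add u f q')
  then show ?case
    using assms(1,3)
    by (simp add: letter_mult_add smash_mult_add_left C_single C_smash_mult)
qed (simp add: letter_mult_zero smash_mult_zero_left)

lemma smash_mult_assoc:
  assumes "p \<in> C" "q \<in> C" "r \<in> C"
  shows "smash_mult (smash_mult p q) r = smash_mult p (smash_mult q r)"
  using assms(1)
proof (induction rule: C_induct)
  case (single u f)
  have "smash_mult (foldr letter_mult u q) r = foldr letter_mult u (smash_mult q r)"
    using single(1) by induction (auto simp: smash_mult_letter_mult C_word_mult assms)
  then show ?case
    by (simp add: smash_mult_single smash_mult_coeff_mult)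
qed (simp_all add: smash_mult_zero_left smash_mult_add_left)

lemma smash_mult_unit_left: "q \<in> C \<Longrightarrow> smash_mult (Poly_Mapping.single [] (indicator U)) q = q"
  by (simp add: smash_mult_single coeff_mult_unit)

lemma smash_mult_unit_right:
  assumes "p \<in> C"
  shows "smash_mult p (Poly_Mapping.single [] (indicator U)) = p"
  using assms
  by (induction rule: C_induct)
    (simp_all add: smash_mult_zero_left smash_mult_add_left smash_mult_single word_mult_unit coeff_mult_simps)

text \<open>\<open>straighten\<close> consumes the reversed word, so the operator of the last letter of the original word
  is applied first, as in the composition \<open>foldr letter_mult u\<close>.\<close>

lemma straighten_eq:
  assumes "g \<in> A" "v \<in> lists (Der A)" "set us \<subseteq> Der A"
  shows "straighten f us g v = coeff_mult f (fold letter_mult us (Poly_Mapping.single v g))"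
  using assms
proof (induction us arbitrary: g v)
  case (Cons \<eta> us)
  have "us \<in> lists (Der A)"
    using Cons.prems by auto
  then have "rev us \<in> lists (Der A)"
    by auto
  then have "fold letter_mult us (p + q) = fold letter_mult us p + fold letter_mult us q"
    if "p \<in> C" "q \<in> C" for p q
    using word_mult_add[OF _ that, of "rev us"] by (simp add: foldr_conv_fold)
  then show ?case
    using Cons Der_closed[of \<eta> g] by (simp add: letter_mult_single C_single coeff_mult_simps)
qed (simp add: coeff_mult_simps)

lemma mult_smash_free:
  assumes "p \<in> C" "q \<in> C"
  shows "p \<otimes>\<^bsub>smash_free U A (Der A)\<^esub> q = smash_mult p q"
proof -
  have "(\<Sum>v\<in>Poly_Mapping.keys q. straighten f (rev u) (Poly_Mapping.lookup q v) v)
      = coeff_mult f (foldr letter_mult u q)"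
    if u: "u \<in> lists (Der A)" for u f
  proof -
    have us: "set (rev u) \<subseteq> Der A"
      using u by auto
    let ?s = "\<lambda>S. \<Sum>v\<in>S. Poly_Mapping.single v (Poly_Mapping.lookup q v)"
    have "(\<Sum>v\<in>S. straighten f (rev u) (Poly_Mapping.lookup q v) v)
        = coeff_mult f (foldr letter_mult u (?s S)) \<and> ?s S \<in> C"
      if "finite S" "S \<subseteq> Poly_Mapping.keys q" for S
      using that
    proof induction
      case (insert v S)
      have "Poly_Mapping.lookup q v \<in> A" "v \<in> lists (Der A)"
        using insert.prems assms(2) by (auto simp: mem_C_iff)
      then have v: "Poly_Mapping.single v (Poly_Mapping.lookup q v) \<in> C"
        and "straighten f (rev u) (Poly_Mapping.lookup q v) v
          = coeff_mult f (foldr letter_mult u (Poly_Mapping.single v (Poly_Mapping.lookup q v)))"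
        using straighten_eq[OF _ _ us] by (simp_all add: C_single foldr_conv_fold)
      with insert word_mult_add[OF u v] show ?case
        by (simp add: C_add coeff_mult_simps)
    qed (simp add: C_zero word_mult_zero coeff_mult_simps)
    from this[OF finite_keys order_refl] show ?thesis
      unfolding poly_mapping_sum_singles by (rule conjunct1)
  qed
  then show ?thesis
    using assms(1) by (auto simp: smash_free_def smash_mult_def linear_extension_def mem_C_iff intro!: sum.cong)
qed

lemma smash_free_simps:
  "p \<oplus>\<^bsub>smash_free U A (Der A)\<^esub> q = p + q"
  "\<zero>\<^bsub>smash_free U A (Der A)\<^esub> = 0"
  "\<one>\<^bsub>smash_free U A (Der A)\<^esub> = Poly_Mapping.single [] (indicator U)"
  by (simp_all add: smash_free_def)

lemma C_unit: "Poly_Mapping.single [] (indicator U) \<in> C"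
  by (simp add: C_single unit_closed)

lemma ring_smash_free: "ring (smash_free U A (Der A))"
proof (rule ringI)
  show "abelian_group (smash_free U A (Der A))"
  proof (rule abelian_groupI)
    fix p assume "p \<in> C"
    then show "\<exists>q\<in>C. q \<oplus>\<^bsub>smash_free U A (Der A)\<^esub> p = \<zero>\<^bsub>smash_free U A (Der A)\<^esub>"
      by (intro bexI[of _ "- p"]) (auto simp: smash_free_simps C_uminus)
  qed (auto simp: smash_free_simps C_closed algebra_simps)
  show "Group.monoid (smash_free U A (Der A))"
    by (rule monoidI)
      (auto simp: mult_smash_free smash_free_simps C_smash_mult C_unit smash_mult_assoc
        smash_mult_unit_left smash_mult_unit_right)
qed (auto simp: mult_smash_free smash_free_simps C_add smash_mult_add_left smash_mult_add_right)

subsection \<open>The defining relations form an ideal\<close>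

definition smash_generators :: "('k der list \<Rightarrow>\<^sub>0 'k fn) set" where
  "smash_generators =
      {Poly_Mapping.single (u @ [\<eta> + \<mu>] @ v) f - Poly_Mapping.single (u @ [\<eta>] @ v) f
         - Poly_Mapping.single (u @ [\<mu>] @ v) f | u v \<eta> \<mu> f.
         u \<in> lists (Der A) \<and> v \<in> lists (Der A) \<and> \<eta> \<in> Der A \<and> \<mu> \<in> Der A \<and> f \<in> A}
      \<union> {Poly_Mapping.single (u @ [\<lambda>h. cscale c (\<eta> h)] @ v) f
         - Poly_Mapping.single (u @ [\<eta>] @ v) (cscale c f) | u v \<eta> c f.
         u \<in> lists (Der A) \<and> v \<in> lists (Der A) \<and> \<eta> \<in> Der A \<and> f \<in> A}
      \<union> {Poly_Mapping.single (u @ [\<eta>, \<mu>] @ v) f - Poly_Mapping.single (u @ [\<mu>, \<eta>] @ v) f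
         - Poly_Mapping.single (u @ [lie \<eta> \<mu>] @ v) f | u v \<eta> \<mu> f.
         u \<in> lists (Der A) \<and> v \<in> lists (Der A) \<and> \<eta> \<in> Der A \<and> \<mu> \<in> Der A \<and> f \<in> A}"

abbreviation rels :: "('k der list \<Rightarrow>\<^sub>0 'k fn) set" where
  "rels \<equiv> smash_rels A (Der A)"

lemma rels_eq: "rels = group_closure smash_generators"
  by (simp only: smash_rels_def smash_generators_def)

lemma rels_zero: "0 \<in> rels"
  and rels_diff: "p \<in> rels \<Longrightarrow> q \<in> rels \<Longrightarrow> p - q \<in> rels"
  and rels_add: "p \<in> rels \<Longrightarrow> q \<in> rels \<Longrightarrow> p + q \<in> rels"
  by (simp_all add: rels_eq group_closure.diff group_closure_add)

lemma generator_add: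
  assumes "u \<in> lists (Der A)" "v \<in> lists (Der A)" "\<eta> \<in> Der A" "\<mu> \<in> Der A" "f \<in> A"
  shows "Poly_Mapping.single (u @ [\<eta> + \<mu>] @ v) f - Poly_Mapping.single (u @ [\<eta>] @ v) f
         - Poly_Mapping.single (u @ [\<mu>] @ v) f \<in> rels"
  unfolding rels_eq smash_generators_def by (rule group_closure.base) (use assms in blast)

lemma generator_cscale:
  assumes "u \<in> lists (Der A)" "v \<in> lists (Der A)" "\<eta> \<in> Der A" "f \<in> A"
  shows "Poly_Mapping.single (u @ [\<lambda>h. cscale c (\<eta> h)] @ v) f
         - Poly_Mapping.single (u @ [\<eta>] @ v) (cscale c f) \<in> rels"
  unfolding rels_eq smash_generators_def by (rule group_closure.base) (use assms in blast)

lemma generator_lie: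
  assumes "u \<in> lists (Der A)" "v \<in> lists (Der A)" "\<eta> \<in> Der A" "\<mu> \<in> Der A" "f \<in> A"
  shows "Poly_Mapping.single (u @ [\<eta>, \<mu>] @ v) f - Poly_Mapping.single (u @ [\<mu>, \<eta>] @ v) f
         - Poly_Mapping.single (u @ [lie \<eta> \<mu>] @ v) f \<in> rels"
  unfolding rels_eq smash_generators_def by (rule group_closure.base) (use assms in blast)

lemma generators_subset_C: "smash_generators \<subseteq> C"
  unfolding smash_generators_def
  by (auto intro!: C_diff C_single cscale_closed Der_add_closed Der_cscale_closed Der_lie_closed)

lemma rels_subset_C: "rels \<subseteq> C"
proof
  fix p assume "p \<in> rels"
  then show "p \<in> C"
    unfolding rels_eq
    by induction (use generators_subset_C in \<open>auto intro: C_zero C_diff\<close>)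
qed

lemma generator_cases [consumes 1, case_names add cscale lie]:
  assumes "s \<in> smash_generators"
  obtains u v \<eta> \<mu> f where
      "s = Poly_Mapping.single (u @ [\<eta> + \<mu>] @ v) f - Poly_Mapping.single (u @ [\<eta>] @ v) f
         - Poly_Mapping.single (u @ [\<mu>] @ v) f"
      "u \<in> lists (Der A)" "v \<in> lists (Der A)" "\<eta> \<in> Der A" "\<mu> \<in> Der A" "f \<in> A"
  | u v \<eta> c f where
      "s = Poly_Mapping.single (u @ [\<lambda>h. cscale c (\<eta> h)] @ v) f
         - Poly_Mapping.single (u @ [\<eta>] @ v) (cscale c f)"
      "u \<in> lists (Der A)" "v \<in> lists (Der A)" "\<eta> \<in> Der A" "f \<in> A"
  | u v \<eta> \<mu> f where
      "s = Poly_Mapping.single (u @ [\<eta>, \<mu>] @ v) f - Poly_Mapping.single (u @ [\<mu>, \<eta>] @ v) f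
         - Poly_Mapping.single (u @ [lie \<eta> \<mu>] @ v) f"
      "u \<in> lists (Der A)" "v \<in> lists (Der A)" "\<eta> \<in> Der A" "\<mu> \<in> Der A" "f \<in> A"
  using assms unfolding smash_generators_def
  by (elim UnE CollectE exE conjE)
    ((rule that(1); assumption) | (rule that(2); assumption) | (rule that(3); assumption))+

lemma rels_coeff_mult:
  assumes "f \<in> A" "p \<in> rels"
  shows "coeff_mult f p \<in> rels"
proof (rule group_closure_image_mem[where h = "coeff_mult f" and C = C])
  fix s assume "s \<in> smash_generators"
  then show "coeff_mult f s \<in> rels"
  proof (cases rule: generator_cases)
    case (cscale u v \<eta> c g)
    moreover have "f * cscale c g = cscale c (f * g)"
      by (simp add: cscale_def fun_eq_iff)
    ultimately show ?thesis
      using generator_cscale[of u v \<eta> "f * g"] assms(1)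
      by (simp add: coeff_mult_simps mult_closed)
  qed (use generator_add generator_lie assms(1) in \<open>auto simp: coeff_mult_simps mult_closed\<close>)
qed (use assms(2) generators_subset_C C_closed rels_zero rels_diff in
    \<open>auto simp: coeff_mult_simps rels_eq\<close>)

lemma rels_letter_mult:
  assumes "\<nu> \<in> Der A" "p \<in> rels"
  shows "letter_mult \<nu> p \<in> rels"
proof (rule group_closure_image_mem[where h = "letter_mult \<nu>" and C = C])
  fix s assume "s \<in> smash_generators"
  then show "letter_mult \<nu> s \<in> rels"
  proof (cases rule: generator_cases)
    case (add u v \<eta> \<mu> f)
    have "letter_mult \<nu> s =
       (Poly_Mapping.single (u @ [\<eta> + \<mu>] @ v) (\<nu> f) - Poly_Mapping.single (u @ [\<eta>] @ v) (\<nu> f)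
         - Poly_Mapping.single (u @ [\<mu>] @ v) (\<nu> f)) +
       (Poly_Mapping.single ((\<nu> # u) @ [\<eta> + \<mu>] @ v) f - Poly_Mapping.single ((\<nu> # u) @ [\<eta>] @ v) f
         - Poly_Mapping.single ((\<nu> # u) @ [\<mu>] @ v) f)"
      using add assms(1)
      by (simp add: letter_mult_diff letter_mult_single C_diff C_single Der_add_closed)
    also have "\<dots> \<in> rels"
      by (intro rels_add generator_add) (use add assms(1) in \<open>auto intro: Der_closed[OF assms(1)]\<close>)
    finally show ?thesis .
  next
    case (cscale u v \<eta> c f)
    have "letter_mult \<nu> s =
       (Poly_Mapping.single (u @ [\<lambda>h. cscale c (\<eta> h)] @ v) (\<nu> f)
         - Poly_Mapping.single (u @ [\<eta>] @ v) (cscale c (\<nu> f))) +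
       (Poly_Mapping.single ((\<nu> # u) @ [\<lambda>h. cscale c (\<eta> h)] @ v) f
         - Poly_Mapping.single ((\<nu> # u) @ [\<eta>] @ v) (cscale c f))"
      using cscale assms(1)
      by (simp add: letter_mult_diff letter_mult_single C_single Der_cscale_closed cscale_closed
          Der_cscale[OF assms(1)])
    also have "\<dots> \<in> rels"
      by (intro rels_add generator_cscale) (use cscale assms(1) in \<open>auto intro: Der_closed[OF assms(1)]\<close>)
    finally show ?thesis .
  next
    case (lie u v \<eta> \<mu> f)
    have "letter_mult \<nu> s =
       (Poly_Mapping.single (u @ [\<eta>, \<mu>] @ v) (\<nu> f) - Poly_Mapping.single (u @ [\<mu>, \<eta>] @ v) (\<nu> f)
         - Poly_Mapping.single (u @ [lie \<eta> \<mu>] @ v) (\<nu> f)) +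
       (Poly_Mapping.single ((\<nu> # u) @ [\<eta>, \<mu>] @ v) f - Poly_Mapping.single ((\<nu> # u) @ [\<mu>, \<eta>] @ v) f
         - Poly_Mapping.single ((\<nu> # u) @ [lie \<eta> \<mu>] @ v) f)"
      using lie assms(1)
      by (simp add: letter_mult_diff letter_mult_single C_diff C_single Der_lie_closed)
    also have "\<dots> \<in> rels"
      by (intro rels_add generator_lie) (use lie assms(1) in \<open>auto intro: Der_closed[OF assms(1)]\<close>)
    finally show ?thesis .
  qed
qed (use assms(2) generators_subset_C C_closed rels_zero rels_diff in
    \<open>auto simp: letter_mult_diff[OF assms(1)] rels_eq\<close>)

lemma rels_word_mult: "u \<in> lists (Der A) \<Longrightarrow> p \<in> rels \<Longrightarrow> foldr letter_mult u p \<in> rels"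
  by (induction rule: lists.induct) (auto intro: rels_letter_mult)

text \<open>To multiply a relation from the right by $g w$, its letters have to act on $g w$.  The terms in
  which a letter differentiates \<open>g\<close> cancel by the Leibniz rule, and what remains is the same relation
  in front of \<open>w\<close> with coefficient \<open>g\<close>.\<close>

lemma letter_mult_add_letter:
  assumes "\<eta> \<in> Der A" "\<mu> \<in> Der A" "q \<in> C"
  shows "letter_mult (\<eta> + \<mu>) q - letter_mult \<eta> q - letter_mult \<mu> q \<in> rels"
proof -
  define \<nu> where "\<nu> = \<eta> + \<mu>"
  have \<nu>: "\<nu> \<in> Der A" "\<nu> g = \<eta> g + \<mu> g" for g
    using assms(1,2) by (simp_all add: \<nu>_def Der_add_closed)
  show ?thesis
    unfolding \<nu>_def[symmetric] using assms(3)
  proof (induction rule: C_induct)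
    case (single w g)
    then show ?case
      using generator_add[of "[]" w \<eta> \<mu> g, folded \<nu>_def] assms(1,2) \<nu>(1)
      by (simp add: letter_mult_single \<nu>(2)[of g] single_add diff_diff_eq)
  next
    case (add w g q)
    from rels_add[OF add.IH] show ?case
      using add assms(1,2) \<nu>(1)
      by (simp add: letter_mult_add C_single algebra_simps)
  qed (simp add: letter_mult_zero rels_zero)
qed

lemma letter_mult_cscale_letter:
  assumes "\<eta> \<in> Der A" "q \<in> C"
  shows "letter_mult (\<lambda>h. cscale c (\<eta> h)) q - coeff_mult (cscale c (indicator U)) (letter_mult \<eta> q)
    \<in> rels"
  using assms(2)
proof (induction rule: C_induct)
  case (single w g)
  then show ?case
    using generator_cscale[of "[]" w \<eta> g] assms(1)
    by (simp add: letter_mult_single Der_cscale_closed coeff_mult_simps cscale_unit_mult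
        Der_closed[OF assms(1)])
next
  case (add w g q)
  from rels_add[OF add.IH] show ?case
    using add assms(1)
    by (simp add: letter_mult_add Der_cscale_closed C_single coeff_mult_simps algebra_simps)
qed (simp add: letter_mult_zero rels_zero coeff_mult_simps)

lemma letter_mult_lie_letter:
  assumes "\<eta> \<in> Der A" "\<mu> \<in> Der A" "q \<in> C"
  shows "letter_mult \<eta> (letter_mult \<mu> q) - letter_mult \<mu> (letter_mult \<eta> q) - letter_mult (lie \<eta> \<mu>) q
    \<in> rels"
  using assms(3)
proof (induction rule: C_induct)
  case (single w g)
  have "Poly_Mapping.single w (\<eta> (\<mu> g))
      = Poly_Mapping.single w (\<mu> (\<eta> g)) + Poly_Mapping.single w (lie \<eta> \<mu> g)"
    by (simp add: lie_def single_diff)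
  then show ?case
    using generator_lie[of "[]" w \<eta> \<mu> g] assms(1,2) single
    by (simp add: letter_mult_single letter_mult_add C_single Der_closed[OF assms(1)]
        Der_closed[OF assms(2)] Der_lie_closed diff_diff_eq)
next
  case (add w g q)
  from rels_add[OF add.IH] show ?case
    using add assms(1,2)
    by (simp add: letter_mult_add Der_lie_closed C_single C_letter_mult algebra_simps)
qed (simp add: letter_mult_zero rels_zero)

lemma rels_smash_mult_left:
  assumes "p \<in> C" "r \<in> rels"
  shows "smash_mult p r \<in> rels"
  using assms(1)
  by (induction rule: C_induct)
    (auto simp: smash_mult_zero_left smash_mult_add_left smash_mult_single assms(2)
      intro!: rels_zero rels_add rels_coeff_mult rels_word_mult)

lemma rels_smash_mult_right:
  assumes "r \<in> rels" "q \<in> C"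
  shows "smash_mult r q \<in> rels"
proof (rule group_closure_image_mem[where h = "\<lambda>r. smash_mult r q" and C = UNIV])
  fix s assume "s \<in> smash_generators"
  then show "smash_mult s q \<in> rels"
  proof (cases rule: generator_cases)
    case (add u v \<eta> \<mu> f)
    define q' where "q' = foldr letter_mult v q"
    have q': "q' \<in> C"
      unfolding q'_def using add assms(2) by (simp add: C_word_mult)
    have "smash_mult s q = coeff_mult f (foldr letter_mult u
        (letter_mult (\<eta> + \<mu>) q' - letter_mult \<eta> q' - letter_mult \<mu> q'))"
      using add q'
      by (simp add: smash_mult_diff_left smash_mult_single q'_def[symmetric] word_mult_diff
          coeff_mult_simps C_letter_mult C_diff Der_add_closed in_listsI)
    also have "\<dots> \<in> rels"
      by (intro rels_coeff_mult rels_word_mult letter_mult_add_letter add q')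
    finally show ?thesis .
  next
    case (cscale u v \<eta> c f)
    define q' where "q' = foldr letter_mult v q"
    have q': "q' \<in> C"
      unfolding q'_def using cscale assms(2) by (simp add: C_word_mult)
    have "f * cscale c (indicator U) = cscale c f"
      using cscale_unit_mult[OF cscale(5)] by (simp add: mult.commute)
    then have "smash_mult s q = coeff_mult f (foldr letter_mult u
        (letter_mult (\<lambda>h. cscale c (\<eta> h)) q' - coeff_mult (cscale c (indicator U)) (letter_mult \<eta> q')))"
      using cscale q'
      by (simp add: smash_mult_diff_left smash_mult_single q'_def[symmetric] word_mult_diff
          word_mult_cscale coeff_mult_simps C_letter_mult C_coeff_mult cscale_closed unit_closed
          Der_cscale_closed in_listsI)
    also have "\<dots> \<in> rels"
      by (intro rels_coeff_mult rels_word_mult letter_mult_cscale_letter cscale q')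
    finally show ?thesis .
  next
    case (lie u v \<eta> \<mu> f)
    define q' where "q' = foldr letter_mult v q"
    have q': "q' \<in> C"
      unfolding q'_def using lie assms(2) by (simp add: C_word_mult)
    have "smash_mult s q = coeff_mult f (foldr letter_mult u
        (letter_mult \<eta> (letter_mult \<mu> q') - letter_mult \<mu> (letter_mult \<eta> q')
          - letter_mult (lie \<eta> \<mu>) q'))"
      using lie q'
      by (simp add: smash_mult_diff_left smash_mult_single q'_def[symmetric] word_mult_diff
          coeff_mult_simps C_letter_mult C_diff Der_lie_closed in_listsI)
    also have "\<dots> \<in> rels"
      by (intro rels_coeff_mult rels_word_mult letter_mult_lie_letter lie q')
    finally show ?thesis .
  qed
qed (use assms(1) rels_zero rels_diff in \<open>auto simp: smash_mult_diff_left rels_eq\<close>)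

lemma ideal_rels: "ideal rels (smash_free U A (Der A))"
proof (rule idealI)
  interpret ring "smash_free U A (Der A)"
    by (rule ring_smash_free)
  show "subgroup rels (add_monoid (smash_free U A (Der A)))"
  proof (rule add.subgroupI)
    fix p assume "p \<in> rels"
    then show "\<ominus>\<^bsub>smash_free U A (Der A)\<^esub> p \<in> rels"
      using minus_equality[of "- p" p] rels_subset_C rels_diff[OF rels_zero, of p]
      by (auto simp: smash_free_simps C_uminus)
  qed (use rels_zero rels_subset_C in \<open>auto simp: smash_free_simps rels_add\<close>)
qed (use rels_subset_C in \<open>auto simp: mult_smash_free rels_smash_mult_left rels_smash_mult_right ring_smash_free\<close>)

end


section \<open>Products of antidiagonal differences\<close>

text \<open>For a biadditive \<open>\<phi>\<close>, seen as a map on $A \otimes A$, \<open>antidiag \<phi> [f\<^sub>1, \<dots>, f\<^sub>k] g h\<close> is its value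
  on $(g \otimes h) \prod_i (f_i \otimes 1 - 1 \otimes f_i)$; such elements span $\Delta^k$.  Keeping
  \<open>\<phi>\<close> arbitrary lets the same computation serve in $A \otimes A$ and in $A\#V$.\<close>

primrec antidiag :: "('f \<Rightarrow> 'f \<Rightarrow> 'a::ab_group_add) \<Rightarrow> 'f::comm_ring_1 list \<Rightarrow> 'f \<Rightarrow> 'f \<Rightarrow> 'a" where
  "antidiag \<phi> [] g h = \<phi> g h"
| "antidiag \<phi> (f # fs) g h = antidiag \<phi> fs (g * f) h - antidiag \<phi> fs g (h * f)"

text \<open>Subgroups of the additive group of a type.  Spans, relations and annihilators are all of this
  kind, and additive maps only have to be controlled on generators of them.\<close>

definition diff_closed_set :: "'a::ab_group_add set \<Rightarrow> bool" where
  "diff_closed_set R \<longleftrightarrow> 0 \<in> R \<and> (\<forall>a\<in>R. \<forall>b\<in>R. a - b \<in> R)"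

lemma diff_closed_setD:
  assumes "diff_closed_set R"
  shows "0 \<in> R" "a \<in> R \<Longrightarrow> b \<in> R \<Longrightarrow> a - b \<in> R" "a \<in> R \<Longrightarrow> - a \<in> R" "a \<in> R \<Longrightarrow> b \<in> R \<Longrightarrow> a + b \<in> R"
proof -
  show zero: "0 \<in> R" and diff: "a \<in> R \<Longrightarrow> b \<in> R \<Longrightarrow> a - b \<in> R" for a b
    using assms by (auto simp: diff_closed_set_def)
  show "a \<in> R \<Longrightarrow> - a \<in> R" for a
    using diff[OF zero, of a] by simp
  then show "a \<in> R \<Longrightarrow> b \<in> R \<Longrightarrow> a + b \<in> R"
    using diff[of a "- b"] by simp
qed

lemma diff_closed_set_sum: "diff_closed_set R \<Longrightarrow> (\<And>i. i \<in> I \<Longrightarrow> f i \<in> R) \<Longrightarrow> sum f I \<in> R"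
  by (induction I rule: infinite_finite_induct) (auto intro: diff_closed_setD)

lemma diff_closed_set_group_closure: "diff_closed_set (group_closure S)"
  by (simp add: diff_closed_set_def group_closure.diff)

lemma diff_closed_set_translate:
  assumes "diff_closed_set R" "a \<in> R"
  shows "(\<lambda>t. t + a) ` R = R"
proof
  show "(\<lambda>t. t + a) ` R \<subseteq> R"
    using diff_closed_setD(4)[OF assms(1)] assms(2) by blast
  show "R \<subseteq> (\<lambda>t. t + a) ` R"
  proof
    fix t assume "t \<in> R"
    then have "t - a \<in> R"
      using diff_closed_setD(2)[OF assms(1)] assms(2) by blast
    then show "t \<in> (\<lambda>t. t + a) ` R"
      by (rule rev_image_eqI) simp
  qed
qed

lemma antidiag_add: "antidiag (\<lambda>g h. \<phi> g h + \<psi> g h) fs g h = antidiag \<phi> fs g h + antidiag \<psi> fs g h"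
  by (induction fs arbitrary: g h) (simp_all add: algebra_simps)

lemma antidiag_diff: "antidiag (\<lambda>g h. \<phi> g h - \<psi> g h) fs g h = antidiag \<phi> fs g h - antidiag \<psi> fs g h"
  by (induction fs arbitrary: g h) (simp_all add: algebra_simps)

lemma antidiag_shift:
  "antidiag (\<lambda>g h. \<phi> (g * a) (h * b)) fs g h = antidiag \<phi> fs (g * a) (h * b)"
  by (induction fs arbitrary: g h) (simp_all add: ac_simps)

lemma antidiag_shift_left: "antidiag (\<lambda>g h. \<phi> (g * a) h) fs g h = antidiag \<phi> fs (g * a) h"
  using antidiag_shift[of \<phi> a 1] by simp

text \<open>A map on $A \otimes A$ that factors through multiplication is zero on \<open>\<Delta>\<close>.\<close>

lemma antidiag_of_product:
  assumes "fs \<noteq> []"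
  shows "antidiag (\<lambda>g h. \<phi> (g * h)) fs g h = 0"
proof -
  have eq: "antidiag (\<lambda>g h. \<phi> (g * h)) fs g h = antidiag (\<lambda>g h. \<phi> (g * h)) fs g' h'"
    if "g * h = g' * h'" for fs g h g' h'
    using that
  proof (induction fs arbitrary: g h g' h')
    case (Cons f fs)
    have "(g * f) * h = (g' * f) * h'" "g * (h * f) = g' * (h' * f)"
      using arg_cong[OF Cons.prems, of "\<lambda>x. x * f"] by (simp_all add: ac_simps)
    then show ?case
      using Cons.IH by (metis antidiag.simps(2))
  qed simp
  obtain f fs' where fs: "fs = f # fs'"
    using assms by (cases fs) auto
  show ?thesis
    unfolding fs antidiag.simps using eq[of "g * f" h g "h * f" fs'] by (simp add: ac_simps)
qed

lemma antidiag_append: "antidiag \<phi> (fs @ gs) g h = antidiag (antidiag \<phi> gs) fs g h"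
  by (induction fs arbitrary: g h) simp_all

context function_algebra
begin

lemma antidiag_cong:
  assumes "\<And>g h. g \<in> A \<Longrightarrow> h \<in> A \<Longrightarrow> \<phi> g h = \<psi> g h" "set fs \<subseteq> A" "g \<in> A" "h \<in> A"
  shows "antidiag \<phi> fs g h = antidiag \<psi> fs g h"
  using assms(2-) by (induction fs arbitrary: g h) (auto simp: assms(1) mult_closed)

lemma antidiag_mem:
  assumes "diff_closed_set R" "\<And>g h. g \<in> A \<Longrightarrow> h \<in> A \<Longrightarrow> \<phi> g h \<in> R" "set fs \<subseteq> A" "g \<in> A" "h \<in> A"
  shows "antidiag \<phi> fs g h \<in> R"
  using assms(3-)
  by (induction fs arbitrary: g h) (auto simp: assms(2) mult_closed diff_closed_setD[OF assms(1)])

lemma antidiag_hom: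
  assumes R: "diff_closed_set R" "\<And>a b. a \<in> R \<Longrightarrow> b \<in> R \<Longrightarrow> F (a - b) = F a - F b"
    and \<phi>: "\<And>g h. g \<in> A \<Longrightarrow> h \<in> A \<Longrightarrow> \<phi> g h \<in> R"
    and "set fs \<subseteq> A" "g \<in> A" "h \<in> A"
  shows "F (antidiag \<phi> fs g h) = antidiag (\<lambda>g h. F (\<phi> g h)) fs g h"
  using assms(4-)
  by (induction fs arbitrary: g h) (auto simp: R antidiag_mem[OF R(1) \<phi>] mult_closed)

text \<open>In $A\#V$ the map $(g, f) \mapsto g\#f\eta$ is additive in \<open>f\<close> and balanced over the constants
  only after passing to the quotient, so these properties are required modulo a subgroup.\<close>

definition balanced_mod :: "'a::ab_group_add set \<Rightarrow> ('k fn \<Rightarrow> 'k fn \<Rightarrow> 'a) \<Rightarrow> bool" where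
  "balanced_mod R \<phi> \<longleftrightarrow> (\<forall>a\<in>A. \<forall>a'\<in>A. \<forall>b\<in>A. \<phi> (a + a') b - \<phi> a b - \<phi> a' b \<in> R) \<and>
     (\<forall>a\<in>A. \<forall>b\<in>A. \<forall>b'\<in>A. \<phi> a (b + b') - \<phi> a b - \<phi> a b' \<in> R) \<and>
     (\<forall>c. \<forall>a\<in>A. \<forall>b\<in>A. \<phi> (cscale c a) b - \<phi> a (cscale c b) \<in> R)"

lemma balanced_modD:
  assumes "balanced_mod R \<phi>"
  shows "a \<in> A \<Longrightarrow> a' \<in> A \<Longrightarrow> b \<in> A \<Longrightarrow> \<phi> (a + a') b - \<phi> a b - \<phi> a' b \<in> R"
    and "a \<in> A \<Longrightarrow> b \<in> A \<Longrightarrow> b' \<in> A \<Longrightarrow> \<phi> a (b + b') - \<phi> a b - \<phi> a b' \<in> R"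
    and "a \<in> A \<Longrightarrow> b \<in> A \<Longrightarrow> \<phi> (cscale c a) b - \<phi> a (cscale c b) \<in> R"
  using assms unfolding balanced_mod_def by blast+

lemma cscale_mult: "cscale c f * g = cscale c (f * g)" for f g :: "'k fn"
  by (simp add: cscale_def fun_eq_iff mult.assoc)

lemma mult_cscale: "g * cscale c f = cscale c (g * f)" for f g :: "'k fn"
  by (simp add: cscale_def fun_eq_iff)

lemma balanced_mod_antidiag:
  assumes R: "diff_closed_set R" and "balanced_mod R \<phi>" "set fs \<subseteq> A"
  shows "balanced_mod R (antidiag \<phi> fs)"
  using assms(3)
proof (induction fs)
  case Nil
  then show ?case
    using assms(2) by (simp add: balanced_mod_def)
next
  case (Cons f fs)
  then have IH: "balanced_mod R (antidiag \<phi> fs)" and f: "f \<in> A"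
    by simp_all
  have rearrange: "(x - y) - (x' - y') - (x'' - y'') = (x - x' - x'') - (y - y' - y'')"
    and rearrange': "(x - y) - (x' - y') = (x - x') - (y - y')" for x y x' y' x'' y'' :: 'a
    by simp_all
  show ?case
    unfolding balanced_mod_def antidiag.simps distrib_right cscale_mult
  proof (intro conjI ballI allI, unfold rearrange)
    fix c a b assume "a \<in> A" "b \<in> A"
    show "antidiag \<phi> fs (cscale c (a * f)) b - antidiag \<phi> fs (cscale c a) (b * f)
        - (antidiag \<phi> fs (a * f) (cscale c b) - antidiag \<phi> fs a (cscale c (b * f))) \<in> R"
      by (subst rearrange', rule diff_closed_setD(2)[OF R])
        (use \<open>a \<in> A\<close> \<open>b \<in> A\<close> f in \<open>auto intro!: balanced_modD[OF IH] mult_closed\<close>)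
  qed (rule diff_closed_setD(2)[OF R]; use f in \<open>auto intro!: balanced_modD[OF IH] mult_closed\<close>)+
qed

text \<open>The Leibniz rule for $\mu \otimes 1 + 1 \otimes \mu$: each factor $f \otimes 1 - 1 \otimes f$ is
  replaced by $\mu(f) \otimes 1 - 1 \otimes \mu(f)$, so the number of factors is kept.\<close>

lemma antidiag_Leibniz:
  assumes R: "diff_closed_set R" and \<phi>: "balanced_mod R \<phi>" and \<mu>: "\<mu> \<in> Der A"
    and "set fs \<subseteq> A" "g \<in> A" "h \<in> A"
  shows "antidiag (\<lambda>g h. \<phi> (\<mu> g) h + \<phi> g (\<mu> h)) fs g h
      - (antidiag \<phi> fs (\<mu> g) h + antidiag \<phi> fs g (\<mu> h)
         + (\<Sum>i<length fs. antidiag \<phi> (fs[i := \<mu> (fs ! i)]) g h)) \<in> R"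
  using assms(4-)
proof (induction fs arbitrary: g h)
  case Nil
  then show ?case
    by (simp add: diff_closed_setD(1)[OF R])
next
  case (Cons f fs)
  note A = Cons.prems(2,3) Der_closed[OF \<mu> Cons.prems(2)] Der_closed[OF \<mu> Cons.prems(3)]
  have f: "f \<in> A" "\<mu> f \<in> A" and fs: "set fs \<subseteq> A"
    using Cons.prems(1) Der_closed[OF \<mu>] by auto
  let ?a = "antidiag \<phi> fs" and ?L = "antidiag (\<lambda>g h. \<phi> (\<mu> g) h + \<phi> g (\<mu> h)) fs"
  let ?s = "\<lambda>g h. \<Sum>i<length fs. antidiag \<phi> (fs[i := \<mu> (fs ! i)]) g h"
  have IH: "?L (g * f) h - (?a (\<mu> (g * f)) h + ?a (g * f) (\<mu> h) + ?s (g * f) h) \<in> R"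
    "?L g (h * f) - (?a (\<mu> g) (h * f) + ?a g (\<mu> (h * f)) + ?s g (h * f)) \<in> R"
    using A f fs by (auto intro!: Cons.IH mult_closed)
  have bal: "?a (\<mu> (g * f)) h - ?a (\<mu> g * f) h - ?a (g * \<mu> f) h \<in> R"
    "?a g (\<mu> (h * f)) - ?a g (\<mu> h * f) - ?a g (h * \<mu> f) \<in> R"
    unfolding Der_mult[OF \<mu> A(1) f(1)] Der_mult[OF \<mu> A(2) f(1)]
    using A f by (auto intro!: balanced_modD[OF balanced_mod_antidiag[OF R \<phi> fs]] mult_closed)
  have s: "(\<Sum>i<length (f # fs). antidiag \<phi> ((f # fs)[i := \<mu> ((f # fs) ! i)]) g h)
      = ?a (g * \<mu> f) h - ?a g (h * \<mu> f) + (?s (g * f) h - ?s g (h * f))"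
    by (simp add: sum.lessThan_Suc_shift sum_subtractf del: sum.lessThan_Suc)
  have "antidiag (\<lambda>g h. \<phi> (\<mu> g) h + \<phi> g (\<mu> h)) (f # fs) g h
      - (antidiag \<phi> (f # fs) (\<mu> g) h + antidiag \<phi> (f # fs) g (\<mu> h)
         + (\<Sum>i<length (f # fs). antidiag \<phi> ((f # fs)[i := \<mu> ((f # fs) ! i)]) g h))
    = ((?L (g * f) h - (?a (\<mu> (g * f)) h + ?a (g * f) (\<mu> h) + ?s (g * f) h))
       + (?a (\<mu> (g * f)) h - ?a (\<mu> g * f) h - ?a (g * \<mu> f) h))
     - ((?L g (h * f) - (?a (\<mu> g) (h * f) + ?a g (\<mu> (h * f)) + ?s g (h * f)))
       + (?a g (\<mu> (h * f)) - ?a g (\<mu> h * f) - ?a g (h * \<mu> f)))"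
    unfolding s antidiag.simps by (simp add: algebra_simps)
  also have "\<dots> \<in> R"
    by (intro diff_closed_setD(2,4)[OF R] IH bal)
  finally show ?case .
qed

text \<open>Since $c \otimes 1 = 1 \otimes c$ for constants, the factors only depend on the \<open>f\<^sub>i\<close> up to
  constants.\<close>

lemma antidiag_subtract_constants:
  assumes R: "diff_closed_set R" and \<phi>: "balanced_mod R \<phi>"
    and "set fs \<subseteq> A" "g \<in> A" "h \<in> A"
  shows "antidiag \<phi> fs g h - antidiag \<phi> (map (\<lambda>f. f - cscale (c f) (indicator U)) fs) g h \<in> R"
  using assms(3-)
proof (induction fs arbitrary: g h)
  case Nil
  then show ?case
    by (simp add: diff_closed_setD(1)[OF R])
next
  case (Cons f fs)
  let ?a = "antidiag \<phi> fs" and ?n = "\<lambda>f. f - cscale (c f) (indicator U)"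
  let ?b = "antidiag \<phi> (map ?n fs)"
  have A: "f \<in> A" "?n f \<in> A" "set fs \<subseteq> A" "g \<in> A" "h \<in> A"
    using Cons.prems by (auto intro: closed)
  have split: "k * f = k * ?n f + cscale (c f) k" if "k \<in> A" for k
    using mult_unit[OF that]
    by (auto simp: fun_eq_iff cscale_def algebra_simps)
  have bal: "?a (g * f) h - ?a (g * ?n f) h - ?a (cscale (c f) g) h \<in> R"
    "?a g (h * f) - ?a g (h * ?n f) - ?a g (cscale (c f) h) \<in> R"
    "?a (cscale (c f) g) h - ?a g (cscale (c f) h) \<in> R"
    unfolding split[OF A(4)] split[OF A(5)]
    using A by (auto intro!: balanced_modD[OF balanced_mod_antidiag[OF R \<phi> A(3)]]
        mult_closed cscale_closed)
  have IH: "?a (g * ?n f) h - ?b (g * ?n f) h \<in> R" "?a g (h * ?n f) - ?b g (h * ?n f) \<in> R"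
    using A by (auto intro!: Cons.IH mult_closed)
  have "antidiag \<phi> (f # fs) g h - antidiag \<phi> (map ?n (f # fs)) g h =
     ((?a (g * f) h - ?a (g * ?n f) h - ?a (cscale (c f) g) h) + (?a (g * ?n f) h - ?b (g * ?n f) h))
     - ((?a g (h * f) - ?a g (h * ?n f) - ?a g (cscale (c f) h)) + (?a g (h * ?n f) - ?b g (h * ?n f)))
     + (?a (cscale (c f) g) h - ?a g (cscale (c f) h))"
    by simp
  also have "\<dots> \<in> R"
    by (intro diff_closed_setD(2,4)[OF R] IH bal)
  finally show ?case .
qed


section \<open>The span of $\Delta^k \otimes V$ and its commutators\<close>

text \<open>\<open>Delta_span k\<close> consists of the representatives of $\Delta^k \otimes_A V$ in the free smash product.
  The relations are included, so that membership depends on the class only.\<close>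

definition sharp :: "'k der \<Rightarrow> 'k fn \<Rightarrow> 'k fn \<Rightarrow> ('k der list \<Rightarrow>\<^sub>0 'k fn)" where
  "sharp \<eta> g h = Poly_Mapping.single [fmul h \<eta>] g"

definition Delta_span :: "nat \<Rightarrow> ('k der list \<Rightarrow>\<^sub>0 'k fn) set" where
  "Delta_span k = group_closure (rels \<union>
     {antidiag (sharp \<eta>) fs g h | \<eta> fs g h.
        \<eta> \<in> Der A \<and> set fs \<subseteq> A \<and> length fs = k \<and> g \<in> A \<and> h \<in> A})"

lemma diff_closed_set_C: "diff_closed_set C"
  by (simp add: diff_closed_set_def C_zero C_diff)

lemma diff_closed_set_rels: "diff_closed_set rels"
  by (simp add: diff_closed_set_def rels_zero rels_diff)

lemma diff_closed_set_Delta_span: "diff_closed_set (Delta_span k)"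
  unfolding Delta_span_def by (rule diff_closed_set_group_closure)

lemma rels_subset_Delta_span: "rels \<subseteq> Delta_span k"
  unfolding Delta_span_def by (auto intro: group_closure.base)

lemma antidiag_sharp_mem_Delta_span:
  "\<eta> \<in> Der A \<Longrightarrow> set fs \<subseteq> A \<Longrightarrow> g \<in> A \<Longrightarrow> h \<in> A \<Longrightarrow> antidiag (sharp \<eta>) fs g h \<in> Delta_span (length fs)"
  unfolding Delta_span_def by (rule group_closure.base) blast

lemma Delta_span_subset:
  assumes "diff_closed_set K" "rels \<subseteq> K"
    and "\<And>\<eta> fs g h. \<eta> \<in> Der A \<Longrightarrow> set fs \<subseteq> A \<Longrightarrow> length fs = k \<Longrightarrow> g \<in> A \<Longrightarrow> h \<in> A
      \<Longrightarrow> antidiag (sharp \<eta>) fs g h \<in> K"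
  shows "Delta_span k \<subseteq> K"
proof
  fix p assume "p \<in> Delta_span k"
  then show "p \<in> K"
    unfolding Delta_span_def
    by induction (use assms diff_closed_setD[OF assms(1)] in auto)
qed

lemma C_sharp: "\<eta> \<in> Der A \<Longrightarrow> g \<in> A \<Longrightarrow> h \<in> A \<Longrightarrow> sharp \<eta> g h \<in> C"
  by (simp add: sharp_def C_single Der_fmul_closed)

lemma C_antidiag_sharp:
  "\<eta> \<in> Der A \<Longrightarrow> set fs \<subseteq> A \<Longrightarrow> g \<in> A \<Longrightarrow> h \<in> A \<Longrightarrow> antidiag (sharp \<eta>) fs g h \<in> C"
  by (rule antidiag_mem[OF diff_closed_set_C]) (auto simp: C_sharp)

lemma Delta_span_subset_C: "Delta_span k \<subseteq> C"
  by (rule Delta_span_subset[OF diff_closed_set_C rels_subset_C]) (rule C_antidiag_sharp)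

lemma balanced_mod_sharp:
  assumes "\<eta> \<in> Der A"
  shows "balanced_mod rels (sharp \<eta>)"
  unfolding balanced_mod_def
proof (intro conjI ballI allI)
  fix a a' b assume "a \<in> A" "a' \<in> A" "b \<in> A"
  then show "sharp \<eta> (a + a') b - sharp \<eta> a b - sharp \<eta> a' b \<in> rels"
    by (simp add: sharp_def single_add rels_zero)
next
  fix a b b' assume "a \<in> A" "b \<in> A" "b' \<in> A"
  then show "sharp \<eta> a (b + b') - sharp \<eta> a b - sharp \<eta> a b' \<in> rels"
    using generator_add[of "[]" "[]" "fmul b \<eta>" "fmul b' \<eta>" a] assms
    by (simp add: sharp_def fmul_add Der_fmul_closed)
next
  fix c a b assume "a \<in> A" "b \<in> A"
  then have "sharp \<eta> a (cscale c b) - sharp \<eta> (cscale c a) b \<in> rels"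
    using generator_cscale[of "[]" "[]" "fmul b \<eta>" a c] assms
    by (simp add: sharp_def fmul_cscale Der_fmul_closed)
  from diff_closed_setD(3)[OF diff_closed_set_rels this]
  show "sharp \<eta> (cscale c a) b - sharp \<eta> a (cscale c b) \<in> rels"
    by simp
qed

text \<open>For $k \geq 1$ the elements commute with functions, because $\eta(a)$ enters with the
  coefficient $\sum g_j f_j = 0$.\<close>

lemma antidiag_sharp_mult_coeff:
  assumes "\<eta> \<in> Der A" "set fs \<subseteq> A" "fs \<noteq> []" "g \<in> A" "h \<in> A" "a \<in> A"
  shows "smash_mult (antidiag (sharp \<eta>) fs g h) (Poly_Mapping.single [] a)
    = antidiag (sharp \<eta>) fs (g * a) h"
proof -
  let ?\<psi> = "\<lambda>p. Poly_Mapping.single [] (p * \<eta> a)"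
  have "smash_mult (antidiag (sharp \<eta>) fs g h) (Poly_Mapping.single [] a)
      = antidiag (\<lambda>g h. smash_mult (sharp \<eta> g h) (Poly_Mapping.single [] a)) fs g h"
    by (rule antidiag_hom[OF diff_closed_set_C])
      (use assms in \<open>auto simp: smash_mult_diff_left C_sharp\<close>)
  also have "\<dots> = antidiag (\<lambda>g h. ?\<psi> (g * h) + sharp \<eta> (g * a) h) fs g h"
  proof (rule antidiag_cong)
    fix g h assume "g \<in> A" "h \<in> A"
    moreover have "fmul h \<eta> a = h * \<eta> a"
      by (simp add: fmul_def)
    ultimately show "smash_mult (sharp \<eta> g h) (Poly_Mapping.single [] a)
        = ?\<psi> (g * h) + sharp \<eta> (g * a) h"
      using assms by (simp add: sharp_def smash_mult_single letter_mult_single Der_fmul_closed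
          coeff_mult_simps mult.assoc)
  qed (use assms in auto)
  also have "\<dots> = antidiag (sharp \<eta>) fs (g * a) h"
    unfolding antidiag_add antidiag_shift_left using antidiag_of_product[OF assms(3), of ?\<psi>] by simp
  finally show ?thesis .
qed

lemma single_letter_mult:
  "q \<in> C \<Longrightarrow> \<mu> \<in> Der A \<Longrightarrow> smash_mult (Poly_Mapping.single [\<mu>] (indicator U)) q = letter_mult \<mu> q"
  by (simp add: smash_mult_single coeff_mult_unit C_letter_mult)

text \<open>From $[\mu, g\#f\eta] = \mu(g)\#f\eta + g\#\mu(f)\eta + g\#f[\mu, \eta]$ the commutator with \<open>\<mu>\<close> acts on
  $\Delta^k \otimes V$ through the derivation $\mu \otimes 1 + 1 \otimes \mu$, which preserves $\Delta^k$, and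
  through the bracket on \<open>V\<close>.\<close>

lemma Delta_span_commutator:
  assumes "\<eta> \<in> Der A" "set fs \<subseteq> A" "g \<in> A" "h \<in> A" and \<mu>: "\<mu> \<in> Der A"
  shows "letter_mult \<mu> (antidiag (sharp \<eta>) fs g h)
      - smash_mult (antidiag (sharp \<eta>) fs g h) (Poly_Mapping.single [\<mu>] (indicator U))
    \<in> Delta_span (length fs)"
proof -
  let ?S = "Delta_span (length fs)"
  note S = diff_closed_setD[OF diff_closed_set_Delta_span]
  have lie: "lie \<mu> \<eta> \<in> Der A"
    by (rule Der_lie_closed[OF \<mu> assms(1)])
  let ?m = "\<lambda>g h. sharp \<eta> (\<mu> g) h + sharp \<eta> g (\<mu> h)"
  have "letter_mult \<mu> (antidiag (sharp \<eta>) fs g h)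
      - smash_mult (antidiag (sharp \<eta>) fs g h) (Poly_Mapping.single [\<mu>] (indicator U))
    = antidiag (\<lambda>g h. letter_mult \<mu> (sharp \<eta> g h)
        - smash_mult (sharp \<eta> g h) (Poly_Mapping.single [\<mu>] (indicator U))) fs g h"
    by (rule antidiag_hom[OF diff_closed_set_C])
      (use assms in \<open>auto simp: letter_mult_diff smash_mult_diff_left C_sharp\<close>)
  also have "\<dots> = antidiag ?m fs g h + antidiag (sharp (lie \<mu> \<eta>)) fs g h
      + antidiag (\<lambda>g h. letter_mult \<mu> (sharp \<eta> g h)
          - smash_mult (sharp \<eta> g h) (Poly_Mapping.single [\<mu>] (indicator U))
          - ?m g h - sharp (lie \<mu> \<eta>) g h) fs g h"
    by (simp add: antidiag_diff)
  also have "\<dots> \<in> ?S"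
  proof (intro S(4))
    let ?r = "antidiag (sharp \<eta>) fs (\<mu> g) h + antidiag (sharp \<eta>) fs g (\<mu> h)
         + (\<Sum>i<length fs. antidiag (sharp \<eta>) (fs[i := \<mu> (fs ! i)]) g h)"
    have "antidiag ?m fs g h - ?r \<in> rels"
      by (rule antidiag_Leibniz[OF diff_closed_set_rels balanced_mod_sharp]) (use assms in auto)
    then have "antidiag ?m fs g h - ?r \<in> ?S"
      using rels_subset_Delta_span by blast
    moreover have "?r \<in> ?S"
    proof (intro S(4) diff_closed_set_sum[OF diff_closed_set_Delta_span])
      fix i assume "i \<in> {..<length fs}"
      then have "\<mu> (fs ! i) \<in> A"
        using assms(2) nth_mem[of i fs] by (intro Der_closed[OF \<mu>]) auto
      then have "set (fs[i := \<mu> (fs ! i)]) \<subseteq> A"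
        using assms(2) set_update_subset_insert[of fs i "\<mu> (fs ! i)"] by blast
      then show "antidiag (sharp \<eta>) (fs[i := \<mu> (fs ! i)]) g h \<in> ?S"
        using antidiag_sharp_mem_Delta_span[of \<eta> "fs[i := \<mu> (fs ! i)]" g h] assms by simp
    qed (use assms Der_closed[OF \<mu>] in \<open>auto intro: antidiag_sharp_mem_Delta_span\<close>)
    ultimately have "(antidiag ?m fs g h - ?r) + ?r \<in> ?S"
      by (rule S(4))
    then show "antidiag ?m fs g h \<in> ?S"
      by simp
    show "antidiag (sharp (lie \<mu> \<eta>)) fs g h \<in> ?S"
      using assms lie by (intro antidiag_sharp_mem_Delta_span)
    have "letter_mult \<mu> (sharp \<eta> g h)
        - smash_mult (sharp \<eta> g h) (Poly_Mapping.single [\<mu>] (indicator U))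
        - ?m g h - sharp (lie \<mu> \<eta>) g h \<in> rels" if gh: "g \<in> A" "h \<in> A" for g h
    proof -
      have V: "fmul h \<eta> \<in> Der A" "fmul (\<mu> h) \<eta> \<in> Der A" "fmul h (lie \<mu> \<eta>) \<in> Der A"
        using gh assms lie Der_closed[OF \<mu>] by (auto intro: Der_fmul_closed)
      have L: "letter_mult \<mu> (sharp \<eta> g h) = Poly_Mapping.single [fmul h \<eta>] (\<mu> g)
          + Poly_Mapping.single [\<mu>, fmul h \<eta>] g"
        unfolding sharp_def by (rule letter_mult_single[OF \<mu>])
      have R: "smash_mult (sharp \<eta> g h) (Poly_Mapping.single [\<mu>] (indicator U))
          = Poly_Mapping.single [fmul h \<eta>, \<mu>] g"
        using gh by (simp add: sharp_def smash_mult_single letter_mult_single[OF V(1)]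
            Der_unit[OF V(1)] coeff_mult_simps)
      have "letter_mult \<mu> (sharp \<eta> g h)
        - smash_mult (sharp \<eta> g h) (Poly_Mapping.single [\<mu>] (indicator U))
        - ?m g h - sharp (lie \<mu> \<eta>) g h =
        (Poly_Mapping.single ([] @ [\<mu>, fmul h \<eta>] @ []) g - Poly_Mapping.single ([] @ [fmul h \<eta>, \<mu>] @ []) g
          - Poly_Mapping.single ([] @ [lie \<mu> (fmul h \<eta>)] @ []) g)
        + (Poly_Mapping.single ([] @ [fmul (\<mu> h) \<eta> + fmul h (lie \<mu> \<eta>)] @ []) g
          - Poly_Mapping.single ([] @ [fmul (\<mu> h) \<eta>] @ []) g
          - Poly_Mapping.single ([] @ [fmul h (lie \<mu> \<eta>)] @ []) g)"
        unfolding L R lie_fmul[OF \<mu> assms(1) gh(2)] unfolding sharp_def by simp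
      also have "\<dots> \<in> rels"
        by (intro rels_add generator_lie generator_add) (use V \<mu> gh in auto)
      finally show ?thesis .
    qed
    then have "antidiag (\<lambda>g h. letter_mult \<mu> (sharp \<eta> g h)
          - smash_mult (sharp \<eta> g h) (Poly_Mapping.single [\<mu>] (indicator U))
          - ?m g h - sharp (lie \<mu> \<eta>) g h) fs g h \<in> rels"
      using assms by (intro antidiag_mem[OF diff_closed_set_rels])
    then show "antidiag (\<lambda>g h. letter_mult \<mu> (sharp \<eta> g h)
          - smash_mult (sharp \<eta> g h) (Poly_Mapping.single [\<mu>] (indicator U))
          - ?m g h - sharp (lie \<mu> \<eta>) g h) fs g h \<in> ?S"
      using rels_subset_Delta_span by blast
  qed
  finally show ?thesis .
qed

text \<open>Letters of a right factor can be moved to the left at the cost of commutators, which stay in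
  the span.  Hence a left ideal containing the span contains the two-sided ideal it generates.\<close>

lemma Delta_span_mult_mem:
  assumes K: "diff_closed_set K" "\<And>p q. p \<in> C \<Longrightarrow> q \<in> K \<Longrightarrow> smash_mult p q \<in> K"
    and sub: "Delta_span k \<subseteq> K" and "k \<ge> 1" "p \<in> Delta_span k" "q \<in> C"
  shows "smash_mult p q \<in> K"
proof -
  let ?one = "indicator U"
  have extend: "smash_mult p q \<in> K"
    if "\<And>\<eta> fs g h. \<eta> \<in> Der A \<Longrightarrow> set fs \<subseteq> A \<Longrightarrow> length fs = k \<Longrightarrow> g \<in> A \<Longrightarrow> h \<in> A
      \<Longrightarrow> smash_mult (antidiag (sharp \<eta>) fs g h) q \<in> K" "p \<in> Delta_span k" "q \<in> C" for p q
  proof -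
    have "Delta_span k \<subseteq> {p. smash_mult p q \<in> K}"
    proof (rule Delta_span_subset)
      show "rels \<subseteq> {p. smash_mult p q \<in> K}"
        using rels_smash_mult_right[OF _ that(3)] rels_subset_Delta_span[of k] sub by blast
    qed (use that(1) diff_closed_setD[OF K(1)] in
          \<open>auto simp: diff_closed_set_def smash_mult_zero_left smash_mult_diff_left\<close>)
    then show ?thesis
      using that(2) by blast
  qed
  have word: "smash_mult (antidiag (sharp \<eta>) fs g h) (Poly_Mapping.single v ?one) \<in> K"
    if "v \<in> lists (Der A)" "\<eta> \<in> Der A" "set fs \<subseteq> A" "length fs = k" "g \<in> A" "h \<in> A" for v \<eta> fs g h
    using that
  proof (induction v arbitrary: \<eta> fs g h rule: lists.induct)
    case Nil
    have "antidiag (sharp \<eta>) fs g h \<in> Delta_span k"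
      using antidiag_sharp_mem_Delta_span[of \<eta> fs g h] Nil by simp
    then have "antidiag (sharp \<eta>) fs g h \<in> K" "antidiag (sharp \<eta>) fs g h \<in> C"
      using sub Delta_span_subset_C by blast+
    then show ?case
      by (simp add: smash_mult_unit_right)
  next
    case (Cons \<mu> v)
    let ?E = "antidiag (sharp \<eta>) fs g h" and ?\<mu> = "Poly_Mapping.single [\<mu>] ?one"
    let ?v = "Poly_Mapping.single v ?one"
    have C: "?E \<in> C" "?\<mu> \<in> C" "?v \<in> C"
      using Cons by (auto intro!: C_antidiag_sharp C_single unit_closed)
    have comm: "letter_mult \<mu> ?E - smash_mult ?E ?\<mu> \<in> Delta_span k"
      using Delta_span_commutator[of \<eta> fs g h \<mu>] Cons by simp
    have "Poly_Mapping.single (\<mu> # v) ?one = smash_mult ?\<mu> ?v"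
      using Cons(1) by (simp add: smash_mult_single letter_mult_single Der_unit[OF Cons(1)]
          coeff_mult_simps unit_closed)
    (* E mu v = mu (E v) - [mu, E] v, where [mu, E] is again in the span and v is shorter *)
    then have "smash_mult ?E (Poly_Mapping.single (\<mu> # v) ?one)
        = smash_mult ?\<mu> (smash_mult ?E ?v) - smash_mult (letter_mult \<mu> ?E - smash_mult ?E ?\<mu>) ?v"
      using C Cons(1)
      by (simp add: smash_mult_diff_left smash_mult_assoc smash_mult_letter_mult
          single_letter_mult C_smash_mult)
    also have "\<dots> \<in> K"
    proof (rule diff_closed_setD(2)[OF K(1)])
      show "smash_mult ?\<mu> (smash_mult ?E ?v) \<in> K"
        by (rule K(2)[OF C(2) Cons.IH[OF Cons.prems]])
      show "smash_mult (letter_mult \<mu> ?E - smash_mult ?E ?\<mu>) ?v \<in> K"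
        by (rule extend[OF _ comm C(3)]) (rule Cons.IH)
    qed
    finally show ?case .
  qed
  from \<open>q \<in> C\<close> show ?thesis
  proof (induction rule: C_induct)
    case zero
    have "smash_mult p 0 = 0"
      using assms(5) Delta_span_subset_C smash_mult_diff_right[of p 0 0] by (auto simp: C_zero)
    then show ?case
      by (simp add: diff_closed_setD(1)[OF K(1)])
  next
    case (single v a)
    have C: "Poly_Mapping.single [] a \<in> C" "Poly_Mapping.single v ?one \<in> C"
      using single by (auto intro: C_single unit_closed)
    have eq: "Poly_Mapping.single v a = smash_mult (Poly_Mapping.single [] a) (Poly_Mapping.single v ?one)"
      using single by (simp add: smash_mult_single coeff_mult_simps)
    show ?case
    proof (rule extend)
      fix \<eta> fs g h
      assume *: "\<eta> \<in> Der A" "set fs \<subseteq> A" "length fs = k" "g \<in> A" "h \<in> A"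
      then have "fs \<noteq> []"
        using \<open>k \<ge> 1\<close> by auto
      then have "smash_mult (antidiag (sharp \<eta>) fs g h) (Poly_Mapping.single v a)
          = smash_mult (antidiag (sharp \<eta>) fs (g * a) h) (Poly_Mapping.single v ?one)"
        unfolding eq using * C single
        by (simp add: smash_mult_assoc[symmetric] C_antidiag_sharp antidiag_sharp_mult_coeff)
      also have "\<dots> \<in> K"
        using * single by (intro word mult_closed)
      finally show "smash_mult (antidiag (sharp \<eta>) fs g h) (Poly_Mapping.single v a) \<in> K" .
    qed (use assms(5) single in \<open>auto intro: C_single\<close>)
  next
    case (add u f q)
    then show ?case
      using assms(5) Delta_span_subset_C[of k]
      by (subst smash_mult_add_right) (auto intro: C_single diff_closed_setD(4)[OF K(1)])
  qed
qed

end


section \<open>Order of vanishing\<close>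

text \<open>Order of vanishing at \<open>P\<close>, measured by iterated derivations; \<open>vanishes A P k\<close> holds on
  $\mathfrak{m}_P^k$.  This form is the one in which the Taylor coefficients in \<open>vf_action\<close> see
  that $\mathfrak{m}_P^{N+1} V$ acts by zero.\<close>

primrec vanishes :: "'k::field fn set \<Rightarrow> 'k pt \<Rightarrow> nat \<Rightarrow> 'k fn \<Rightarrow> bool" where
  "vanishes A P 0 f \<longleftrightarrow> True"
| "vanishes A P (Suc k) f \<longleftrightarrow> f P = 0 \<and> (\<forall>D\<in>Der A. vanishes A P k (D f))"

context function_algebra
begin

lemma vanishes_add:
  "f \<in> A \<Longrightarrow> g \<in> A \<Longrightarrow> vanishes A P k f \<Longrightarrow> vanishes A P k g \<Longrightarrow> vanishes A P k (f + g)"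
proof (induction k arbitrary: f g)
  case (Suc k)
  have "vanishes A P k (D (f + g))" if D: "D \<in> Der A" for D
    unfolding Der_add[OF D Suc.prems(1,2)]
    using Suc D by (intro Suc.IH Der_closed[OF D]) simp_all
  moreover have "(f + g) P = 0"
    using Suc.prems by simp
  ultimately show ?case
    unfolding vanishes.simps by blast
qed simp

lemma vanishes_SucD: "vanishes A P (Suc k) f \<Longrightarrow> f \<in> A \<Longrightarrow> vanishes A P k f"
proof (induction k arbitrary: f)
  case (Suc k)
  have "vanishes A P k (D f)" if D: "D \<in> Der A" for D
    using Suc.prems D by (intro Suc.IH Der_closed[OF D]) auto
  then show ?case
    using Suc.prems(1) by simp
qed simp

lemma vanishes_mono: "j \<le> k \<Longrightarrow> vanishes A P k f \<Longrightarrow> f \<in> A \<Longrightarrow> vanishes A P j f"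
  by (induction k rule: dec_induct) (auto dest: vanishes_SucD simp del: vanishes.simps(2))

lemma vanishes_mult:
  "f \<in> A \<Longrightarrow> g \<in> A \<Longrightarrow> vanishes A P k f \<Longrightarrow> vanishes A P k (f * g)"
proof (induction k arbitrary: f g)
  case (Suc k)
  have "vanishes A P k (D (f * g))" if D: "D \<in> Der A" for D
    unfolding Der_mult[OF D Suc.prems(1,2)]
    using Suc.prems D vanishes_SucD[OF Suc.prems(3,1)]
    by (intro vanishes_add mult_closed Suc.IH Der_closed[OF D]) simp_all
  moreover have "(f * g) P = 0"
    using Suc.prems by simp
  ultimately show ?case
    unfolding vanishes.simps by blast
qed simp

lemma vanishes_Suc_mult:
  "f \<in> A \<Longrightarrow> g \<in> A \<Longrightarrow> vanishes A P k f \<Longrightarrow> g P = 0 \<Longrightarrow> vanishes A P (Suc k) (f * g)"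
proof (induction k arbitrary: f g)
  case (Suc k)
  have "vanishes A P (Suc k) (D (f * g))" if D: "D \<in> Der A" for D
    unfolding Der_mult[OF D Suc.prems(1,2)]
  proof (rule vanishes_add)
    show "vanishes A P (Suc k) (D f * g)"
      using Suc.prems D by (intro Suc.IH Der_closed[OF D]) simp_all
    show "vanishes A P (Suc k) (f * D g)"
      using Suc.prems D by (intro vanishes_mult Der_closed[OF D])
  qed (use Suc.prems D in \<open>auto intro: mult_closed Der_closed[OF D]\<close>)
  moreover have "(f * g) P = 0"
    using Suc.prems by simp
  ultimately show ?case
    unfolding vanishes.simps by blast
qed simp_all

lemma vanishes_pd_pow:
  assumes pd: "\<And>i. i < n \<Longrightarrow> pd i \<in> Der A" and "f \<in> A" "vanishes A P (Suc (mdeg s)) f"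
    and s: "Poly_Mapping.keys s \<subseteq> {..<n}"
  shows "pd_pow n pd s f P = 0"
proof -
  have power: "vanishes A P k ((D ^^ j) f) \<and> (D ^^ j) f \<in> A"
    if D: "D \<in> Der A" and "vanishes A P (k + j) f" "f \<in> A" for D j k f
    using that(2-)
  proof (induction j arbitrary: k)
    case (Suc j)
    from Suc.IH[of "Suc k"] Suc.prems have "vanishes A P (Suc k) ((D ^^ j) f) \<and> (D ^^ j) f \<in> A"
      by simp
    then show ?case
      using D Der_closed[OF D] by simp
  qed simp
  have fold: "vanishes A P k (foldr (\<lambda>i. pd i ^^ Poly_Mapping.lookup s i) is f) \<and>
      foldr (\<lambda>i. pd i ^^ Poly_Mapping.lookup s i) is f \<in> A"
    if "set is \<subseteq> {..<n}" "vanishes A P (k + (\<Sum>i\<leftarrow>is. Poly_Mapping.lookup s i)) f" for k "is"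
    using that
  proof (induction "is" arbitrary: k)
    case (Cons i "is")
    then show ?case
      using power[OF pd, of i k "Poly_Mapping.lookup s i"] Cons.IH[of "k + Poly_Mapping.lookup s i"]
      by (simp add: add.assoc)
  qed (use assms(2) in simp)
  have "(\<Sum>i\<leftarrow>[0..<n]. Poly_Mapping.lookup s i) = (\<Sum>i<n. Poly_Mapping.lookup s i)"
    by (simp add: sum_list_distinct_conv_sum_set atLeast0LessThan)
  also have "\<dots> = mdeg s"
    unfolding mdeg_def using s by (intro sum.mono_neutral_right) (auto simp: in_keys_iff)
  finally have "vanishes A P (Suc 0 + (\<Sum>i\<leftarrow>[0..<n]. Poly_Mapping.lookup s i)) f"
    using assms(3) by simp
  from fold[OF _ this] show ?thesis
    by (simp add: pd_pow_def atLeast0LessThan)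
qed


section \<open>Left ideals containing $\Delta^{N+1} \otimes V$\<close>

text \<open>
  After subtracting constants, all \<open>f\<^sub>i\<close> vanish at \<open>P\<close>.  Expanding
  $(g \otimes h) \prod_{i \leq N} (f_i \otimes 1 - 1 \otimes f_i)$ gives terms $g'\#h'\eta$.  If both
  $g'$ and $h'$ receive a factor, \<open>both\<close> applies; if $h'$ receives all of them, \<open>deep\<close> applies;
  if $g'$ receives all of them, then $g'\#h\eta = h\eta \cdot g' - h\eta(g')$ lies in the left ideal
  generated by functions vanishing at \<open>P\<close>, as $N + 1 \geq 2$.
\<close>

lemma Delta_span_subset_left_ideal:
  assumes K: "diff_closed_set K" "rels \<subseteq> K" "\<And>p q. p \<in> C \<Longrightarrow> q \<in> K \<Longrightarrow> smash_mult p q \<in> K"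
    and funs: "\<And>f. f \<in> A \<Longrightarrow> f P = 0 \<Longrightarrow> Poly_Mapping.single [] f \<in> K"
    and both: "\<And>\<eta> g h. \<eta> \<in> Der A \<Longrightarrow> g \<in> A \<Longrightarrow> h \<in> A \<Longrightarrow> g P = 0 \<Longrightarrow> h P = 0 \<Longrightarrow> sharp \<eta> g h \<in> K"
    and deep: "\<And>\<eta> g h. \<eta> \<in> Der A \<Longrightarrow> g \<in> A \<Longrightarrow> h \<in> A \<Longrightarrow> vanishes A P (Suc N) h \<Longrightarrow> sharp \<eta> g h \<in> K"
    and "P \<in> U" "N \<ge> 1"
  shows "Delta_span (Suc N) \<subseteq> K"
proof (rule Delta_span_subset[OF K(1,2)])
  fix \<eta> fs g h
  assume \<eta>: "\<eta> \<in> Der A" and fs: "set fs \<subseteq> A" "length fs = Suc N" and "g \<in> A" "h \<in> A"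
  note diff = diff_closed_setD(2)[OF K(1)]
  let ?a = "antidiag (sharp \<eta>)"
  define \<M> where "\<M> = {f \<in> A. f P = 0}"
  have \<M>_mult: "g * f \<in> \<M>" if "g \<in> A" "f \<in> A" "g P = 0 \<or> f P = 0" for g f
    using that by (auto simp: \<M>_def intro: mult_closed)
  (* g and h both vanish at P already; further factors keep this *)
  have both': "?a fs g h \<in> K" if "set fs \<subseteq> \<M>" "g \<in> \<M>" "h \<in> \<M>" for fs g h
    using that
  proof (induction fs arbitrary: g h)
    case Nil
    then show ?case
      using both[OF \<eta>] by (simp add: \<M>_def)
  next
    case (Cons f fs)
    then have "g * f \<in> \<M>" "h * f \<in> \<M>"
      by (auto simp: \<M>_def intro: mult_closed)
    then show ?case
      using Cons by (auto intro!: diff)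
  qed
  (* the factors so far went into g; a second one is needed for h\<eta>(g) to vanish at P *)
  have left: "?a fs g h \<in> K"
    if "set fs \<subseteq> \<M>" "h \<in> A" "g \<in> \<M>" "fs = [] \<Longrightarrow> vanishes A P 2 g" for fs g h
    using that
  proof (induction fs arbitrary: g h)
    case Nil
    have g: "g \<in> A" "g P = 0" "vanishes A P 2 g"
      using Nil by (auto simp: \<M>_def)
    have h\<eta>: "fmul h \<eta> \<in> Der A"
      using \<eta> Nil by (simp add: Der_fmul_closed)
    have "sharp \<eta> g h = smash_mult (Poly_Mapping.single [fmul h \<eta>] (indicator U)) (Poly_Mapping.single [] g)
        - Poly_Mapping.single [] (fmul h \<eta> g)"
      using g h\<eta> Der_closed[OF h\<eta>]
      by (simp add: sharp_def smash_mult_single letter_mult_single coeff_mult_simps)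
    also have "\<dots> \<in> K"
    proof (rule diff)
      show "smash_mult (Poly_Mapping.single [fmul h \<eta>] (indicator U)) (Poly_Mapping.single [] g) \<in> K"
        using g h\<eta> by (intro K(3) funs) (auto intro: C_single unit_closed)
      have "fmul h \<eta> g P = 0"
        using g(3) h\<eta> by (simp add: numeral_2_eq_2)
      then show "Poly_Mapping.single [] (fmul h \<eta> g) \<in> K"
        using Der_closed[OF h\<eta>] g by (intro funs)
    qed
    finally show ?case
      by simp
  next
    case (Cons f fs)
    then have A: "g \<in> A" "f \<in> A" "g P = 0" "f P = 0" "g * f \<in> \<M>" "h * f \<in> \<M>"
      by (auto simp: \<M>_def intro: mult_closed)
    have "vanishes A P (Suc 1) (g * f)"
      using A by (intro vanishes_Suc_mult) auto
    then have "?a fs (g * f) h \<in> K"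
      unfolding One_nat_def numeral_2_eq_2[symmetric] using A Cons by (intro Cons.IH) (auto simp del: times_fun_apply)
    moreover have "?a fs g (h * f) \<in> K"
      using A Cons.prems by (intro both') auto
    ultimately show ?case
      by (auto intro: diff)
  qed
  (* j factors so far, all of which went into h *)
  have right: "?a fs g h \<in> K"
    if "set fs \<subseteq> \<M>" "g \<in> A" "h \<in> \<M>" "vanishes A P j h" "j + length fs = Suc N" for fs g h j
    using that
  proof (induction fs arbitrary: h j)
    case Nil
    then show ?case
      using deep[OF \<eta>] by (simp add: \<M>_def)
  next
    case (Cons f fs)
    then have A: "h \<in> A" "f \<in> A" "h P = 0" "f P = 0" "g * f \<in> \<M>" "h * f \<in> \<M>"
      by (auto simp: \<M>_def intro: mult_closed)
    have "?a fs (g * f) h \<in> K"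
      using A Cons.prems by (intro both') auto
    moreover have "?a fs g (h * f) \<in> K"
      by (rule Cons.IH[of "h * f" "Suc j"])
        (use A Cons.prems vanishes_Suc_mult[of h f P j] in \<open>simp_all del: times_fun_apply vanishes.simps\<close>)
    ultimately show ?case
      by (auto intro: diff)
  qed
  let ?n = "\<lambda>f. f - cscale (f P) (indicator U)"
  have n: "?n f \<in> \<M>" if "f \<in> A" for f
    using that \<open>P \<in> U\<close> by (auto simp: \<M>_def cscale_def[of _ "indicator U"] intro: diff_closed
        cscale_closed[OF unit_closed, unfolded cscale_def])
  have normalised: "?a (map ?n fs) g h \<in> K"
  proof (cases fs)
    case (Cons f fs')
    then have f: "?n f \<in> \<M>" and fs': "set (map ?n fs') \<subseteq> \<M>" "length (map ?n fs') = N"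
      using fs n by auto
    have A: "?n f \<in> A" "g * ?n f \<in> \<M>" "h * ?n f \<in> \<M>"
      using f \<open>g \<in> A\<close> \<open>h \<in> A\<close> by (auto simp: \<M>_def intro: mult_closed)
    have "?a (map ?n fs') (g * ?n f) h \<in> K"
      using fs' A \<open>h \<in> A\<close> \<open>N \<ge> 1\<close> by (intro left) auto
    moreover have "?a (map ?n fs') g (h * ?n f) \<in> K"
      using fs' A \<open>g \<in> A\<close> by (intro right[of _ _ _ 1]) (simp_all add: \<M>_def)
    ultimately show ?thesis
      unfolding Cons by (auto intro: diff)
  qed (use fs in simp)
  have "?a fs g h - ?a (map ?n fs) g h \<in> K"
    by (rule subsetD[OF K(2) antidiag_subtract_constants[OF diff_closed_set_rels
            balanced_mod_sharp[OF \<eta>] fs(1) \<open>g \<in> A\<close> \<open>h \<in> A\<close>]])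
  from diff_closed_setD(4)[OF K(1) this normalised] show "?a fs g h \<in> K"
    by (simp only: diff_add_cancel)
qed

text \<open>The element is $(1 \otimes f - f \otimes 1)^k \otimes \eta$, expanded by the binomial theorem.  With a
  general factor $g \otimes h$ in front, Pascal's rule turns this expansion into the recursion of
  \<open>antidiag\<close>, up to a sign in each step.\<close>

lemma diff_element_mem_Delta_span:
  assumes \<eta>: "\<eta> \<in> Der A" and f: "f \<in> A"
  shows "diff_element U k f \<eta> \<in> Delta_span k"
proof -
  define \<Psi> where "\<Psi> k g h = (\<Sum>j\<le>k. Poly_Mapping.single [fmul (h * f ^ (k - j)) \<eta>]
      (cscale ((-1) ^ j * of_nat (k choose j)) (g * f ^ j)))" for k g h
  have step: "\<Psi> (Suc k) g h = \<Psi> k g (h * f) - \<Psi> k (g * f) h" for k g h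
  proof -
    define t where "t j c = Poly_Mapping.single [fmul (h * f ^ (Suc k - j)) \<eta>] (cscale c (g * f ^ j))"
      for j c
    have t: "t j (c - d) = t j c - t j d" "t j 0 = 0" for j c d
    proof -
      have "cscale (c - d) u = cscale c u - cscale d u" "cscale 0 u = 0" for u :: "'k fn"
        by (simp_all add: cscale_def fun_eq_iff algebra_simps)
      then show "t j (c - d) = t j c - t j d" "t j 0 = 0"
        by (simp_all only: t_def single_diff single_zero)
    qed
    have pascal: "(-1) ^ Suc j * of_nat (Suc k choose Suc j)
        = (-1) ^ Suc j * of_nat (k choose Suc j) - (-1) ^ j * (of_nat (k choose j) :: 'k)" for j
      by (simp add: algebra_simps)
    have "\<Psi> (Suc k) g h = (\<Sum>j\<le>Suc k. t j ((-1) ^ j * of_nat (Suc k choose j)))"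
      by (simp only: \<Psi>_def t_def)
    also have "\<dots> = t 0 1 + (\<Sum>j\<le>k. t (Suc j) ((-1) ^ Suc j * of_nat (Suc k choose Suc j)))"
      by (subst sum.atMost_Suc_shift) simp
    also have "\<dots> = (t 0 1 + (\<Sum>j\<le>k. t (Suc j) ((-1) ^ Suc j * of_nat (k choose Suc j))))
        - (\<Sum>j\<le>k. t (Suc j) ((-1) ^ j * of_nat (k choose j)))"
      unfolding pascal t(1) sum_subtractf by simp
    also have "t 0 1 + (\<Sum>j\<le>k. t (Suc j) ((-1) ^ Suc j * of_nat (k choose Suc j)))
        = (\<Sum>j\<le>Suc k. t j ((-1) ^ j * of_nat (k choose j)))"
      by (subst sum.atMost_Suc_shift) simp
    also have "\<dots> = (\<Sum>j\<le>k. t j ((-1) ^ j * of_nat (k choose j)))"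
      by (simp add: t(2) binomial_eq_0)
    also have "\<dots> = \<Psi> k g (h * f)"
      unfolding \<Psi>_def t_def by (intro sum.cong) (auto simp: Suc_diff_le mult.assoc)
    also have "(\<Sum>j\<le>k. t (Suc j) ((-1) ^ j * of_nat (k choose j))) = \<Psi> k (g * f) h"
      unfolding \<Psi>_def t_def by (intro sum.cong) (auto simp: mult.assoc)
    finally show ?thesis .
  qed
  have "(\<forall>g h. \<Psi> k g h = antidiag (sharp \<eta>) (replicate k f) g h)
      \<or> (\<forall>g h. \<Psi> k g h = - antidiag (sharp \<eta>) (replicate k f) g h)"
  proof (induction k)
    case 0
    show ?case
      by (auto simp: \<Psi>_def sharp_def cscale_def)
  next
    case (Suc k)
    then show ?case
      by (auto simp: step simp del: times_fun_apply)
  qed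
  moreover have "antidiag (sharp \<eta>) (replicate k f) (indicator U) (indicator U) \<in> Delta_span k"
    using antidiag_sharp_mem_Delta_span[OF \<eta>, of "replicate k f" "indicator U" "indicator U"] f
    by (simp add: unit_closed set_replicate_conv_if)
  ultimately have "\<Psi> k (indicator U) (indicator U) \<in> Delta_span k"
    using diff_closed_setD(3)[OF diff_closed_set_Delta_span] by metis
  moreover have "diff_element U k f \<eta> = \<Psi> k (indicator U) (indicator U)"
  proof -
    have "fmul (indicator U * u) \<eta> = fmul u \<eta>" for u
    proof
      fix v
      have "indicator U * \<eta> v = \<eta> v"
        using Der_closed[OF \<eta>] Der_outside[OF \<eta>] by (cases "v \<in> A") (simp_all del: func_zero)
      then show "fmul (indicator U * u) \<eta> v = fmul u \<eta> v"
        by (simp add: fmul_def ac_simps)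
    qed
    moreover have "indicator U * cscale c u = cscale c (indicator U * u)" for c and u :: "'k fn"
      by (simp add: cscale_def fun_eq_iff)
    ultimately show ?thesis
      by (simp add: diff_element_def \<Psi>_def)
  qed
  ultimately show ?thesis
    by simp
qed


section \<open>The powers of $\Delta$\<close>

abbreviation square_free :: "(('k fn \<times> 'k fn) \<Rightarrow>\<^sub>0 int) ring" where
  "square_free \<equiv> tensor_square_free U A"

abbreviation square_rels :: "(('k fn \<times> 'k fn) \<Rightarrow>\<^sub>0 int) set" where
  "square_rels \<equiv> tensor_rels A (+) A (+) UNIV (\<lambda>f c. cscale c f) cscale"

lemma carrier_square_free: "t \<in> carrier square_free \<longleftrightarrow> Poly_Mapping.keys t \<subseteq> A \<times> A"
  by (simp add: tensor_square_free_def)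

lemma mem_square_free_coset: "t \<in> s +>\<^bsub>square_free\<^esub> a \<longleftrightarrow> (\<exists>h\<in>s. t = h + a)"
  by (auto simp: a_r_coset_def r_coset_def tensor_square_free_def)

lemma diff_closed_set_square_rels: "diff_closed_set square_rels"
  unfolding tensor_rels_def by (rule diff_closed_set_group_closure)

lemma square_rels_balanced: "balanced_mod square_rels (\<lambda>g h. frag_of (g, h))"
  unfolding balanced_mod_def tensor_rels_def
  by (intro conjI ballI allI; rule group_closure.base) blast+

text \<open>The universal property of the tensor product, modulo a subgroup: it reduces every statement that
  a map respects the relations of $A \otimes A$ to \<open>balanced_mod\<close>.\<close>

lemma square_rels_image:
  assumes R: "diff_closed_set R" and \<phi>: "balanced_mod R \<phi>"
    and F: "\<And>s t. F (s - t) = F s - F t" "\<And>g h. F (frag_of (g, h)) = \<phi> g h"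
    and "t \<in> square_rels"
  shows "F t \<in> R"
  using assms(5) unfolding tensor_rels_def
proof (rule group_closure_image_mem[where C = UNIV])
  fix t
  assume "t \<in> {frag_of (a + a', b) - frag_of (a, b) - frag_of (a', b) | a a' b.
         a \<in> A \<and> a' \<in> A \<and> b \<in> A}
      \<union> {frag_of (a, b + b') - frag_of (a, b) - frag_of (a, b') | a b b'.
         a \<in> A \<and> b \<in> A \<and> b' \<in> A}
      \<union> {frag_of (cscale c a, b) - frag_of (a, cscale c b) | a c b. a \<in> A \<and> c \<in> UNIV \<and> b \<in> A}"
  then show "F t \<in> R"
    by (elim UnE CollectE exE conjE) (simp_all add: F balanced_modD[OF \<phi>] del: plus_fun_apply)
qed (use diff_closed_setD[OF R] F in auto)

lemma square_rels_subset: "square_rels \<subseteq> carrier square_free"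
proof
  fix t assume "t \<in> square_rels"
  then show "t \<in> carrier square_free"
    unfolding tensor_rels_def carrier_square_free
  proof induction
    case (diff s t)
    then show ?case
      using keys_diff[of s t] by blast
  next
    case (base s)
    have add: "Poly_Mapping.keys (u - v) \<subseteq> A \<times> A"
      if "Poly_Mapping.keys u \<subseteq> A \<times> A" "Poly_Mapping.keys v \<subseteq> A \<times> A"
      for u v :: "('k fn \<times> 'k fn) \<Rightarrow>\<^sub>0 int"
      using that keys_diff[of u v] by blast
    from base show ?case
      by (elim insertE UnE CollectE exE conjE; simp del: plus_fun_apply)
        (intro add; simp add: add_closed cscale_closed del: plus_fun_apply)+
  qed
qed

text \<open>Representatives of the elements of $\Delta^k$; compare \<open>Delta_span\<close>.\<close>

definition square_span :: "nat \<Rightarrow> (('k fn \<times> 'k fn) \<Rightarrow>\<^sub>0 int) set" where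
  "square_span k = group_closure (square_rels \<union>
     {antidiag (\<lambda>g h. frag_of (g, h)) fs g h | fs g h.
        set fs \<subseteq> A \<and> length fs = k \<and> g \<in> A \<and> h \<in> A})"

lemma diff_closed_set_square_span: "diff_closed_set (square_span k)"
  unfolding square_span_def by (rule diff_closed_set_group_closure)

lemma square_rels_subset_span: "square_rels \<subseteq> square_span k"
  unfolding square_span_def by (auto intro: group_closure.base)

lemma antidiag_mem_square_span:
  "set fs \<subseteq> A \<Longrightarrow> g \<in> A \<Longrightarrow> h \<in> A \<Longrightarrow> antidiag (\<lambda>g h. frag_of (g, h)) fs g h \<in> square_span (length fs)"
  unfolding square_span_def by (rule group_closure.base) blast

lemma square_span_subset:
  assumes "diff_closed_set K" "square_rels \<subseteq> K"
    and "\<And>fs g h. set fs \<subseteq> A \<Longrightarrow> length fs = k \<Longrightarrow> g \<in> A \<Longrightarrow> h \<in> A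
      \<Longrightarrow> antidiag (\<lambda>g h. frag_of (g, h)) fs g h \<in> K"
  shows "square_span k \<subseteq> K"
proof
  fix p assume "p \<in> square_span k"
  then show "p \<in> K"
    unfolding square_span_def
    by induction (use assms diff_closed_setD[OF assms(1)] in auto)
qed

lemma square_span_0: "carrier square_free \<subseteq> square_span 0"
proof
  fix t assume "t \<in> carrier square_free"
  then have "Poly_Mapping.keys t \<subseteq> A \<times> A"
    by (simp add: carrier_square_free)
  then show "t \<in> square_span 0"
  proof (induction rule: frag_induction)
    case (one x)
    then show ?case
      using antidiag_mem_square_span[of "[]" "fst x" "snd x"] by auto
  qed (use diff_closed_setD[OF diff_closed_set_square_span] in auto)
qed

subsection \<open>Multiplication\<close>

definition square_mult ::
  "(('k fn \<times> 'k fn) \<Rightarrow>\<^sub>0 int) \<Rightarrow> (('k fn \<times> 'k fn) \<Rightarrow>\<^sub>0 int) \<Rightarrow> (('k fn \<times> 'k fn) \<Rightarrow>\<^sub>0 int)" where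
  "square_mult s t = frag_extend (\<lambda>(a, b). frag_extend (\<lambda>(c, d). frag_of (a * c, b * d)) t) s"

lemma mult_square_free: "s \<otimes>\<^bsub>square_free\<^esub> t = square_mult s t"
  by (simp add: tensor_square_free_def square_mult_def)

lemma square_mult_diff_left: "square_mult (s - s') t = square_mult s t - square_mult s' t"
  by (simp add: square_mult_def frag_extend_diff)

lemma square_mult_frag:
  "square_mult (frag_of (a, b)) t = frag_extend (\<lambda>(c, d). frag_of (a * c, b * d)) t"
  by (simp add: square_mult_def)

lemma square_mult_diff_right: "square_mult s (t - t') = square_mult s t - square_mult s t'"
proof -
  have "Poly_Mapping.keys s \<subseteq> UNIV"
    by simp
  then show ?thesis
    by (induction rule: frag_induction)
      (auto simp: square_mult_frag square_mult_diff_left frag_extend_diff, simp add: square_mult_def)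
qed

lemma balanced_mod_square_mult:
  assumes t: "t \<in> carrier square_free"
  shows "balanced_mod square_rels (\<lambda>a b. square_mult (frag_of (a, b)) t)"
proof -
  have "Poly_Mapping.keys t \<subseteq> A \<times> A"
    using t by (simp add: carrier_square_free)
  then show ?thesis
  proof (induction rule: frag_induction)
    case zero
    show ?case
      by (simp add: balanced_mod_def square_mult_frag diff_closed_setD(1)[OF diff_closed_set_square_rels]
          del: plus_fun_apply)
  next
    case (one x)
    then obtain c d where x: "x = (c, d)" "c \<in> A" "d \<in> A"
      by auto
    show ?case
      unfolding balanced_mod_def square_mult_frag x frag_extend_of prod.case distrib_right cscale_mult
      using x by (intro conjI ballI allI balanced_modD[OF square_rels_balanced] mult_closed)
  next
    case (diff s t)
    have rearrange: "(x - y) - (x' - y') - (x'' - y'') = (x - x' - x'') - (y - y' - y'')"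
      and rearrange': "(x - y) - (x' - y') = (x - x') - (y - y')"
      for x y x' y' x'' y'' :: "('k fn \<times> 'k fn) \<Rightarrow>\<^sub>0 int"
      by simp_all
    note bal = balanced_modD[OF diff.IH(1)] balanced_modD[OF diff.IH(2)]
    show ?case
      unfolding balanced_mod_def square_mult_diff_right
    proof (intro conjI ballI allI)
      fix c a b assume "a \<in> A" "b \<in> A"
      then show "square_mult (frag_of (cscale c a, b)) s - square_mult (frag_of (cscale c a, b)) t
          - (square_mult (frag_of (a, cscale c b)) s - square_mult (frag_of (a, cscale c b)) t) \<in> square_rels"
        by (subst rearrange') (intro diff_closed_setD(2)[OF diff_closed_set_square_rels] bal)
    qed (subst rearrange, intro diff_closed_setD(2)[OF diff_closed_set_square_rels] bal, assumption+)+
  qed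
qed

text \<open>The product of two of the spanning elements concatenates their lists of factors.\<close>

lemma square_span_mult:
  assumes "s \<in> square_span k" and t: "t \<in> square_span (Suc 0)" "t \<in> carrier square_free"
  shows "square_mult s t \<in> square_span (Suc k)"
proof -
  let ?frag = "\<lambda>g h. frag_of (g, h)"
  have hom: "square_mult (antidiag ?frag fs g h) t = antidiag (\<lambda>g h. square_mult (frag_of (g, h)) t) fs g h"
    if "set fs \<subseteq> A" "g \<in> A" "h \<in> A" for fs g h t
    using that by (intro antidiag_hom[of UNIV]) (auto simp: diff_closed_set_def square_mult_diff_left)
  have basis: "square_mult (antidiag ?frag fs g h) t \<in> square_span (Suc k)"
    if fs: "set fs \<subseteq> A" "length fs = k" "g \<in> A" "h \<in> A" for fs g h
  proof -
    have "square_span (Suc 0) \<subseteq> {t. square_mult (antidiag ?frag fs g h) t \<in> square_span (Suc k)}"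
    proof (rule square_span_subset)
      show "square_rels \<subseteq> {t. square_mult (antidiag ?frag fs g h) t \<in> square_span (Suc k)}"
      proof
        fix t assume t: "t \<in> square_rels"
        have "square_mult (frag_of (g, h)) t \<in> square_rels" if gh: "g \<in> A" "h \<in> A" for g h
        proof (rule square_rels_image[OF diff_closed_set_square_rels _ square_mult_diff_right _ t])
          show "balanced_mod square_rels (\<lambda>c d. frag_of (g * c, h * d))"
            unfolding balanced_mod_def distrib_left mult_cscale
            using gh by (intro conjI ballI allI balanced_modD[OF square_rels_balanced] mult_closed)
        qed (simp add: square_mult_frag)
        then have "square_mult (antidiag ?frag fs g h) t \<in> square_rels"
          unfolding hom[OF fs(1,3,4)] using fs
          by (intro antidiag_mem[OF diff_closed_set_square_rels])
        then show "t \<in> {t. square_mult (antidiag ?frag fs g h) t \<in> square_span (Suc k)}"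
          using square_rels_subset_span by blast
      qed
    next
      fix fs' g' h'
      assume *: "set fs' \<subseteq> A" "length fs' = Suc 0" "g' \<in> A" "h' \<in> A"
      have "square_mult (frag_of (g, h)) (antidiag ?frag fs' g' h') = antidiag ?frag fs' (g * g') (h * h')" for g h
      proof -
        have "square_mult (frag_of (g, h)) (antidiag ?frag fs' g' h')
            = antidiag (\<lambda>c d. frag_of (c * g, d * h)) fs' g' h'"
          using * by (subst antidiag_hom[of UNIV])
            (auto simp: diff_closed_set_def square_mult_diff_right square_mult_frag mult.commute)
        then show ?thesis
          using antidiag_shift[of ?frag g h fs' g' h'] by (simp add: mult.commute)
      qed
      then have "square_mult (antidiag ?frag fs g h) (antidiag ?frag fs' g' h')
          = antidiag ?frag (fs @ fs') (g * g') (h * h')"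
        using fs antidiag_shift[of "antidiag ?frag fs'" g' h' fs g h]
        by (simp add: hom antidiag_append)
      also have "\<dots> \<in> square_span (Suc k)"
        using antidiag_mem_square_span[of "fs @ fs'" "g * g'" "h * h'"] * fs by (simp add: mult_closed)
      finally show "antidiag ?frag fs' g' h' \<in> {t. square_mult (antidiag ?frag fs g h) t \<in> square_span (Suc k)}"
        by simp
    qed (use diff_closed_setD[OF diff_closed_set_square_span] square_mult_diff_right[of _ 0 0] in
        \<open>auto simp: diff_closed_set_def square_mult_diff_right\<close>)
    then show ?thesis
      using t by blast
  qed
  have "square_span k \<subseteq> {s. square_mult s t \<in> square_span (Suc k)}"
  proof (rule square_span_subset)
    show "square_rels \<subseteq> {s. square_mult s t \<in> square_span (Suc k)}"
      using square_rels_image[OF diff_closed_set_square_rels balanced_mod_square_mult[OF t(2)]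
          square_mult_diff_left refl] square_rels_subset_span[of "Suc k"] by blast
  qed (use diff_closed_setD[OF diff_closed_set_square_span] square_mult_diff_left[of 0 0 t] basis in
      \<open>auto simp: diff_closed_set_def square_mult_diff_left\<close>)
  then show ?thesis
    using assms(1) by blast
qed

subsection \<open>Generators of $\Delta$\<close>

lemma mult_map_eq: "mult_map t = linear_extension (\<lambda>(g, f) c. of_int c * (g * f)) t"
  by (simp add: mult_map_def linear_extension_def case_prod_beta)

lemma mult_map_add: "mult_map (s + t) = mult_map s + mult_map t"
  unfolding mult_map_eq
  by (rule linear_extension_add[of _ UNIV]) (auto simp: distrib_right)

lemma mult_map_diff: "mult_map (s - t) = mult_map s - mult_map t"
  using mult_map_add[of "s - t" t] by simp

lemma mult_map_frag: "mult_map (frag_of (g, f)) = g * f"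
  unfolding mult_map_eq by (subst linear_extension_single) auto

lemma mult_map_square_rels:
  assumes "t \<in> square_rels"
  shows "mult_map t = 0"
proof -
  have "balanced_mod {0} ((*) :: 'k fn \<Rightarrow> 'k fn \<Rightarrow> 'k fn)"
    unfolding balanced_mod_def distrib_left distrib_right cscale_mult mult_cscale by simp
  from square_rels_image[OF _ this mult_map_diff mult_map_frag assms] show ?thesis
    by (simp add: diff_closed_set_def)
qed

text \<open>As $g \otimes f = gf \otimes 1 - (g \otimes 1)(f \otimes 1 - 1 \otimes f)$, every tensor \<open>t\<close> is
  \<open>mult_map t\<close> $\otimes 1$ up to the ideal generated by the differences.\<close>

lemma kernel_mult_map:
  assumes "t \<in> carrier square_free" "mult_map t = 0"
  shows "t \<in> square_span (Suc 0)"
proof -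
  note S = diff_closed_setD[OF diff_closed_set_square_span[of "Suc 0"]]
  note bal = balanced_modD[OF square_rels_balanced]
  let ?one = "indicator U"
  have frag_zero: "frag_of (0, ?one) \<in> square_rels"
  proof -
    have "frag_of (0 + 0, ?one) - frag_of (0, ?one) - frag_of (0, ?one) \<in> square_rels"
      by (intro bal zero_closed unit_closed)
    then show ?thesis
      using diff_closed_setD(3)[OF diff_closed_set_square_rels] by force
  qed
  have "Poly_Mapping.keys t \<subseteq> A \<times> A"
    using assms(1) by (simp add: carrier_square_free)
  then have "t - frag_of (mult_map t, ?one) \<in> square_span (Suc 0) \<and> mult_map t \<in> A"
  proof (induction rule: frag_induction)
    case zero
    have "mult_map 0 = (0 :: 'k fn)"
      by (simp add: mult_map_def)
    moreover have "0 - frag_of (0, ?one) \<in> square_span (Suc 0)"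
      unfolding diff_0 using frag_zero square_rels_subset_span[of "Suc 0"] by (intro S(3)) blast
    ultimately show ?case
      using zero_closed by (simp only: simp_thms)
  next
    case (one x)
    then obtain g f where x: "x = (g, f)" "g \<in> A" "f \<in> A"
      by auto
    have "- antidiag (\<lambda>g h. frag_of (g, h)) [f] g ?one = frag_of x - frag_of (mult_map (frag_of x), ?one)"
      using x by (simp add: mult_map_frag)
    moreover have "- antidiag (\<lambda>g h. frag_of (g, h)) [f] g ?one \<in> square_span (Suc 0)"
      using antidiag_mem_square_span[of "[f]" g ?one] x by (intro S(3)) (simp add: unit_closed)
    ultimately show ?case
      using x by (simp add: mult_map_frag mult_closed del: times_fun_apply)
  next
    case (diff s t)
    let ?f = "\<lambda>t. frag_of (mult_map t, ?one)"
    have A: "mult_map s \<in> A" "mult_map t \<in> A" "mult_map s - mult_map t \<in> A"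
      using diff.IH by (auto intro: diff_closed)
    have "frag_of ((mult_map s - mult_map t) + mult_map t, ?one) - frag_of (mult_map s - mult_map t, ?one) - ?f t
        \<in> square_rels"
      by (intro bal A unit_closed)
    then have "?f s - frag_of (mult_map s - mult_map t, ?one) - ?f t \<in> square_span (Suc 0)"
      using square_rels_subset_span[of "Suc 0"] by (simp only: diff_add_cancel) blast
    from S(4)[OF S(2)[OF conjunct1[OF diff.IH(1)] conjunct1[OF diff.IH(2)]] this]
    have "s - t - frag_of (mult_map s - mult_map t, ?one) \<in> square_span (Suc 0)"
      by (simp add: algebra_simps)
    then show ?case
      using A(3) unfolding mult_map_diff by (rule conjI)
  qed
  then have "t - frag_of (0, ?one) \<in> square_span (Suc 0)"
    unfolding assms(2) ..
  moreover have "frag_of (0, ?one) \<in> square_span (Suc 0)"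
    using frag_zero square_rels_subset_span[of "Suc 0"] by blast
  ultimately have "(t - frag_of (0, ?one)) + frag_of (0, ?one) \<in> square_span (Suc 0)"
    by (rule S(4))
  then show ?thesis
    unfolding diff_add_cancel .
qed

text \<open>The elements of $A \otimes A$ are cosets; the following statements concern each of their
  representatives.  As \<open>mult_map\<close> is constant on cosets, the condition defining \<open>\<Delta>\<close> holds for
  any of them.\<close>

lemma Delta_elementD:
  assumes "T \<in> Delta U A" "t \<in> T"
  shows "t \<in> square_span (Suc 0)" "t \<in> carrier square_free"
proof -
  obtain a where a: "a \<in> carrier square_free" "T = square_rels +>\<^bsub>square_free\<^esub> a"
    using assms(1) by (auto simp: Delta_def tensor_square_def FactRing_def A_RCOSETS_def')
  have "mult_map u = mult_map a" if "u \<in> T" for u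
    using that by (auto simp: a(2) mem_square_free_coset mult_map_add mult_map_square_rels simp del: func_zero)
  moreover from this have "mult_map ` T = {mult_map a}"
    using assms(2) by auto
  ultimately have "mult_map t = 0"
    using assms by (simp add: Delta_def)
  moreover obtain h where "h \<in> square_rels" "t = h + a"
    using assms(2) by (auto simp: a(2) mem_square_free_coset)
  then show "t \<in> carrier square_free"
    using a(1) subsetD[OF square_rels_subset, of h] keys_add[of h a]
    unfolding carrier_square_free by blast
  ultimately show "t \<in> square_span (Suc 0)"
    by (intro kernel_mult_map)
qed

lemma Delta_pow_elementD: "T \<in> Delta_pow U A k \<Longrightarrow> t \<in> T \<Longrightarrow> t \<in> square_span k"
proof (induction k arbitrary: T t)
  case 0
  then obtain a where a: "a \<in> carrier square_free" "T = square_rels +>\<^bsub>square_free\<^esub> a"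
    by (auto simp: Delta_pow_def ideals_set_def nat_pow_def tensor_square_def FactRing_def A_RCOSETS_def')
  then obtain h where "h \<in> square_rels" "t = h + a"
    using 0(2) by (auto simp: mem_square_free_coset)
  then show ?case
    using a(1) square_span_0 square_rels_subset_span[of 0]
    by (auto intro: diff_closed_setD(4)[OF diff_closed_set_square_span])
next
  case (Suc k)
  have "T \<in> ideal_prod (tensor_square U A) (Delta_pow U A k) (Delta U A)"
    using Suc.prems(1) by (simp add: Delta_pow_def ideals_set_def nat_pow_def)
  then show ?case
    using Suc.prems(2)
  proof (induction arbitrary: t)
    case (prod S D)
    then obtain s d where sd: "s \<in> S" "d \<in> D" "t \<in> square_rels +>\<^bsub>square_free\<^esub> (s \<otimes>\<^bsub>square_free\<^esub> d)"
      by (auto simp: tensor_square_def FactRing_def rcoset_mult_def)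
    then obtain h where h: "h \<in> square_rels" "t = h + square_mult s d"
      by (auto simp: mem_square_free_coset mult_square_free)
    have "square_mult s d \<in> square_span (Suc k)"
      using sd prod.hyps by (intro square_span_mult Suc.IH Delta_elementD) auto
    then show ?case
      using h square_rels_subset_span[of "Suc k"]
      by (auto intro: diff_closed_setD(4)[OF diff_closed_set_square_span])
  next
    case (sum S S')
    then obtain s s' where "s \<in> S" "s' \<in> S'" "t = s + s'"
      by (auto simp: tensor_square_def FactRing_def set_add_def set_mult_def tensor_square_free_def)
    then show ?case
      using sum.IH by (auto intro: diff_closed_setD(4)[OF diff_closed_set_square_span])
  qed
qed

subsection \<open>Passing to $A\#V$\<close>

lemma to_sharp_eq:
  "to_sharp t \<eta> = linear_extension (\<lambda>(g, f) c. Poly_Mapping.single [fmul f \<eta>] (of_int c * g)) t"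
  by (simp add: to_sharp_def linear_extension_def case_prod_beta)

lemma to_sharp_diff: "to_sharp (s - t) \<eta> = to_sharp s \<eta> - to_sharp t \<eta>"
proof -
  have "to_sharp (s + t) \<eta> = to_sharp s \<eta> + to_sharp t \<eta>" for s t
    unfolding to_sharp_eq
    by (rule linear_extension_add[of _ UNIV]) (auto simp: distrib_right single_add simp del: func_zero times_fun_apply)
  from this[of "s - t" t] show ?thesis
    by simp
qed

lemma to_sharp_frag: "to_sharp (frag_of (g, f)) \<eta> = sharp \<eta> g f"
  unfolding to_sharp_eq sharp_def
  by (subst linear_extension_single) (auto simp del: func_zero times_fun_apply)

lemma to_sharp_mem_Delta_span:
  assumes "t \<in> square_span k" "\<eta> \<in> Der A"
  shows "to_sharp t \<eta> \<in> Delta_span k"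
proof -
  have "square_span k \<subseteq> {t. to_sharp t \<eta> \<in> Delta_span k}"
  proof (rule square_span_subset)
    show "square_rels \<subseteq> {t. to_sharp t \<eta> \<in> Delta_span k}"
      using square_rels_image[OF diff_closed_set_rels balanced_mod_sharp[OF assms(2)], of "\<lambda>t. to_sharp t \<eta>"]
        rels_subset_Delta_span[of k] by (auto simp: to_sharp_diff to_sharp_frag)
  next
    fix fs g h
    assume *: "set fs \<subseteq> A" "length fs = k" "g \<in> A" "h \<in> A"
    then have "to_sharp (antidiag (\<lambda>g h. frag_of (g, h)) fs g h) \<eta> = antidiag (sharp \<eta>) fs g h"
      by (subst antidiag_hom[of UNIV "\<lambda>t. to_sharp t \<eta>"])
        (auto simp: diff_closed_set_def to_sharp_diff to_sharp_frag)
    then show "antidiag (\<lambda>g h. frag_of (g, h)) fs g h \<in> {t. to_sharp t \<eta> \<in> Delta_span k}"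
      using antidiag_sharp_mem_Delta_span[of \<eta> fs g h] * assms(2) by simp
  qed (use diff_closed_setD[OF diff_closed_set_Delta_span] to_sharp_diff[of 0 0 \<eta>] in
      \<open>auto simp: diff_closed_set_def to_sharp_diff\<close>)
  then show ?thesis
    using assms(1) by blast
qed

end


section \<open>Rudakov modules\<close>

locale rudakov = function_algebra U A
  for U :: "'k::field_char_0 pt set" and A :: "'k fn set" +
  fixes n N :: nat
    and scale :: "'k \<Rightarrow> 'w::ab_group_add \<Rightarrow> 'w"
    and \<rho> :: "'k vf \<Rightarrow> 'w \<Rightarrow> 'w"
    and x :: "nat \<Rightarrow> 'k fn"
    and pd :: "nat \<Rightarrow> 'k fn \<Rightarrow> 'k fn"
    and P :: "'k pt"
  assumes vector_space: "vector_space scale"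
    and coordinate: "i < n \<Longrightarrow> x i \<in> A"
    and partial: "i < n \<Longrightarrow> pd i \<in> Der A"
    and point: "P \<in> U"
    and order: "N \<ge> 1"
begin

abbreviation B :: "('k der list \<Rightarrow>\<^sub>0 'k fn) set ring" where
  "B \<equiv> smash U A (Der A)"

abbreviation cls :: "('k der list \<Rightarrow>\<^sub>0 'k fn) \<Rightarrow> ('k der list \<Rightarrow>\<^sub>0 'k fn) set" where
  "cls \<equiv> smash_class U A (Der A)"

abbreviation T :: "((('k der list \<Rightarrow>\<^sub>0 'k fn) set \<times> 'w) \<Rightarrow>\<^sub>0 int) set" where
  "T \<equiv> rudakov_rels U A n N scale \<rho> x pd P"

abbreviation M :: "(('k der list \<Rightarrow>\<^sub>0 'k fn) set, ((('k der list \<Rightarrow>\<^sub>0 'k fn) set \<times> 'w) \<Rightarrow>\<^sub>0 int) set) module" where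
  "M \<equiv> rudakov_module U A n N scale \<rho> x pd P"

lemma ring_B: "ring B"
  unfolding smash_def by (rule ideal.quotient_is_ring[OF ideal_rels])

lemma cls_hom: "cls \<in> Ring.ring_hom (smash_free U A (Der A)) B"
  using ideal.rcos_ring_hom[OF ideal_rels] by (simp add: smash_def smash_class_def[abs_def])

lemma cls_closed: "p \<in> C \<Longrightarrow> cls p \<in> carrier B"
  by (rule ring_hom_closed[OF cls_hom])

lemma cls_add: "p \<in> C \<Longrightarrow> q \<in> C \<Longrightarrow> cls (p + q) = cls p \<oplus>\<^bsub>B\<^esub> cls q"
  using ring_hom_add[OF cls_hom] by (simp add: smash_free_simps)

lemma cls_mult: "p \<in> C \<Longrightarrow> q \<in> C \<Longrightarrow> cls (smash_mult p q) = cls p \<otimes>\<^bsub>B\<^esub> cls q"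
  using ring_hom_mult[OF cls_hom] by (simp add: mult_smash_free)

lemma cls_surj: "b \<in> carrier B \<Longrightarrow> \<exists>p\<in>C. b = cls p"
  by (auto simp: smash_def smash_class_def FactRing_def A_RCOSETS_def')

lemma cls_rels: "p \<in> rels \<Longrightarrow> cls p = \<zero>\<^bsub>B\<^esub>"
  using diff_closed_set_translate[OF diff_closed_set_rels, of p]
  by (simp add: smash_def smash_class_def FactRing_def a_r_coset_def r_coset_def smash_free_simps
      setcompr_eq_image[symmetric] UNION_singleton_eq_range)

lemma max_ideal_V_subset: "max_ideal_V A P \<subseteq> Der A"
proof
  have zero: "0 \<in> Der A"
    by (auto simp: Der_def zero_closed cscale_def fun_eq_iff)
  fix D assume "D \<in> max_ideal_V A P"
  then show "D \<in> Der A"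
    unfolding max_ideal_V_def
  proof induction
    case (base D)
    then show ?case
      using zero by (auto intro: Der_fmul_closed)
  next
    case (diff D E)
    have "D - E = D + (\<lambda>h. cscale (-1) (E h))"
      by (simp add: fun_eq_iff cscale_def)
    moreover have "D + (\<lambda>h. cscale (-1) (E h)) \<in> Der A"
      by (intro Der_add_closed Der_cscale_closed diff.IH)
    ultimately show ?case
      by (simp only:)
  qed
qed

lemma subalgebra_subset: "carrier (smash_free U A (max_ideal_V A P)) \<subseteq> C"
proof
  fix p assume "p \<in> carrier (smash_free U A (max_ideal_V A P))"
  then have "Poly_Mapping.keys p \<subseteq> lists (max_ideal_V A P)" "range (Poly_Mapping.lookup p) \<subseteq> A"
    by (simp_all add: smash_free_def)
  with order.trans[OF _ lists_mono[OF max_ideal_V_subset]] show "p \<in> C"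
    unfolding mem_C_iff by blast
qed

lemma diff_closed_set_T: "diff_closed_set T"
  unfolding rudakov_rels_def tensor_rels_def by (rule diff_closed_set_group_closure)

lemma T_add:
  "a \<in> carrier B \<Longrightarrow> a' \<in> carrier B \<Longrightarrow> frag_of (a \<oplus>\<^bsub>B\<^esub> a', w) - frag_of (a, w) - frag_of (a', w) \<in> T"
  unfolding rudakov_rels_def tensor_rels_def by (rule group_closure.base) blast

lemma T_balanced:
  "a \<in> carrier B \<Longrightarrow> c \<in> carrier (smash_free U A (max_ideal_V A P)) \<Longrightarrow>
    frag_of (a \<otimes>\<^bsub>B\<^esub> cls c, w) - frag_of (a, smash_action n N scale \<rho> x pd P c w) \<in> T"
  unfolding rudakov_rels_def tensor_rels_def by (rule group_closure.base) blast

lemma T_zero_right: "a \<in> carrier B \<Longrightarrow> frag_of (a, 0) \<in> T"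
proof -
  assume "a \<in> carrier B"
  then have "frag_of (a, 0 + 0) - frag_of (a, 0) - frag_of (a, 0) \<in> T"
    unfolding rudakov_rels_def tensor_rels_def by (intro group_closure.base) blast
  from diff_closed_setD(3)[OF diff_closed_set_T this] show ?thesis
    by simp
qed

lemma T_zero_left: "frag_of (\<zero>\<^bsub>B\<^esub>, w) \<in> T"
proof -
  interpret B: ring B
    by (rule ring_B)
  have "frag_of (\<zero>\<^bsub>B\<^esub> \<oplus>\<^bsub>B\<^esub> \<zero>\<^bsub>B\<^esub>, w) - frag_of (\<zero>\<^bsub>B\<^esub>, w) - frag_of (\<zero>\<^bsub>B\<^esub>, w) \<in> T"
    by (intro T_add B.zero_closed)
  from diff_closed_setD(3)[OF diff_closed_set_T this] show ?thesis
    by simp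
qed

lemma T_subset: "t \<in> T \<Longrightarrow> Poly_Mapping.keys t \<subseteq> carrier B \<times> UNIV"
proof -
  interpret B: ring B
    by (rule ring_B)
  have sub: "Poly_Mapping.keys (u - v) \<subseteq> carrier B \<times> UNIV"
    if "Poly_Mapping.keys u \<subseteq> carrier B \<times> UNIV" "Poly_Mapping.keys v \<subseteq> carrier B \<times> UNIV"
    for u v :: "(('k der list \<Rightarrow>\<^sub>0 'k fn) set \<times> 'w) \<Rightarrow>\<^sub>0 int"
    using that keys_diff[of u v] by blast
  have cls: "cls c \<in> carrier B" if "c \<in> carrier (smash_free U A (max_ideal_V A P))" for c
    using that subalgebra_subset by (auto intro: cls_closed)
  assume "t \<in> T"
  then show ?thesis
    unfolding rudakov_rels_def tensor_rels_def
  proof induction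
    case (base s)
    then show ?case
      by (elim insertE UnE CollectE exE conjE; simp) (intro sub; simp add: cls)+
  qed (rule sub)
qed

text \<open>The elements \<open>p\<close> with $b p \otimes w = 0$ in the Rudakov module for all \<open>b\<close> and \<open>w\<close>.  Including
  the factor \<open>b\<close> makes this a left ideal by definition and allows working with the relations on the
  generators $b \otimes w$, before the action on the quotient is considered.\<close>

definition annihilator :: "('k der list \<Rightarrow>\<^sub>0 'k fn) set" where
  "annihilator = {p \<in> C. \<forall>b\<in>carrier B. \<forall>w. frag_of (b \<otimes>\<^bsub>B\<^esub> cls p, w) \<in> T}"

lemma diff_closed_set_annihilator: "diff_closed_set annihilator"
proof -
  interpret B: ring B
    by (rule ring_B)
  have "0 \<in> annihilator"
    using cls_rels[OF rels_zero] T_zero_left by (simp add: annihilator_def C_zero)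
  moreover have "p - q \<in> annihilator" if p: "p \<in> annihilator" and q: "q \<in> annihilator" for p q
  proof -
    have C: "p \<in> C" "q \<in> C" "p - q \<in> C"
      using p q by (auto simp: annihilator_def intro: C_diff)
    have "frag_of (b \<otimes>\<^bsub>B\<^esub> cls (p - q), w) \<in> T" if b: "b \<in> carrier B" for b w
    proof -
      have "b \<otimes>\<^bsub>B\<^esub> cls p = b \<otimes>\<^bsub>B\<^esub> cls (p - q) \<oplus>\<^bsub>B\<^esub> b \<otimes>\<^bsub>B\<^esub> cls q"
        using cls_add[OF C(3,2)] C b by (simp add: B.r_distr cls_closed)
      then have sum: "frag_of (b \<otimes>\<^bsub>B\<^esub> cls p, w) - frag_of (b \<otimes>\<^bsub>B\<^esub> cls (p - q), w)
          - frag_of (b \<otimes>\<^bsub>B\<^esub> cls q, w) \<in> T"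
        using T_add[of "b \<otimes>\<^bsub>B\<^esub> cls (p - q)" "b \<otimes>\<^bsub>B\<^esub> cls q" w] C b by (simp add: cls_closed)
      have "frag_of (b \<otimes>\<^bsub>B\<^esub> cls p, w) \<in> T" "frag_of (b \<otimes>\<^bsub>B\<^esub> cls q, w) \<in> T"
        using p q b by (simp_all add: annihilator_def)
      from diff_closed_setD(2)[OF diff_closed_set_T diff_closed_setD(2)[OF diff_closed_set_T this] sum]
      show ?thesis
        by simp
    qed
    then show ?thesis
      using C by (simp add: annihilator_def)
  qed
  ultimately show ?thesis
    by (simp add: diff_closed_set_def)
qed

lemma annihilator_left_ideal:
  assumes "p \<in> C" "q \<in> annihilator"
  shows "smash_mult p q \<in> annihilator"
proof -
  interpret B: ring B
    by (rule ring_B)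
  show ?thesis
    using assms by (auto simp: annihilator_def C_smash_mult cls_mult cls_closed B.m_assoc[symmetric])
qed

lemma rels_subset_annihilator: "rels \<subseteq> annihilator"
proof -
  interpret B: ring B
    by (rule ring_B)
  show ?thesis
    using rels_subset_C T_zero_left by (auto simp: annihilator_def cls_rels)
qed

text \<open>For \<open>c\<close> in the subalgebra, $b c \otimes w = b \otimes c w$.\<close>

lemma annihilatorI:
  assumes "c \<in> carrier (smash_free U A (max_ideal_V A P))"
    and "\<And>w. smash_action n N scale \<rho> x pd P c w = 0"
  shows "c \<in> annihilator"
proof -
  have "frag_of (b \<otimes>\<^bsub>B\<^esub> cls c, w) \<in> T" if "b \<in> carrier B" for b w
    using diff_closed_setD(4)[OF diff_closed_set_T T_balanced[OF that assms(1), of w] T_zero_right[OF that]]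
    by (simp add: assms(2))
  then show ?thesis
    using assms(1) subalgebra_subset by (auto simp: annihilator_def)
qed

lemma smash_action_single:
  "smash_action n N scale \<rho> x pd P (Poly_Mapping.single u f) w
    = scale (f P) (foldr (vf_action n N scale \<rho> x pd P) u w)"
proof -
  interpret vector_space scale
    by (rule vector_space)
  show ?thesis
    by (cases "f = 0") (simp_all add: smash_action_def)
qed

lemma single_mem_subalgebra:
  "set u \<subseteq> max_ideal_V A P \<Longrightarrow> f \<in> A \<Longrightarrow>
    Poly_Mapping.single u f \<in> carrier (smash_free U A (max_ideal_V A P))"
  by (auto simp: smash_free_def lookup_single when_def zero_closed)

lemma fmul_mem_max_ideal_V: "\<eta> \<in> Der A \<Longrightarrow> h \<in> A \<Longrightarrow> h P = 0 \<Longrightarrow> fmul h \<eta> \<in> max_ideal_V A P"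
  unfolding max_ideal_V_def by (rule group_closure.base) blast

text \<open>Taylor coefficients of order at most \<open>N\<close> of a function in $\mathfrak{m}_P^{N+1}$ are zero.\<close>

lemma vf_action_vanishing:
  assumes "\<eta> \<in> Der A" "h \<in> A" "vanishes A P (Suc N) h"
  shows "vf_action n N scale \<rho> x pd P (fmul h \<eta>) w = 0"
proof -
  interpret vector_space scale
    by (rule vector_space)
  have "pd_pow n pd s (fmul h \<eta> (x i)) P = 0"
    if i: "i < n" and s: "Poly_Mapping.keys s \<subseteq> {..<n}" "mdeg s \<le> N" for i s
  proof (rule vanishes_pd_pow[OF partial _ _ s(1)])
    have x: "\<eta> (x i) \<in> A"
      by (rule Der_closed[OF assms(1) coordinate[OF i]])
    then show "fmul h \<eta> (x i) \<in> A"
      using assms(2) by (simp add: fmul_def mult_closed)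
    show "vanishes A P (Suc (mdeg s)) (fmul h \<eta> (x i))"
      unfolding fmul_def using x assms(2) s(2)
      by (intro vanishes_mult vanishes_mono[OF _ assms(3)]) simp_all
  qed
  then show ?thesis
    unfolding vf_action_def by (intro sum.neutral ballI) simp
qed

lemma Delta_span_subset_annihilator: "Delta_span (Suc N) \<subseteq> annihilator"
proof (rule Delta_span_subset_left_ideal[OF diff_closed_set_annihilator rels_subset_annihilator
      annihilator_left_ideal _ _ _ point order])
  interpret vector_space scale
    by (rule vector_space)
  fix f assume "f \<in> A" "f P = 0"
  then show "Poly_Mapping.single [] f \<in> annihilator"
    by (intro annihilatorI single_mem_subalgebra) (simp_all add: smash_action_single)
next
  interpret vector_space scale
    by (rule vector_space)
  fix \<eta> g h assume "\<eta> \<in> Der A" "g \<in> A" "h \<in> A" "g P = 0" "h P = 0"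
  then show "sharp \<eta> g h \<in> annihilator"
    unfolding sharp_def
    by (intro annihilatorI single_mem_subalgebra) (simp_all add: smash_action_single fmul_mem_max_ideal_V)
next
  interpret vector_space scale
    by (rule vector_space)
  fix \<eta> g h assume "\<eta> \<in> Der A" "g \<in> A" "h \<in> A" "vanishes A P (Suc N) h"
  moreover from this have "h P = 0"
    by simp
  ultimately show "sharp \<eta> g h \<in> annihilator"
    unfolding sharp_def
    by (intro annihilatorI single_mem_subalgebra)
      (simp_all add: smash_action_single fmul_mem_max_ideal_V vf_action_vanishing del: vanishes.simps)
qed

text \<open>Every generator $b \otimes w$ is killed: \<open>b\<close> is the class of some \<open>q\<close>, and $p q$ lies in the left
  ideal \<open>annihilator\<close> because \<open>p\<close> can be moved past \<open>q\<close>.\<close>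

lemma Delta_span_acts_by_zero:
  assumes "p \<in> Delta_span (Suc N)" "r \<in> carrier M"
  shows "cls p \<odot>\<^bsub>M\<^esub> r = \<zero>\<^bsub>M\<^esub>"
proof -
  interpret B: ring B
    by (rule ring_B)
  let ?F = "free_Abelian_group (carrier B \<times> UNIV) :: ((('k der list \<Rightarrow>\<^sub>0 'k fn) set \<times> 'w) \<Rightarrow>\<^sub>0 int) monoid"
  let ?L = "frag_extend (\<lambda>(b, w). frag_of (cls p \<otimes>\<^bsub>B\<^esub> b, w :: 'w))"
  have p: "p \<in> C"
    using assms(1) Delta_span_subset_C by blast
  have "frag_of (cls p \<otimes>\<^bsub>B\<^esub> b, w) \<in> T" if b: "b \<in> carrier B" for b w
  proof -
    obtain q where q: "q \<in> C" "b = cls q"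
      using cls_surj[OF b] by blast
    have "smash_mult p q \<in> annihilator"
      using assms(1) q(1)
      by (intro Delta_span_mult_mem[OF diff_closed_set_annihilator annihilator_left_ideal
            Delta_span_subset_annihilator]) auto
    then have "frag_of (\<one>\<^bsub>B\<^esub> \<otimes>\<^bsub>B\<^esub> cls (smash_mult p q), w) \<in> T"
      unfolding annihilator_def using B.one_closed by blast
    then show ?thesis
      using p q by (simp add: cls_mult cls_closed)
  qed
  note generator = this
  have L: "?L t \<in> T" if "Poly_Mapping.keys t \<subseteq> carrier B \<times> UNIV" for t
    using that
    by (induction rule: frag_induction)
      (auto simp: frag_extend_diff generator diff_closed_setD[OF diff_closed_set_T])
  have coset: "T #>\<^bsub>?F\<^esub> a = (\<lambda>t. t + a) ` T" for a
    by (auto simp: r_coset_def)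
  have T_coset: "T #>\<^bsub>?F\<^esub> a = T" if "a \<in> T" for a
    unfolding coset by (rule diff_closed_set_translate[OF diff_closed_set_T that])
  obtain a where a: "Poly_Mapping.keys a \<subseteq> carrier B \<times> UNIV" "r = T #>\<^bsub>?F\<^esub> a"
    using assms(2) by (auto simp: rudakov_module_def Let_def FactGroup_def RCOSETS_def)
  have "?L t \<in> T" if t: "t \<in> r" for t
  proof -
    obtain s where s: "s \<in> T" "t = s + a"
      using t unfolding a(2) coset by blast
    then show ?thesis
      using keys_add[of s a] T_subset[OF s(1)] a(1) by (intro L) blast
  qed
  then have "(\<Union>t\<in>r. T #>\<^bsub>?F\<^esub> ?L t) = (\<Union>t\<in>r. T)"
    using T_coset by (intro SUP_cong refl) blast
  moreover have "r \<noteq> {}"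
    using diff_closed_setD(1)[OF diff_closed_set_T] by (auto simp: a(2) coset)
  ultimately show ?thesis
    by (simp add: rudakov_module_def Let_def FactGroup_def)
qed

theorem rudakov_annihilated:
  shows "differentiable_module U A M" "annihilates (Delta_pow_V U A (N + 1)) M"
proof -
  show "differentiable_module U A M"
    unfolding differentiable_module_def annihilates_def
    using Delta_span_acts_by_zero diff_element_mem_Delta_span
    by (intro exI[of _ "Suc N"]) auto
  interpret B: ring B
    by (rule ring_B)
  have "\<exists>p\<in>Delta_span (Suc N). b = cls p" if "b \<in> Delta_pow_V U A (Suc N)" for b
    using that unfolding Delta_pow_V_def
  proof (induction rule: generate.induct)
    case one
    show ?case
      using cls_rels[OF rels_zero] diff_closed_setD(1)[OF diff_closed_set_Delta_span]
      by (intro bexI[of _ 0]) auto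
  next
    case (incl b)
    then show ?case
      using to_sharp_mem_Delta_span Delta_pow_elementD by blast
  next
    case (inv b)
    then obtain p where p: "p \<in> Delta_span (Suc N)" "b = cls p"
      using to_sharp_mem_Delta_span Delta_pow_elementD by blast
    then have C: "p \<in> C" "- p \<in> C" "- p \<in> Delta_span (Suc N)"
      using Delta_span_subset_C by (auto intro: C_uminus diff_closed_setD(3)[OF diff_closed_set_Delta_span])
    have "cls (- p) \<oplus>\<^bsub>B\<^esub> cls p = \<zero>\<^bsub>B\<^esub>"
      using cls_add[OF C(2,1)] cls_rels[OF rels_zero] by simp
    then have "\<ominus>\<^bsub>B\<^esub> cls p = cls (- p)"
      using C by (intro B.minus_equality) (auto simp: cls_closed)
    then show ?case
      using C p by (auto simp: a_inv_def)
  next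
    case (eng b b')
    then obtain p p' where p: "p \<in> Delta_span (Suc N)" "p' \<in> Delta_span (Suc N)" "b = cls p" "b' = cls p'"
      by blast
    moreover have "p + p' \<in> Delta_span (Suc N)"
      using p by (intro diff_closed_setD(4)[OF diff_closed_set_Delta_span])
    moreover have "cls (p + p') = cls p \<oplus>\<^bsub>B\<^esub> cls p'"
      using p Delta_span_subset_C by (intro cls_add) auto
    ultimately show ?case
      by auto
  qed
  then show "annihilates (Delta_pow_V U A (N + 1)) M"
    using Delta_span_acts_by_zero by (auto simp: annihilates_def)
qed

end


section \<open>The algebra of regular functions\<close>

definition monomial_eval :: "('x \<Rightarrow> 'k::comm_ring_1) \<Rightarrow> ('x \<Rightarrow>\<^sub>0 nat) \<Rightarrow> 'k" where
  "monomial_eval v s = (\<Prod>i\<in>Poly_Mapping.keys s. v i ^ Poly_Mapping.lookup s i)"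

lemma peval_eq: "peval v p = linear_extension (\<lambda>s c. c * monomial_eval v s) p"
  by (simp add: peval_def linear_extension_def monomial_eval_def)

lemma monomial_eval_add: "monomial_eval v (s + t) = monomial_eval v s * monomial_eval v t"
proof -
  let ?S = "Poly_Mapping.keys s \<union> Poly_Mapping.keys t"
  have superset: "monomial_eval v u = (\<Prod>i\<in>?S. v i ^ Poly_Mapping.lookup u i)"
    if "Poly_Mapping.keys u \<subseteq> ?S" for u
    unfolding monomial_eval_def by (rule prod.mono_neutral_left) (use that in \<open>auto simp: in_keys_iff\<close>)
  show ?thesis
    by (simp add: superset keys_add lookup_add power_add prod.distrib)
qed

lemma peval_zero: "peval v 0 = 0"
  by (simp add: peval_eq)

lemma peval_add: "peval v (p + q) = peval v p + peval v q"
  unfolding peval_eq by (rule linear_extension_add[of _ UNIV]) (simp_all add: distrib_right)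

lemma peval_single: "peval v (Poly_Mapping.single s c) = c * monomial_eval v s"
  unfolding peval_eq by (rule linear_extension_single) simp

lemma peval_mult: "peval v (p * q) = peval v p * peval v q"
proof -
  have "peval v (Poly_Mapping.single s c * q) = peval v (Poly_Mapping.single s c) * peval v q" for s c
    using subset_UNIV[of "Poly_Mapping.keys q"] subset_UNIV[of "range (Poly_Mapping.lookup q)"]
  proof (induction q rule: poly_mapping_carrier_induct)
    case (add t d q)
    have "peval v (Poly_Mapping.single s c * Poly_Mapping.single t d)
        = peval v (Poly_Mapping.single s c) * peval v (Poly_Mapping.single t d)"
      by (simp add: mult_single peval_single monomial_eval_add ac_simps)
    with add show ?case
      by (simp add: distrib_left peval_add)
  qed (simp_all add: peval_zero mult_single peval_single monomial_eval_add ac_simps)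
  with subset_UNIV[of "Poly_Mapping.keys p"] subset_UNIV[of "range (Poly_Mapping.lookup p)"]
  show ?thesis
  proof (induction p rule: poly_mapping_carrier_induct)
    case (add t d p)
    then show ?case
      by (simp add: distrib_right peval_add)
  qed (simp_all add: peval_zero)
qed

lemma peval_constant: "peval v (Poly_Mapping.single 0 c) = c"
  by (simp add: peval_single monomial_eval_def)

lemma mdeg_add: "mdeg (s + t) = mdeg s + mdeg t"
proof -
  let ?S = "Poly_Mapping.keys s \<union> Poly_Mapping.keys t"
  have superset: "mdeg u = (\<Sum>i\<in>?S. Poly_Mapping.lookup u i)" if "Poly_Mapping.keys u \<subseteq> ?S" for u
    unfolding mdeg_def by (rule sum.mono_neutral_left) (use that in \<open>auto simp: in_keys_iff\<close>)
  show ?thesis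
    by (simp add: superset keys_add lookup_add sum.distrib)
qed

lemma homogeneous_mult: "homogeneous d p \<Longrightarrow> homogeneous e q \<Longrightarrow> homogeneous (d + e) (p * q)"
  using keys_mult[of p q] by (fastforce simp: homogeneous_def mdeg_add)

lemma homogeneous_add: "homogeneous d p \<Longrightarrow> homogeneous d q \<Longrightarrow> homogeneous d (p + q)"
  using keys_add[of p q] by (auto simp: homogeneous_def)

lemma homogeneous_constant: "homogeneous 0 (Poly_Mapping.single 0 c)"
  by (simp add: homogeneous_def mdeg_def)

definition is_fraction ::
  "'k::field pt set \<Rightarrow> 'k fn \<Rightarrow> nat \<Rightarrow> (nat, 'k) mpoly \<Rightarrow> (nat, 'k) mpoly \<Rightarrow> bool" where
  "is_fraction W f d F G \<longleftrightarrow> homogeneous d F \<and> homogeneous d G \<and>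
     (\<forall>q\<in>W. \<forall>v\<in>q. peval v G \<noteq> 0 \<and> f q = peval v F / peval v G)"

lemma regular_iff:
  "f \<in> regular m U \<longleftrightarrow> (\<forall>q. q \<notin> U \<longrightarrow> f q = 0) \<and>
     (\<forall>p\<in>U. \<exists>W d F G. openin (subtopology (zariski m) U) W \<and> p \<in> W \<and> is_fraction W f d F G)"
  unfolding regular_def is_fraction_def by simp

lemma is_fraction_cscale:
  "is_fraction W f d F G \<Longrightarrow> is_fraction W (cscale c f) d (Poly_Mapping.single 0 c * F) G"
  using homogeneous_mult[OF homogeneous_constant, of d F c]
  by (auto simp: is_fraction_def cscale_def peval_mult peval_constant)

lemma is_fraction_add:
  assumes "is_fraction W f d F G" "is_fraction W' g e H K"
  shows "is_fraction (W \<inter> W') (f + g) (d + e) (F * K + G * H) (G * K)"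
proof -
  have "homogeneous (d + e) (F * K + G * H)" "homogeneous (d + e) (G * K)"
    using assms by (auto simp: is_fraction_def intro: homogeneous_add homogeneous_mult)
  moreover have "peval v (G * K) \<noteq> 0 \<and> (f + g) q = peval v (F * K + G * H) / peval v (G * K)"
    if "q \<in> W \<inter> W'" "v \<in> q" for q v
  proof -
    have "peval v G \<noteq> 0" "peval v K \<noteq> 0" "f q = peval v F / peval v G" "g q = peval v H / peval v K"
      using assms that unfolding is_fraction_def by blast+
    then show ?thesis
      by (simp add: peval_add peval_mult field_simps)
  qed
  ultimately show ?thesis
    unfolding is_fraction_def by blast
qed

lemma is_fraction_mult:
  assumes "is_fraction W f d F G" "is_fraction W' g e H K"
  shows "is_fraction (W \<inter> W') (f * g) (d + e) (F * H) (G * K)"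
proof -
  have "homogeneous (d + e) (F * H)" "homogeneous (d + e) (G * K)"
    using assms by (auto simp: is_fraction_def intro: homogeneous_mult)
  moreover have "peval v (G * K) \<noteq> 0 \<and> (f * g) q = peval v (F * H) / peval v (G * K)"
    if "q \<in> W \<inter> W'" "v \<in> q" for q v
  proof -
    have "peval v G \<noteq> 0" "peval v K \<noteq> 0" "f q = peval v F / peval v G" "g q = peval v H / peval v K"
      using assms that unfolding is_fraction_def by blast+
    then show ?thesis
      by (simp add: peval_mult)
  qed
  ultimately show ?thesis
    unfolding is_fraction_def by blast
qed

lemma is_fraction_indicator:
  "is_fraction U (indicator U) 0 (Poly_Mapping.single 0 1) (Poly_Mapping.single 0 1)"
  by (simp add: is_fraction_def homogeneous_constant peval_constant del: single_one)

text \<open>Local presentations by fractions are combined on the intersection of their domains over the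
  common denominator, which keeps numerator and denominator homogeneous of equal degree.\<close>

lemma function_algebra_regular:
  fixes U :: "'k::field pt set"
  assumes "U \<subseteq> topspace (zariski m)"
  shows "function_algebra U (regular m U)"
proof
  fix f q
  assume "f \<in> regular m U" "q \<notin> U"
  then show "f q = 0"
    by (simp add: regular_iff)
next
  fix f :: "'k fn" and c :: 'k
  assume "f \<in> regular m U"
  then show "cscale c f \<in> regular m U"
    unfolding regular_iff
    using is_fraction_cscale by (fastforce simp: cscale_def)
next
  fix f g :: "'k fn"
  assume fg: "f \<in> regular m U" "g \<in> regular m U"
  have "\<exists>W d F G. openin (subtopology (zariski m) U) W \<and> p \<in> W \<and> is_fraction W (f + g) d F G"
    "\<exists>W d F G. openin (subtopology (zariski m) U) W \<and> p \<in> W \<and> is_fraction W (f * g) d F G"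
    if p: "p \<in> U" for p
  proof -
    obtain W d F G where f: "openin (subtopology (zariski m) U) W" "p \<in> W" "is_fraction W f d F G"
      using fg(1) p unfolding regular_iff by blast
    obtain W' e H K where g: "openin (subtopology (zariski m) U) W'" "p \<in> W'" "is_fraction W' g e H K"
      using fg(2) p unfolding regular_iff by blast
    have "openin (subtopology (zariski m) U) (W \<inter> W')" "p \<in> W \<inter> W'"
      using f g by (auto intro: openin_Int)
    then show "\<exists>W d F G. openin (subtopology (zariski m) U) W \<and> p \<in> W \<and> is_fraction W (f + g) d F G"
      "\<exists>W d F G. openin (subtopology (zariski m) U) W \<and> p \<in> W \<and> is_fraction W (f * g) d F G"
      using is_fraction_add[OF f(3) g(3)] is_fraction_mult[OF f(3) g(3)] by blast+
  qed
  then show "f + g \<in> regular m U" "f * g \<in> regular m U"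
    using fg unfolding regular_iff by auto
next
  have "openin (subtopology (zariski m) U) U"
    using assms by (simp add: openin_subtopology_refl)
  then show "indicator U \<in> regular m U"
    unfolding regular_iff using is_fraction_indicator[of U] by auto
qed

theorem lemma22:
  fixes X U :: "'k::{alg_closed_field, field_char_0} pt set"
    and m n N :: nat
    and P :: "'k pt"
    and x :: "nat \<Rightarrow> 'k fn"
    and pd :: "nat \<Rightarrow> 'k fn \<Rightarrow> 'k fn"
    and scale :: "'k \<Rightarrow> 'w::ab_group_add \<Rightarrow> 'w"
    and \<rho> :: "'k vf \<Rightarrow> 'w \<Rightarrow> 'w"
  assumes "quasi_projective m X"
    and "irreducible_in (zariski m) X"
    and "smooth_of_dim m n X"
    and "etale_chart m X n U x pd"
    and "P \<in> U"
    and "rational_Lplus_module n scale \<rho>"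
    and "N \<ge> 1"
    and "\<forall>v\<in>max_pow_Lplus n N. \<forall>w. \<rho> v w = 0"
  shows "differentiable_module U (regular m U)
           (rudakov_module U (regular m U) n N scale \<rho> x pd P) \<and>
         annihilates (Delta_pow_V U (regular m U) (N + 1))
           (rudakov_module U (regular m U) n N scale \<rho> x pd P)"
proof -
  have "openin (subtopology (zariski m) X) U"
    using assms(4) by (simp add: etale_chart_def)
  then have "U \<subseteq> topspace (zariski m)"
    using openin_subset by fastforce
  then interpret function_algebra U "regular m U"
    by (rule function_algebra_regular)
  obtain Basis where "finite_dimensional_vector_space scale Basis"
    using assms(6) by (auto simp: rational_Lplus_module_def fd_Lplus_module_def)
  then interpret rudakov U "regular m U" n N scale \<rho> x pd P
    using assms(4,5,7)
    by unfold_locales (auto simp: etale_chart_def finite_dimensional_vector_space_def vector_space_def)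
  show ?thesis
    using rudakov_annihilated by blast
qed

end
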